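(* Let $p\in\mathbb{C}[z_1,z_2]$ be a semi-stable bivariate polynomial of bidegree $n=(n_1,n_2)\neq(0,0)$ with $p(0,0)=1$. Then $p$ is self-reversive up to a unimodular constant if and only if there exists a unitary matrix $K\in\mathbb{C}^{(n_1+n_2)\times(n_1+n_2)}$ such that $$p(z_1,z_2)=\det\bigl(I_{|n|}-KZ_n\bigr),$$ where $|n|=n_1+n_2$ and $Z_n=z_1I_{n_1}\oplus z_2I_{n_2}$.
   Context: The bidegree of $p\in\mathbb{C}[z_1,z_2]$ is the pair $\deg p=(\deg_1 p,\deg_2 p)$ of its partial degrees in $z_1$ and $z_2$. A bivariate polynomial is semi-stable if it has no zeros in the open unit bidisk $\mathbb{D}^2=\{(z_1,z_2)\in\mathbb{C}^2: |z_1|<1,\ |z_2|<1\}$. The reverse of a polynomial $p$ of bidegree $(n_1,n_2)$ is the polynomial $$\overleftarrow{p}(z_1,z_2)=z_1^{n_1}z_2^{n_2}\,\overline{p(1/\bar z_1,1/\bar z_2)}.$$ $p$ is self-reversive up to a unimodular constant if $\overleftarrow{p}=\alpha p$ for some $\alpha\in\mathbb{C}$ with $|\alpha|=1$. $I_m$ is the $m\times m$ identity matrix, and $z_1I_{n_1}\oplus z_2I_{n_2}$ is the diagonal matrix with $n_1$ diagonal entries $z_1$ followed by $n_2$ diagonal entries $z_2$ (a block is absent if its size is $0$). *)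

theory Defs
  imports
    "HOL-Computational_Algebra.Polynomial"
    "Jordan_Normal_Form.Schur_Decomposition"
    Complex_Main
begin

text \<open>
  A polynomial in \<open>\<complex>[z\<^sub>1, z\<^sub>2]\<close> is represented as an element of \<open>\<complex>[z\<^sub>1][z\<^sub>2]\<close>: the outer
  variable is \<open>z\<^sub>2\<close>, and the coefficients are polynomials in \<open>z\<^sub>1\<close>.
\<close>

type_synonym bipoly = "complex poly poly"

definition eval2 :: "bipoly \<Rightarrow> complex \<Rightarrow> complex \<Rightarrow> complex" where
  "eval2 p z1 z2 = poly (poly p [:z2:]) z1"

definition deg1 :: "bipoly \<Rightarrow> nat" where
  "deg1 p = Max ((\<lambda>j. degree (coeff p j)) ` {..degree p})"

definition deg2 :: "bipoly \<Rightarrow> nat" where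
  "deg2 p = degree p"

definition semi_stable :: "bipoly \<Rightarrow> bool" where
  "semi_stable p \<longleftrightarrow> (\<forall>z1 z2. norm z1 < 1 \<and> norm z2 < 1 \<longrightarrow> eval2 p z1 z2 \<noteq> 0)"

text \<open>
  The defining formula of the reverse makes sense only for nonzero arguments; it determines
  a unique polynomial, by lemma \<open>ex1_is_reverse\<close> below.
\<close>

definition is_reverse :: "bipoly \<Rightarrow> bipoly \<Rightarrow> bool" where
  "is_reverse p q \<longleftrightarrow> (\<forall>z1 z2. z1 \<noteq> 0 \<longrightarrow> z2 \<noteq> 0 \<longrightarrow>
     eval2 q z1 z2 = z1 ^ deg1 p * z2 ^ deg2 p * cnj (eval2 p (1 / cnj z1) (1 / cnj z2)))"

definition reverse :: "bipoly \<Rightarrow> bipoly" where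
  "reverse p = (THE q. is_reverse p q)"

definition self_reversive :: "bipoly \<Rightarrow> bool" where
  "self_reversive p \<longleftrightarrow> (\<exists>\<alpha>::complex. norm \<alpha> = 1 \<and> reverse p = smult [:\<alpha>:] p)"

definition unitary_mat :: "nat \<Rightarrow> complex mat \<Rightarrow> bool" where
  "unitary_mat m K \<longleftrightarrow> K \<in> carrier_mat m m \<and>
     mat_adjoint K * K = 1\<^sub>m m \<and> K * mat_adjoint K = 1\<^sub>m m"

definition Z_mat :: "nat \<Rightarrow> nat \<Rightarrow> complex \<Rightarrow> complex \<Rightarrow> complex mat" where
  "Z_mat n1 n2 z1 z2 = diag_block_mat [z1 \<cdot>\<^sub>m 1\<^sub>m n1, z2 \<cdot>\<^sub>m 1\<^sub>m n2]"

lemma eval2_smult: "eval2 (smult [:c:] p) z1 z2 = c * eval2 p z1 z2"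
  by (simp add: eval2_def)

lemma degree_coeff_le_deg1: "degree (coeff p j) \<le> deg1 p"
proof (cases "j \<le> degree p")
  case True
  then show ?thesis unfolding deg1_def by (intro Max_ge) auto
qed (simp add: coeff_eq_0)

lemma eval2_as_sum:
  "eval2 p z1 z2 = (\<Sum>j\<le>deg2 p. \<Sum>i\<le>deg1 p. coeff (coeff p j) i * z1 ^ i * z2 ^ j)"
proof -
  have inner: "poly (coeff p j) z1 = (\<Sum>i\<le>deg1 p. coeff (coeff p j) i * z1 ^ i)" for j
  proof -
    have "coeff p j = (\<Sum>i\<le>deg1 p. monom (coeff (coeff p j) i) i)"
      using poly_as_sum_of_monoms'[OF degree_coeff_le_deg1[of p j]] by simp
    then have "poly (coeff p j) z1 = poly (\<Sum>i\<le>deg1 p. monom (coeff (coeff p j) i) i) z1"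
      by simp
    then show ?thesis by (simp only: poly_sum poly_monom)
  qed
  have "eval2 p z1 z2 = (\<Sum>j\<le>deg2 p. poly (coeff p j) z1 * z2 ^ j)"
    unfolding eval2_def deg2_def by (simp add: poly_altdef[of p] poly_sum)
  then show ?thesis by (simp add: inner sum_distrib_right)
qed

lemma eval2_eqI:
  assumes "\<And>z1 z2. z1 \<noteq> 0 \<Longrightarrow> z2 \<noteq> 0 \<Longrightarrow> eval2 p z1 z2 = eval2 q z1 z2"
  shows "p = q"
proof -
  have inf: "infinite {z::complex. z \<noteq> 0}"
    using infinite_UNIV_char_0[where 'a = complex] finite_compl[of "{0::complex}"]
    by (auto simp: Compl_eq)
  have univ: "f = g" if "\<And>z. z \<noteq> 0 \<Longrightarrow> poly f z = poly g z" for f g :: "complex poly"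
  proof (rule ccontr)
    assume "f \<noteq> g"
    then have "finite {z. poly (f - g) z = 0}" by (intro poly_roots_finite) simp
    moreover have "{z. z \<noteq> 0} \<subseteq> {z. poly (f - g) z = 0}" using that by auto
    ultimately show False using inf finite_subset by blast
  qed
  have outer: "poly (p - q) [:z2:] = 0" if "z2 \<noteq> 0" for z2
    using univ[of "poly p [:z2:]" "poly q [:z2:]"] assms that by (simp add: eval2_def)
  show ?thesis
  proof (rule ccontr)
    assume "p \<noteq> q"
    then have "finite {w. poly (p - q) w = 0}" by (intro poly_roots_finite) simp
    moreover have "(\<lambda>z. [:z:]) ` {z. z \<noteq> 0} \<subseteq> {w. poly (p - q) w = 0}" using outer by auto
    ultimately have "finite ((\<lambda>z::complex. [:z:]) ` {z. z \<noteq> 0})" using finite_subset by blast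
    then show False using inf by (auto dest!: finite_imageD intro: inj_onI)
  qed
qed

lemma ex1_is_reverse: "\<exists>!q. is_reverse p q"
proof -
  define q where "q = (\<Sum>j\<le>deg2 p. monom (\<Sum>i\<le>deg1 p.
      monom (cnj (coeff (coeff p (deg2 p - j)) (deg1 p - i))) i) j)"
  have "is_reverse p q"
    unfolding is_reverse_def
  proof (intro allI impI)
    fix z1 z2 :: complex
    assume nz: "z1 \<noteq> 0" "z2 \<noteq> 0"
    have "eval2 q z1 z2 = (\<Sum>j\<le>deg2 p. \<Sum>i\<le>deg1 p.
        cnj (coeff (coeff p (deg2 p - j)) (deg1 p - i)) * z1 ^ i * z2 ^ j)"
      by (simp add: eval2_def q_def poly_sum poly_monom sum_distrib_right)
    also have "\<dots> = (\<Sum>j\<le>deg2 p. \<Sum>i\<le>deg1 p.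
        cnj (coeff (coeff p j) i) * z1 ^ (deg1 p - i) * z2 ^ (deg2 p - j))"
      by (rule sum.reindex_bij_witness[of _ "\<lambda>j. deg2 p - j" "\<lambda>j. deg2 p - j"], simp_all,
          rule sum.reindex_bij_witness[of _ "\<lambda>i. deg1 p - i" "\<lambda>i. deg1 p - i"], simp_all)
    also have "\<dots> = (\<Sum>j\<le>deg2 p. \<Sum>i\<le>deg1 p. z1 ^ deg1 p * z2 ^ deg2 p *
        cnj (coeff (coeff p j) i * (1 / cnj z1) ^ i * (1 / cnj z2) ^ j))"
      using nz by (intro sum.cong refl) (simp add: power_diff field_simps)
    also have "\<dots> = z1 ^ deg1 p * z2 ^ deg2 p * cnj (eval2 p (1 / cnj z1) (1 / cnj z2))"
      by (simp only: eval2_as_sum[of p] cnj_sum sum_distrib_left)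
    finally show "eval2 q z1 z2 =
        z1 ^ deg1 p * z2 ^ deg2 p * cnj (eval2 p (1 / cnj z1) (1 / cnj z2))" .
  qed
  moreover have "q' = q" if "is_reverse p q'" for q'
    using that \<open>is_reverse p q\<close> by (intro eval2_eqI) (simp add: is_reverse_def)
  ultimately show ?thesis by blast
qed

lemma is_reverse_reverse: "is_reverse p (reverse p)"
  unfolding reverse_def by (rule theI'[OF ex1_is_reverse])

end

(* Put f(x, y) = (x + i)^n1 (y + i)^n2 p((x - i)/(x + i), (y - i)/(y + i)), after a rotation of the
   variables making p(1, 1) nonzero.  Semi-stability and self-reversiveness say that for real s the
   polynomial t |-> f(t + s, t), monic of degree n1 + n2 up to a constant, has only real roots.  If
   these roots are simple for all real s, their Hermite matrix H(s) is positive definite and a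
   scalar multiple of it factors as Q(s)^* Q(s) with det Q zero-free in the closed upper half plane.  With
   the companion matrix C(s), the function Q C Q^{-1} is Hermitian on the real line and has no
   poles, and since its eigenvalues grow linearly it is an affine pencil s A + B.  The general case
   follows by applying (1 + e d/dt)^(n1 + n2), which makes the roots simple, and letting e tend
   to 0.  The leading form of f shows that -A is unitarily equivalent to I (+) 0, so
   that f(x, y) = c det((x I (+) y I) + C) with C Hermitian, and the Cayley transform
   K = (C + i)^{-1} (C - i) is the required unitary matrix. *)
theory Submission
  imports Defs "HOL-Computational_Algebra.Fundamental_Theorem_Algebra"
begin


text \<open>The line (t + s, t) is used because both coordinates enter the upper half plane together
  with t, and because the leading coefficient in t is then the constant p(1, 1): t enters the pencil
  through t I alone, and only s needs a matrix. The obstacle is that the roots are not polynomial in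
  s. Everything is therefore expressed through symmetric functions of them: the companion matrix,
  whose entries come from coefficients, and the Hermite matrix of power sums. On the real line the
  latter is V^* V for the Vandermonde matrix V, so distinct roots make it definite. Schur
  complements without division give Q^* Q only up to a factor |k|^2, which is harmless because
  conjugation by Q ignores scalars. The zeros of det Q are moved because Hermitian symmetry on the
  real line mirrors the poles of Q C Q^{-1}: if the closed upper half plane has none, neither has
  the lower one. The operator 1 + e d/dt acts on t only, so coefficients stay polynomial in s, and
  it moves roots by a controlled amount; hence the pencils for all e have uniformly bounded entries
  and a subsequence converges.\<close>

section \<open>Polynomial functions of a complex variable\<close>

text \<open>Polynomials are handled as functions, so that matrices depending on a parameter stay
  complex matrices at each point and determinants and adjoints are taken pointwise.\<close>

definition polyfun :: "(complex \<Rightarrow> complex) \<Rightarrow> bool" where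
  "polyfun f \<longleftrightarrow> (\<exists>p. f = poly p)"

lemma polyfun_poly [simp, intro]: "polyfun (poly p)" "polyfun (\<lambda>z. poly p z)"
  by (auto simp: polyfun_def)

lemma polyfun_const [simp, intro]: "polyfun (\<lambda>_. c)"
  unfolding polyfun_def by (intro exI[of _ "[:c:]"]) auto

lemma polyfun_id [simp, intro]: "polyfun (\<lambda>z. z)"
  unfolding polyfun_def by (intro exI[of _ "[:0, 1:]"]) auto

lemma polyfun_add [intro]:
  assumes "polyfun f" "polyfun g" shows "polyfun (\<lambda>z. f z + g z)"
proof -
  obtain p q where "f = poly p" "g = poly q" using assms by (auto simp: polyfun_def)
  then have "(\<lambda>z. f z + g z) = poly (p + q)" by auto
  then show ?thesis by (auto simp: polyfun_def)
qed

lemma polyfun_mult [intro]: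
  assumes "polyfun f" "polyfun g" shows "polyfun (\<lambda>z. f z * g z)"
proof -
  obtain p q where "f = poly p" "g = poly q" using assms by (auto simp: polyfun_def)
  then have "(\<lambda>z. f z * g z) = poly (p * q)" by auto
  then show ?thesis by (auto simp: polyfun_def)
qed

lemma polyfun_uminus [intro]: "polyfun f \<Longrightarrow> polyfun (\<lambda>z. - f z)"
  using polyfun_mult[of "\<lambda>_. -1" f] by simp

lemma polyfun_diff [intro]: "polyfun f \<Longrightarrow> polyfun g \<Longrightarrow> polyfun (\<lambda>z. f z - g z)"
  using polyfun_add[of f "\<lambda>z. - g z"] by auto

lemma polyfun_sum [intro]: "(\<And>i. i \<in> I \<Longrightarrow> polyfun (f i)) \<Longrightarrow> polyfun (\<lambda>z. \<Sum>i\<in>I. f i z)"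
  by (induction I rule: infinite_finite_induct) auto

lemma polyfun_prod [intro]: "(\<And>i. i \<in> I \<Longrightarrow> polyfun (f i)) \<Longrightarrow> polyfun (\<lambda>z. \<Prod>i\<in>I. f i z)"
  by (induction I rule: infinite_finite_induct) auto

lemma polyfun_power [intro]: "polyfun f \<Longrightarrow> polyfun (\<lambda>z. f z ^ n)"
  by (induction n) auto

lemma poly_cnj_conv: "poly (map_poly cnj p) z = cnj (poly p (cnj z))"
  by (induction p) (auto simp: map_poly_pCons)

lemma polyfun_eqI:
  assumes "polyfun f" "polyfun g" "infinite S" "\<And>z. z \<in> S \<Longrightarrow> f z = g z"
  shows "f = g"
proof -
  obtain p q where pq: "f = poly p" "g = poly q" using assms by (auto simp: polyfun_def)
  have "S \<subseteq> {z. poly (p - q) z = 0}" using assms(4) pq by auto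
  then have "infinite {z. poly (p - q) z = 0}" using assms(3) finite_subset by blast
  then have "p - q = 0" using poly_roots_finite by blast
  then show ?thesis using pq by simp
qed

lemma infinite_Reals: "infinite (\<real> :: complex set)"
proof
  assume "finite (\<real> :: complex set)"
  moreover have "(complex_of_real ` UNIV) \<subseteq> \<real>" by auto
  ultimately have "finite (complex_of_real ` UNIV)" using finite_subset by blast
  then have "finite (UNIV :: real set)" by (rule finite_imageD) (auto intro: injI)
  then show False using infinite_UNIV_char_0 by blast
qed

lemma polyfun_eqI_real:
  assumes "polyfun f" "polyfun g" "\<And>x::real. f (of_real x) = g (of_real x)"
  shows "f = g"
  using polyfun_eqI[OF assms(1,2) infinite_Reals] assms(3) by (auto elim!: Reals_cases)

lemma infinite_Compl_finite: "finite S \<Longrightarrow> infinite (- S :: complex set)"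
  using finite_compl infinite_UNIV_char_0 by blast

lemma poly_has_root: "degree (p :: complex poly) > 0 \<Longrightarrow> \<exists>z. poly p z = 0"
  using fundamental_theorem_of_algebra[of p] by (auto simp: constant_degree)

section \<open>Scalar and matrix Fejer-Riesz factorization on the real line\<close>

text \<open>Positivity excludes real roots and realness pairs each root \<open>l\<close> with
  \<open>cnj l\<close>; one root of each pair goes into \<open>q\<close>, since (x - l)(x - cnj l) =
  |x - l|^2 for real x.\<close>

lemma fejer_riesz_real_line:
  fixes p :: "complex poly"
  assumes "\<And>x::real. poly p (of_real x) \<in> \<real> \<and> Re (poly p (of_real x)) > 0"
  shows "\<exists>q. \<forall>x::real. poly p (of_real x) = poly q (of_real x) * cnj (poly q (of_real x))"
  using assms
proof (induction "degree p" arbitrary: p rule: less_induct)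
  case less
  show ?case
  proof (cases "degree p = 0")
    case True
    then obtain c where p: "p = [:c:]" by (metis degree_eq_zeroE)
    then have "c \<in> \<real>" "Re c > 0" using less.prems[of 0] by auto
    then show ?thesis unfolding p
      by (intro exI[of _ "[:complex_of_real (sqrt (Re c)):]"])
         (auto simp: complex_eq_iff complex_is_Real_iff)
  next
    case False
    then obtain l where l: "poly p l = 0" using poly_has_root by blast
    have p0: "p \<noteq> 0" using False by auto
    have nr: "Im l \<noteq> 0"
    proof
      assume "Im l = 0"
      then have "l = of_real (Re l)" by (simp add: complex_eq_iff)
      then show False using less.prems[of "Re l"] l by simp
    qed
    \<comment> \<open>Equal on the real line, hence everywhere; this is what makes
      \<open>cnj l\<close> a root as well.\<close>
    have sym: "poly p = poly (map_poly cnj p)"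
    proof (rule polyfun_eqI_real)
      fix x :: real
      show "poly p (of_real x) = poly (map_poly cnj p) (of_real x)"
        using less.prems[of x] by (simp add: poly_cnj_conv Reals_cnj_iff)
    qed auto
    obtain p1 where p1: "p = [:-l,1:] * p1" using l by (auto simp: poly_eq_0_iff_dvd dvd_def)
    have "poly p (cnj l) = 0" using sym l by (metis poly_cnj_conv complex_cnj_cnj complex_cnj_zero)
    then have "poly p1 (cnj l) = 0" using nr unfolding p1 by (auto simp: complex_eq_iff)
    then obtain p2 where p2: "p1 = [:-cnj l,1:] * p2" by (auto simp: poly_eq_0_iff_dvd dvd_def)
    have p: "p = [:-l,1:] * ([:-cnj l,1:] * p2)" using p1 p2 by simp
    have p20: "p2 \<noteq> 0" using p0 p by auto
    have "degree ([:-cnj l,1:] * p2) = Suc (degree p2)" using p20 by (subst degree_mult_eq) auto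
    then have deg: "degree p = degree p2 + 2" using p20 unfolding p
      by (subst degree_mult_eq) (auto simp del: mult_pCons_left)
    have ev: "poly p (of_real x) = of_real ((norm (of_real x - l))^2) * poly p2 (of_real x)" for x :: real
    proof -
      have "complex_of_real ((norm (of_real x - l))^2) = (of_real x - l) * (of_real x - cnj l)"
        by (subst complex_norm_square) simp
      moreover have "poly p (of_real x) = (of_real x - l) * (of_real x - cnj l) * poly p2 (of_real x)"
        unfolding p by (simp add: algebra_simps)
      ultimately show ?thesis by (simp only:)
    qed
    have pos: "(norm (of_real x - l))^2 > 0" for x :: real
      using nr by (auto simp: complex_eq_iff)
    have "poly p2 (of_real x) \<in> \<real> \<and> Re (poly p2 (of_real x)) > 0" for x :: real
      using less.prems[of x] pos[of x] unfolding ev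
      by (auto simp: complex_is_Real_iff zero_less_mult_iff simp del: of_real_power)
    then obtain q where q: "\<forall>x::real. poly p2 (of_real x) = poly q (of_real x) * cnj (poly q (of_real x))"
      using less.hyps[of p2] deg by auto
    have "poly p (of_real x) = poly ([:-l,1:] * q) (of_real x) * cnj (poly ([:-l,1:] * q) (of_real x))" for x :: real
      using q unfolding p by (simp add: algebra_simps)
    then show ?thesis by blast
  qed
qed

text \<open>Each step splits off the first row and column by a Schur complement, cleared of its
  denominator; the pivot is handled by the scalar factorization.\<close>
lemma matrix_fejer_riesz_real_line:
  fixes H :: "complex \<Rightarrow> nat \<Rightarrow> nat \<Rightarrow> complex"
  assumes "\<And>i j. polyfun (\<lambda>s. H s i j)"
    and "\<And>(x::real) i j. i < n \<Longrightarrow> j < n \<Longrightarrow> cnj (H (of_real x) j i) = H (of_real x) i j"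
    and "\<And>(x::real) v. \<exists>i<n. v i \<noteq> 0 \<Longrightarrow> Re (\<Sum>i<n. \<Sum>j<n. cnj (v i) * H (of_real x) i j * v j) > 0"
  shows "\<exists>Q k. (\<forall>i j. polyfun (\<lambda>s. Q s i j)) \<and> polyfun k \<and> (\<forall>x::real. k (of_real x) \<noteq> 0) \<and>
    (\<forall>(x::real). \<forall>i<n. \<forall>j<n. (\<Sum>l<n. cnj (Q (of_real x) l i) * Q (of_real x) l j)
        = k (of_real x) * cnj (k (of_real x)) * H (of_real x) i j)"
  using assms
proof (induction n arbitrary: H)
  case 0
  show ?case by (intro exI[of _ "\<lambda>_ _ _. 0"] exI[of _ "\<lambda>_. 1"]) auto
next
  case (Suc n)
  define h where "h = (\<lambda>s. H s 0 0)"
  have hpf: "polyfun h" using Suc.prems(1) by (simp add: h_def)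
  have hreal: "h (of_real x) \<in> \<real>" for x :: real
    using Suc.prems(2)[of 0 0 x] by (simp add: h_def Reals_cnj_iff)
  have hpos: "Re (h (of_real x)) > 0" for x :: real
    using Suc.prems(3)[of "\<lambda>i. case i of 0 \<Rightarrow> 1 | Suc _ \<Rightarrow> 0" x, OF exI[of _ 0]]
    by (auto simp: h_def sum.lessThan_Suc_shift simp del: sum.lessThan_Suc)
  have hcnj: "cnj (h (of_real x)) = h (of_real x)" for x :: real
    using hreal Reals_cnj_iff by blast
  have hnz: "h (of_real x) \<noteq> 0" for x :: real using hpos[of x] by auto
  obtain q where q: "polyfun q" "\<And>x::real. h (of_real x) = q (of_real x) * cnj (q (of_real x))"
  proof -
    obtain p where p: "h = poly p" using hpf by (auto simp: polyfun_def)
    show ?thesis using fejer_riesz_real_line[of p] hreal hpos that p by (metis polyfun_poly(1))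
  qed
  \<comment> \<open>The Schur complement of the pivot multiplied by \<open>h\<close>: entries remain
    polynomial, and positivity survives because \<open>h\<close> is positive on the real
    line.\<close>
  define S where "S = (\<lambda>s i j. h s * H s (Suc i) (Suc j) - H s (Suc i) 0 * H s 0 (Suc j))"
  have S1: "polyfun (\<lambda>s. S s i j)" for i j
    unfolding S_def using Suc.prems(1) hpf by (intro polyfun_diff polyfun_mult) auto
  have S2: "cnj (S (of_real x) j i) = S (of_real x) i j" if "i < n" "j < n" for x :: real and i j
    unfolding S_def using that Suc.prems(2)[of "Suc i" "Suc j" x] Suc.prems(2)[of "Suc i" 0 x]
      Suc.prems(2)[of 0 "Suc j" x] hcnj[of x] by simp
  have S3: "Re (\<Sum>i<n. \<Sum>j<n. cnj (v i) * S (of_real x) i j * v j) > 0"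
    if v: "\<exists>i<n. v i \<noteq> 0" for x :: real and v
  proof -
    define X where "X = (of_real x :: complex)"
    define b where "b = (\<Sum>j<n. H X 0 (Suc j) * v j)"
    define b' where "b' = (\<Sum>i<n. cnj (v i) * H X (Suc i) 0)"
    define d where "d = (\<Sum>i<n. \<Sum>j<n. cnj (v i) * H X (Suc i) (Suc j) * v j)"
    have b': "cnj b = b'" unfolding b_def b'_def cnj_sum
      using Suc.prems(2)[of _ 0 x] by (intro sum.cong) (auto simp: X_def)
    have hX: "h X \<noteq> 0" "cnj (h X) = h X" using hnz hcnj by (auto simp: X_def)
    \<comment> \<open>The first coordinate minimizes the form of \<open>H\<close> with the others
      fixed to \<open>v\<close>; the minimum is the Schur complement form at
      \<open>v\<close>.\<close>
    define w where "w = (\<lambda>i. case i of 0 \<Rightarrow> - b / h X | Suc i \<Rightarrow> v i)"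
    obtain i0 where "i0 < n" "v i0 \<noteq> 0" using v by blast
    then have "\<exists>i<Suc n. w i \<noteq> 0" by (intro exI[of _ "Suc i0"]) (auto simp: w_def)
    have wS: "w (Suc i) = v i" for i by (simp add: w_def)
    from Suc.prems(3)[OF \<open>\<exists>i<Suc n. w i \<noteq> 0\<close>, of x]
    have "0 < Re (\<Sum>i<Suc n. \<Sum>j<Suc n. cnj (w i) * H X i j * w j)" by (simp add: X_def)
    also have "(\<Sum>i<Suc n. \<Sum>j<Suc n. cnj (w i) * H X i j * w j) =
       cnj (w 0) * h X * w 0 + cnj (w 0) * b + b' * w 0 + d"
      unfolding sum.lessThan_Suc_shift b_def b'_def d_def wS h_def sum.distrib
      by (simp add: sum_distrib_left sum_distrib_right mult.assoc del: sum.lessThan_Suc)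
    also have "\<dots> = d - b' * b / h X" using hX by (simp add: w_def b' field_simps)
    finally have 1: "0 < Re (d - b' * b / h X)" .
    have "(\<Sum>i<n. \<Sum>j<n. cnj (v i) * S X i j * v j) =
        (\<Sum>i<n. \<Sum>j<n. h X * (cnj (v i) * H X (Suc i) (Suc j) * v j)
          - (cnj (v i) * H X (Suc i) 0) * (H X 0 (Suc j) * v j))"
      unfolding S_def by (intro sum.cong refl) (simp add: algebra_simps)
    also have "\<dots> = h X * d - b' * b"
      by (simp only: d_def b_def b'_def sum_subtractf sum_distrib_left[symmetric] sum_distrib_right[symmetric])
    also have "\<dots> = h X * (d - b' * b / h X)" using hX by (simp add: field_simps)
    finally have "(\<Sum>i<n. \<Sum>j<n. cnj (v i) * S X i j * v j) = h X * (d - b' * b / h X)" .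
    moreover have "h X = of_real (Re (h X))" using hreal[of x] by (simp add: X_def)
    ultimately have "Re (\<Sum>i<n. \<Sum>j<n. cnj (v i) * S X i j * v j) = Re (h X) * Re (d - b' * b / h X)"
      by (metis Re_complex_of_real times_complex.sel(1) Im_complex_of_real mult_zero_left diff_zero)
    then show ?thesis using 1 hpos[of x] by (simp add: X_def)
  qed
  obtain R k where R: "\<forall>i j. polyfun (\<lambda>s. R s i j)" and k: "polyfun k" "\<forall>x::real. k (of_real x) \<noteq> 0"
    and RS: "\<forall>(x::real). \<forall>i<n. \<forall>j<n. (\<Sum>l<n. cnj (R (of_real x) l i) * R (of_real x) l j)
        = k (of_real x) * cnj (k (of_real x)) * S (of_real x) i j"
    using Suc.IH[of S] S1 S2 S3 by blast
  \<comment> \<open>The first row contributes |k|^2 H_i0 H_0j, which restores the term subtracted in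
    \<open>S\<close>. What remains is |k|^2 h H_ij with h = |q|^2, so the multiplier becomes
    \<open>k s * q s\<close>.\<close>
  define Q where "Q = (\<lambda>s l j. case l of 0 \<Rightarrow> k s * H s 0 j
     | Suc l \<Rightarrow> (case j of 0 \<Rightarrow> 0 | Suc j \<Rightarrow> R s l j))"
  show ?case
  proof (intro exI[of _ Q] exI[of _ "\<lambda>s. k s * q s"] conjI allI impI)
    fix i j
    show "polyfun (\<lambda>s. Q s i j)" unfolding Q_def using R k Suc.prems(1)
      by (cases i; cases j) (auto intro: polyfun_mult)
  next
    show "polyfun (\<lambda>s. k s * q s)" using k q by auto
  next
    fix x :: real
    show "k (of_real x) * q (of_real x) \<noteq> 0" using k q(2)[of x] hnz[of x] by auto
  next
    fix x :: real and i j assume ij: "i < Suc n" "j < Suc n"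
    have H0: "cnj (H (of_real x) 0 i) = H (of_real x) i 0" using Suc.prems(2)[of i 0 x] ij by simp
    have 1: "(\<Sum>l<n. cnj (Q (of_real x) (Suc l) i) * Q (of_real x) (Suc l) j)
      = k (of_real x) * cnj (k (of_real x)) * (h (of_real x) * H (of_real x) i j - H (of_real x) i 0 * H (of_real x) 0 j)"
      using RS ij by (cases i; cases j) (auto simp: Q_def S_def h_def)
    show "(\<Sum>l<Suc n. cnj (Q (of_real x) l i) * Q (of_real x) l j) =
       k (of_real x) * q (of_real x) * cnj (k (of_real x) * q (of_real x)) * H (of_real x) i j"
      unfolding sum.lessThan_Suc_shift 1
      by (simp add: Q_def H0 q(2) algebra_simps)
  qed
qed


section \<open>Adjoints and unitary matrices\<close>

lemma mat_adjoint_eq: "A \<in> carrier_mat n n \<Longrightarrow> mat_adjoint A = mat n n (\<lambda>(i, j). cnj (A $$ (j, i)))"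
  unfolding mat_adjoint_def by (intro eq_matI) (auto simp: mat_of_rows_def)

lemma mat_adjoint_index [simp]:
  "A \<in> carrier_mat n n \<Longrightarrow> i < n \<Longrightarrow> j < n \<Longrightarrow> mat_adjoint A $$ (i, j) = cnj (A $$ (j, i))"
  by (simp add: mat_adjoint_eq)

lemma mat_adjoint_carrier [simp, intro]:
  fixes A :: "complex mat"
  shows "A \<in> carrier_mat n n \<Longrightarrow> mat_adjoint A \<in> carrier_mat n n"
  by (simp add: mat_adjoint_eq)

lemma dim_mat_adjoint [simp]:
  "dim_row (mat_adjoint A) = dim_col A" "dim_col (mat_adjoint A) = dim_row A"
  by (simp_all add: mat_adjoint_def)

lemma mult_mat_index:
  "A \<in> carrier_mat n m \<Longrightarrow> B \<in> carrier_mat m k \<Longrightarrow> i < n \<Longrightarrow> j < k \<Longrightarrow>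
    (A * B) $$ (i, j) = (\<Sum>l<m. A $$ (i, l) * B $$ (l, j))"
  by (auto simp: scalar_prod_def lessThan_atLeast0)

lemma square_mult_carrier [simp]:
  "A \<in> carrier_mat n n \<Longrightarrow> B \<in> carrier_mat n n \<Longrightarrow> A * B \<in> carrier_mat n n"
  by simp

lemma square_mult_assoc:
  "A \<in> carrier_mat n n \<Longrightarrow> B \<in> carrier_mat n n \<Longrightarrow> C \<in> carrier_mat n n \<Longrightarrow>
    A * B * C = A * (B * C)"
  by simp

lemma mat_adjoint_adjoint [simp]:
  fixes A :: "complex mat"
  assumes A: "A \<in> carrier_mat n n"
  shows "mat_adjoint (mat_adjoint A) = A"
  unfolding mat_adjoint_eq[OF mat_adjoint_carrier[OF A]] using A by (intro eq_matI) auto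

lemma mat_adjoint_one [simp]: "mat_adjoint (1\<^sub>m n :: complex mat) = 1\<^sub>m n"
  by (subst mat_adjoint_eq[of _ n]) (auto intro!: eq_matI)

lemma mat_adjoint_mult:
  fixes A B :: "complex mat"
  assumes "A \<in> carrier_mat n n" "B \<in> carrier_mat n n"
  shows "mat_adjoint (A * B) = mat_adjoint B * mat_adjoint A"
proof (intro eq_matI)
  fix i j assume "i < dim_row (mat_adjoint B * mat_adjoint A)" "j < dim_col (mat_adjoint B * mat_adjoint A)"
  then have ij: "i < n" "j < n"
    using mat_adjoint_carrier[OF assms(1)] mat_adjoint_carrier[OF assms(2)] by auto
  have "mat_adjoint (A * B) $$ (i, j) = cnj ((A * B) $$ (j, i))"
    using assms ij by (subst mat_adjoint_index[of _ n]) auto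
  also have "\<dots> = (mat_adjoint B * mat_adjoint A) $$ (i, j)"
    using assms ij by (simp add: mult_mat_index[of _ n n _ n] mult.commute del: index_mult_mat)
  finally show "mat_adjoint (A * B) $$ (i, j) = (mat_adjoint B * mat_adjoint A) $$ (i, j)" .
qed (use mat_adjoint_carrier[OF assms(1)] mat_adjoint_carrier[OF assms(2)]
       mat_adjoint_carrier[OF mult_carrier_mat[OF assms]] in auto)

lemma det_mat_adjoint:
  fixes A :: "complex mat"
  assumes "A \<in> carrier_mat n n" shows "det (mat_adjoint A) = cnj (det A)"
proof -
  interpret cnj: comm_ring_hom cnj by unfold_locales auto
  have "mat_adjoint A = transpose_mat (map_mat cnj A)"
    using assms by (intro eq_matI) (auto simp: mat_adjoint_eq)
  then show ?thesis using assms by (simp add: det_transpose[of _ n] cnj.hom_det)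
qed

lemma unitary_mat_carrier: "unitary_mat n U \<Longrightarrow> U \<in> carrier_mat n n"
  by (simp add: unitary_mat_def)

lemma unitary_matI:
  assumes "U \<in> carrier_mat n n" "mat_adjoint U * U = 1\<^sub>m n"
  shows "unitary_mat n U"
  using assms mat_mult_left_right_inverse[of "mat_adjoint U" n U] by (auto simp: unitary_mat_def)

lemma unitary_mat_adjoint: "unitary_mat n U \<Longrightarrow> unitary_mat n (mat_adjoint U)"
  by (auto simp: unitary_mat_def)

lemma unitary_mat_mult:
  assumes "unitary_mat n U" "unitary_mat n V" shows "unitary_mat n (U * V)"
proof (rule unitary_matI)
  have c: "U \<in> carrier_mat n n" "V \<in> carrier_mat n n" using assms by (auto simp: unitary_mat_def)
  then show "U * V \<in> carrier_mat n n" by simp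
  have "mat_adjoint (U * V) * (U * V) = mat_adjoint V * (mat_adjoint U * U) * V"
    using c mat_adjoint_carrier[OF c(1)] mat_adjoint_carrier[OF c(2)]
    by (simp add: mat_adjoint_mult[OF c] square_mult_assoc[of _ n])
  also have "\<dots> = 1\<^sub>m n" using assms by (auto simp: unitary_mat_def)
  finally show "mat_adjoint (U * V) * (U * V) = 1\<^sub>m n" .
qed

lemma det_unitary_nz: assumes "unitary_mat n U" shows "det U \<noteq> 0"
proof -
  have "det (mat_adjoint U) * det U = det (mat_adjoint U * U)"
    using assms by (subst det_mult[of _ n]) (auto simp: unitary_mat_def)
  also have "\<dots> = 1" using assms by (simp add: unitary_mat_def)
  finally show ?thesis by auto
qed

text \<open>A Householder reflector; the phase of \<open>v\<close> is chosen so that \<open>v 0 \<le> 0\<close>, which keeps the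
  reflection vector \<open>v - e\<^sub>0\<close> away from zero.\<close>
lemma unitary_first_column:
  fixes v :: "nat \<Rightarrow> complex"
  assumes "n > 0" "\<exists>i<n. v i \<noteq> 0"
  shows "\<exists>W c. unitary_mat n W \<and> c \<noteq> 0 \<and> (\<forall>i<n. W $$ (i, 0) = c * v i)"
proof -
  define a where "a = (\<Sum>i<n. (norm (v i))^2)"
  have a: "a > 0" unfolding a_def using assms(2) by (auto intro!: sum_pos2)
  \<comment> \<open>The phase turns \<open>v 0\<close> into a nonpositive real number and 1 / sqrt a
    normalizes the length. For \<open>v 0 = 0\<close> any phase works, and 1 is taken.\<close>
  define c where "c = (if v 0 = 0 then 1 else - cnj (v 0) / norm (v 0)) / sqrt a"
  have c0: "c \<noteq> 0" using a by (auto simp: c_def)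
  have cn: "(norm c)^2 = 1 / a" using a by (auto simp: c_def norm_divide power_divide)
  define x where "x = (\<lambda>i. c * v i)"
  have x1: "(\<Sum>i<n. (norm (x i))^2) = 1"
    using a unfolding x_def norm_mult power_mult_distrib cn sum_distrib_left[symmetric] a_def[symmetric] by simp
  define g where "g = norm (v 0) / sqrt a"
  have x0: "x 0 = - of_real g"
    by (auto simp: x_def c_def g_def mult.commute[of "cnj _"] complex_norm_square[symmetric] power2_eq_square)
  have g0: "g \<ge> 0" using a by (auto simp: g_def)
  define w where "w = (\<lambda>i. x i - (if i = 0 then 1 else 0))"
  \<comment> \<open>Half the squared length of \<open>w\<close>, so that I - w w^* / G below is the
    usual reflector I - 2 w w^* / |w|^2.\<close>
  define G where "G = complex_of_real (1 + g)"
  have G0: "G \<noteq> 0" using g0 by (auto simp: G_def complex_eq_iff)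
  have cG: "cnj G = G" by (simp add: G_def)
  have xs: "(\<Sum>i<n. cnj (x i) * x i) = 1"
  proof -
    have "cnj z * z = of_real ((norm z)^2)" for z
      unfolding complex_norm_square by (rule mult.commute)
    then show ?thesis by (metis (no_types, lifting) x1 of_real_sum of_real_1 sum.cong)
  qed
  have ws: "(\<Sum>k<n. cnj (w k) * w k) = 2 * G"
  proof -
    have "cnj (w k) * w k = cnj (x k) * x k - (if k = 0 then x 0 + cnj (x 0) - 1 else 0)" for k
      by (auto simp: w_def algebra_simps)
    then have "(\<Sum>k<n. cnj (w k) * w k) = 1 - (x 0 + cnj (x 0) - 1)"
      using xs assms(1) by (simp add: sum_subtractf)
    then show ?thesis by (simp add: x0 G_def)
  qed
  define W where "W = mat n n (\<lambda>(i, j). (if i = j then 1 else 0) - w i * cnj (w j) / G)"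
  have Wc: "W \<in> carrier_mat n n" by (simp add: W_def)
  have Wad: "mat_adjoint W = W"
    unfolding mat_adjoint_eq[OF Wc] by (intro eq_matI) (auto simp: W_def cG mult.commute)
  have "W * W = 1\<^sub>m n"
  proof (intro eq_matI)
    fix i j assume "i < dim_row (1\<^sub>m n :: complex mat)" "j < dim_col (1\<^sub>m n :: complex mat)"
    then have ij: "i < n" "j < n" by auto
    have "(W * W) $$ (i, j) = (\<Sum>k<n. ((if i = k then 1 else 0) - w i * cnj (w k) / G) *
        ((if k = j then 1 else 0) - w k * cnj (w j) / G))"
      using ij Wc by (subst mult_mat_index[of _ n n _ n]) (auto simp: W_def)
    also have "\<dots> = (\<Sum>k<n. (if k = i then (if k = j then 1 else 0) - w k * cnj (w j) / G else 0)
        - (if k = j then w i * cnj (w k) / G else 0)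
        + w i * cnj (w j) / (G * G) * (cnj (w k) * w k))"
      using G0 by (intro sum.cong) (auto simp: field_simps)
    also have "\<dots> = (if i = j then 1 else 0) - w i * cnj (w j) / G - w i * cnj (w j) / G + w i * cnj (w j) / (G * G) * (2 * G)"
      by (simp only: sum.distrib sum_subtractf sum_distrib_left[symmetric] ws) (use ij in simp)
    also have "\<dots> = 1\<^sub>m n $$ (i, j)" using ij G0 by (auto simp: field_simps)
    finally show "(W * W) $$ (i, j) = 1\<^sub>m n $$ (i, j)" .
  qed (auto simp: W_def)
  then have "unitary_mat n W" using Wc Wad by (simp add: unitary_mat_def)
  moreover have "W $$ (i, 0) = c * v i" if "i < n" for i
  proof -
    \<comment> \<open>Hence W e_0 = e_0 + w = x: the reflector exchanges e_0 and the unit vector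
      \<open>x\<close>.\<close>
    have "cnj (w 0) = - G" by (simp add: w_def x0 G_def)
    then show ?thesis using that assms(1) G0 by (auto simp: W_def w_def x_def)
  qed
  ultimately show ?thesis using c0 by blast
qed

section \<open>Polynomial matrices and reflection of determinant zeros\<close>

definition polymat :: "nat \<Rightarrow> (complex \<Rightarrow> complex mat) \<Rightarrow> bool" where
  "polymat n Q \<longleftrightarrow> (\<forall>s. Q s \<in> carrier_mat n n) \<and> (\<forall>i<n. \<forall>j<n. polyfun (\<lambda>s. Q s $$ (i, j)))"

lemma polymat_mult:
  assumes "polymat n P" "polymat n Q" shows "polymat n (\<lambda>s. P s * Q s)"
proof -
  have c: "P s \<in> carrier_mat n n" "Q s \<in> carrier_mat n n" for s
    using assms by (auto simp: polymat_def)
  have "polyfun (\<lambda>s. \<Sum>k<n. P s $$ (i, k) * Q s $$ (k, j))" if "i < n" "j < n" for i j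
    using assms that by (intro polyfun_sum polyfun_mult) (auto simp: polymat_def)
  then show ?thesis using c by (simp add: polymat_def mult_mat_index[OF c] del: index_mult_mat)
qed

lemma polymat_const: "A \<in> carrier_mat n n \<Longrightarrow> polymat n (\<lambda>_. A)"
  by (simp add: polymat_def)

lemma polyfun_det:
  assumes "polymat n Q" shows "polyfun (\<lambda>s. det (Q s))"
proof -
  have "polyfun (\<lambda>s. \<Sum>p | p permutes {0..<n}. signof p * (\<Prod>i = 0..<n. Q s $$ (i, p i)))"
    using assms by (intro polyfun_sum polyfun_mult polyfun_prod) (auto simp: polymat_def)
  then show ?thesis using assms by (simp add: polymat_def det_def'[of _ n])
qed

lemma polyfun_root_factor:
  assumes "polyfun f" "f l = 0"
  shows "\<exists>g. polyfun g \<and> (\<forall>s. f s = (s - l) * g s)"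
proof -
  obtain p where p: "f = poly p" using assms(1) by (auto simp: polyfun_def)
  then obtain q where q: "p = [:-l, 1:] * q" using assms(2) by (auto simp: poly_eq_0_iff_dvd dvd_def)
  have "\<forall>s. f s = (s - l) * poly q s" unfolding p q by (simp add: algebra_simps)
  then show ?thesis by blast
qed

lemma adjoint_mult_index:
  fixes Q :: "complex mat"
  shows "Q \<in> carrier_mat n n \<Longrightarrow> i < n \<Longrightarrow> j < n \<Longrightarrow>
    (mat_adjoint Q * Q) $$ (i, j) = (\<Sum>l<n. cnj (Q $$ (l, i)) * Q $$ (l, j))"
  by (subst mult_mat_index[of _ n n _ n]) auto

text \<open>A Blaschke--Potapov step: after a constant unitary change of basis the first row of \<open>Q\<close>
  vanishes at \<open>l\<close>, and multiplying it by the unimodular \<open>(s - cnj l) / (s - l)\<close> reflects that zero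
  of the determinant in the real line.\<close>
lemma reflect_det_zero:
  assumes Q: "polymat n Q" and l: "det (Q l) = 0" "Im l \<noteq> 0"
  shows "\<exists>Q' c. polymat n Q' \<and> c \<noteq> 0 \<and>
    (\<forall>x::real. mat_adjoint (Q' (of_real x)) * Q' (of_real x) = mat_adjoint (Q (of_real x)) * Q (of_real x)) \<and>
    (\<forall>s. (s - l) * det (Q' s) = c * (s - cnj l) * det (Q s))"
proof -
  have Qc: "Q s \<in> carrier_mat n n" for s using Q by (simp add: polymat_def)
  have n: "n > 0" using l Qc[of l] by (cases "n = 0") auto
  have "det (mat_adjoint (Q l)) = 0" using l Qc by (simp add: det_mat_adjoint[of _ n])
  \<comment> \<open>A kernel vector of the adjoint is a left kernel vector of \<open>Q l\<close>.
    With \<open>W\<close> having first column proportional to \<open>v\<close>, the first row of W^*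
    Q vanishes at \<open>l\<close>.\<close>
  then obtain v where v: "v \<in> carrier_vec n" "v \<noteq> 0\<^sub>v n" "mat_adjoint (Q l) *\<^sub>v v = 0\<^sub>v n"
    using det_0_iff_vec_prod_zero_field[of "mat_adjoint (Q l)" n] Qc by auto
  have "\<exists>i<n. v $ i \<noteq> 0" using v(1,2) by (metis carrier_vecD eq_vecI index_zero_vec(1) index_zero_vec(2))
  then obtain W c where W: "unitary_mat n W" "c \<noteq> 0" "\<forall>i<n. W $$ (i, 0) = c * v $ i"
    using unitary_first_column[of n "\<lambda>i. v $ i"] n by auto
  have Wc: "W \<in> carrier_mat n n" using W unitary_mat_carrier by auto
  define Q1 where "Q1 = (\<lambda>s. mat_adjoint W * Q s)"
  have Q1: "polymat n Q1" unfolding Q1_def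
    using Q Wc by (intro polymat_mult polymat_const) auto
  have Q1c: "Q1 s \<in> carrier_mat n n" for s using Q1 by (simp add: polymat_def)
  have Q1l: "Q1 l $$ (0, j) = 0" if j: "j < n" for j
  proof -
    have "0 = cnj ((mat_adjoint (Q l) *\<^sub>v v) $ j)" using v j by simp
    also have "\<dots> = (\<Sum>k<n. cnj (v $ k) * Q l $$ (k, j))"
      using v j Qc mat_adjoint_carrier[OF Qc]
      by (subst index_mult_mat_vec) (auto simp: scalar_prod_def lessThan_atLeast0 mat_adjoint_eq[OF Qc] mult.commute)
    finally have "(\<Sum>k<n. cnj (c * v $ k) * Q l $$ (k, j)) = 0"
      by (simp add: sum_distrib_left[symmetric] mult.assoc)
    then show ?thesis using j Wc Qc W(3) n unfolding Q1_def
      by (subst mult_mat_index[of _ n n _ n]) auto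
  qed
  have "\<forall>j. \<exists>g. j < n \<longrightarrow> polyfun g \<and> (\<forall>s. Q1 s $$ (0, j) = (s - l) * g s)"
    using Q1 n Q1l polyfun_root_factor[of _ l] unfolding polymat_def by metis
  then obtain g where g: "\<And>j. j < n \<Longrightarrow> polyfun (g j)" "\<And>j s. j < n \<Longrightarrow> Q1 s $$ (0, j) = (s - l) * g j s"
    by metis
  \<comment> \<open>Replacing the factor s - l of the first row by s - cnj l does not affect Q^* Q
    at real points, where the two factors have the same modulus.\<close>
  define Q' where "Q' = (\<lambda>s. mat n n (\<lambda>(i, j). if i = 0 then (s - cnj l) * g j s else Q1 s $$ (i, j)))"
  have Q'c: "Q' s \<in> carrier_mat n n" for s by (simp add: Q'_def)
  have "polyfun (\<lambda>s. Q' s $$ (i, j))" if "i < n" "j < n" for i j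
    using Q1 g that by (cases "i = 0") (auto simp: Q'_def polymat_def intro!: polyfun_mult polyfun_diff)
  then have Q'p: "polymat n Q'" using Q'c by (auto simp: polymat_def)
  have adj: "mat_adjoint (Q' (of_real x)) * Q' (of_real x) = mat_adjoint (Q (of_real x)) * Q (of_real x)"
    for x :: real
  proof -
    define X where "X = complex_of_real x"
    have cX: "cnj X = X" by (simp add: X_def)
    have "mat_adjoint (Q' X) * Q' X = mat_adjoint (Q1 X) * Q1 X"
    proof (intro eq_matI)
      fix i j assume "i < dim_row (mat_adjoint (Q1 X) * Q1 X)" "j < dim_col (mat_adjoint (Q1 X) * Q1 X)"
      then have ij: "i < n" "j < n" using mat_adjoint_carrier[OF Q1c[of X]] Q1c[of X] by auto
      have "cnj (Q' X $$ (k, i)) * Q' X $$ (k, j) = cnj (Q1 X $$ (k, i)) * Q1 X $$ (k, j)" if "k < n" for k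
        using that ij n g(2) by (cases "k = 0") (auto simp: Q'_def cX)
      then show "(mat_adjoint (Q' X) * Q' X) $$ (i, j) = (mat_adjoint (Q1 X) * Q1 X) $$ (i, j)"
        unfolding adjoint_mult_index[OF Q'c ij] adjoint_mult_index[OF Q1c ij] by simp
    qed (use Q1c[of X] Q'c[of X] mat_adjoint_carrier[OF Q1c[of X]] mat_adjoint_carrier[OF Q'c[of X]] in auto)
    also have "\<dots> = mat_adjoint (Q X) * (W * mat_adjoint W) * Q X"
      unfolding Q1_def using Wc Qc mat_adjoint_carrier[OF Wc] mat_adjoint_carrier[OF Qc[of X]]
      by (simp add: mat_adjoint_mult[of _ n] square_mult_assoc[of _ n])
    also have "\<dots> = mat_adjoint (Q X) * Q X"
      using W(1) by (simp add: unitary_mat_def right_mult_one_mat[OF mat_adjoint_carrier[OF Qc]])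
    finally show ?thesis by (simp add: X_def)
  qed
  have det: "(s - l) * det (Q' s) = det (mat_adjoint W) * (s - cnj l) * det (Q s)" for s
  proof -
    \<comment> \<open>Cross-multiplied form of the change of the first row, valid also at s =
      l.\<close>
    have "multrow 0 (s - l) (Q' s) = multrow 0 (s - cnj l) (Q1 s)"
      using g(2) n Q1c[of s] Q'c[of s] by (intro eq_matI) (auto simp: Q'_def)
    then have "(s - l) * det (Q' s) = (s - cnj l) * det (Q1 s)"
      using det_multrow[OF n Q'c] det_multrow[OF n Q1c] by metis
    also have "det (Q1 s) = det (mat_adjoint W) * det (Q s)"
      unfolding Q1_def using Wc Qc by (subst det_mult[of _ n]) auto
    finally show ?thesis by simp
  qed
  have "det (mat_adjoint W) \<noteq> 0" using W(1) det_unitary_nz unitary_mat_adjoint by blast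
  then show ?thesis using Q'p adj det by blast
qed

text \<open>Induction on the zeros still to be inspected, collected in \<open>d1\<close>;
  \<open>d2\<close> carries those known to lie below the real line. A lower zero of
  \<open>d1\<close> moves to \<open>d2\<close> as it is, an upper zero \<open>l\<close> moves there
  as \<open>cnj l\<close> after a reflection.\<close>

lemma reflect_upper_zeros:
  assumes "polymat n Q" "\<And>s. det (Q s) = poly d1 s * poly d2 s" "\<And>z. Im z \<ge> 0 \<Longrightarrow> poly d2 z \<noteq> 0"
    "\<And>x::real. poly d1 (of_real x) \<noteq> 0"
  shows "\<exists>Q'. polymat n Q' \<and>
    (\<forall>x::real. mat_adjoint (Q' (of_real x)) * Q' (of_real x) = mat_adjoint (Q (of_real x)) * Q (of_real x)) \<and>
    (\<forall>z. Im z \<ge> 0 \<longrightarrow> det (Q' z) \<noteq> 0)"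
  using assms
proof (induction "degree d1" arbitrary: d1 d2 Q)
  case 0
  then obtain c where c: "d1 = [:c:]" by (metis degree_eq_zeroE)
  then have "c \<noteq> 0" using "0.prems"(4)[of 0] by auto
  then show ?case using 0 c by (intro exI[of _ Q]) auto
next
  case (Suc m)
  then obtain l where l: "poly d1 l = 0" using poly_has_root[of d1] by auto
  then obtain e where e: "d1 = [:-l, 1:] * e" by (auto simp: poly_eq_0_iff_dvd dvd_def)
  have nr: "Im l \<noteq> 0"
  proof
    assume "Im l = 0"
    then have "l = of_real (Re l)" by (simp add: complex_eq_iff)
    then show False using Suc.prems(4)[of "Re l"] l by simp
  qed
  have "e \<noteq> 0" using Suc.hyps(2) e by auto
  then have dm: "m = degree e" using Suc.hyps(2) unfolding e by (subst (asm) degree_mult_eq) auto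
  have ez: "poly e (of_real x) \<noteq> 0" for x :: real using Suc.prems(4)[of x] e by auto
  show ?case
  proof (cases "Im l > 0")
    case False
    show ?thesis
    proof (rule Suc.hyps(1)[OF dm, of Q "[:-l, 1:] * d2"])
      show "det (Q s) = poly e s * poly ([:-l, 1:] * d2) s" for s
        using Suc.prems(2)[of s] unfolding e by (simp add: algebra_simps)
      show "poly ([:-l, 1:] * d2) z \<noteq> 0" if "Im z \<ge> 0" for z
        using Suc.prems(3)[OF that] that False nr by auto
    qed (use Suc.prems ez in auto)
  next
    case True
    have "det (Q l) = 0" using Suc.prems(2) l by simp
    then obtain Q' c where Q': "polymat n Q'" "c \<noteq> 0"
      "\<forall>x::real. mat_adjoint (Q' (of_real x)) * Q' (of_real x) = mat_adjoint (Q (of_real x)) * Q (of_real x)"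
      "\<forall>s. (s - l) * det (Q' s) = c * (s - cnj l) * det (Q s)"
      using reflect_det_zero[OF Suc.prems(1) _ nr] by blast
    \<comment> \<open>The factor s - l can be cancelled only for s different from \<open>l\<close>;
      both sides are polynomial, so the identity extends to \<open>l\<close>.\<close>
    have eq: "(\<lambda>s. det (Q' s)) = (\<lambda>s. poly e s * poly (smult c ([:-cnj l, 1:] * d2)) s)"
    proof (rule polyfun_eqI)
      show "infinite (- {l})" by (rule infinite_Compl_finite) auto
      fix s assume "s \<in> - {l}"
      moreover have "(s - l) * det (Q' s) = (s - l) * (poly e s * poly (smult c ([:-cnj l, 1:] * d2)) s)"
      proof -
        have ds: "det (Q s) = (s - l) * poly e s * poly d2 s"
          using Suc.prems(2)[of s] unfolding e by (simp add: algebra_simps)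
        show ?thesis unfolding Q'(4)[rule_format] ds by (simp add: algebra_simps)
      qed
      ultimately show "det (Q' s) = poly e s * poly (smult c ([:-cnj l, 1:] * d2)) s" by auto
    qed (use polyfun_det[OF Q'(1)] in \<open>auto intro!: polyfun_mult simp del: poly_smult mult_pCons_left\<close>)
    have "\<exists>Q''. polymat n Q'' \<and>
      (\<forall>x::real. mat_adjoint (Q'' (of_real x)) * Q'' (of_real x) = mat_adjoint (Q' (of_real x)) * Q' (of_real x)) \<and>
      (\<forall>z. Im z \<ge> 0 \<longrightarrow> det (Q'' z) \<noteq> 0)"
    proof (rule Suc.hyps(1)[OF dm Q'(1)])
      show "det (Q' s) = poly e s * poly (smult c ([:-cnj l, 1:] * d2)) s" for s
        using eq by metis
      show "poly (smult c ([:-cnj l, 1:] * d2)) z \<noteq> 0" if "Im z \<ge> 0" for z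
        using Suc.prems(3)[OF that] that True Q'(2) by auto
    qed (use ez in auto)
    then show ?thesis using Q'(3) by auto
  qed
qed


section \<open>Vandermonde and companion matrices\<close>

text \<open>A nonzero \<open>v\<close> would be the coefficient vector of a polynomial of degree
  below \<open>n\<close> with \<open>n\<close> distinct roots.\<close>

lemma vandermonde_kernel:
  fixes r :: "nat \<Rightarrow> complex"
  assumes "inj_on r {..<n}" "\<And>l. l < n \<Longrightarrow> (\<Sum>j<n. r l ^ j * v j) = 0"
  shows "\<forall>j<n. v j = 0"
proof (rule ccontr)
  assume ne: "\<not> (\<forall>j<n. v j = 0)"
  define q where "q = (\<Sum>j<n. monom (v j) j)"
  have co: "coeff q j = (if j < n then v j else 0)" for j
    by (auto simp: q_def coeff_sum)
  have q0: "q \<noteq> 0"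
  proof
    assume "q = 0"
    then have "coeff q j = 0" for j by simp
    then show False using ne co by metis
  qed
  have "degree q < n" using q0 co by (metis leading_coeff_0_iff)
  moreover have "r ` {..<n} \<subseteq> {z. poly q z = 0}"
    using assms(2) by (auto simp: q_def poly_sum poly_monom mult.commute)
  then have "card (r ` {..<n}) \<le> card {z. poly q z = 0}"
    using poly_roots_finite[OF q0] by (intro card_mono) auto
  then have "n \<le> degree q" using card_poly_roots_bound[OF q0] assms(1) by (simp add: card_image)
  ultimately show False by simp
qed

definition vandermonde :: "nat \<Rightarrow> (nat \<Rightarrow> complex) \<Rightarrow> complex mat" where
  "vandermonde n r = mat n n (\<lambda>(l, j). r l ^ j)"

lemma vandermonde_carrier [simp]: "vandermonde n r \<in> carrier_mat n n"
  by (simp add: vandermonde_def)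

lemma mat_inverse_exists:
  fixes A :: "complex mat"
  assumes "A \<in> carrier_mat n n" "det A \<noteq> 0"
  shows "\<exists>B \<in> carrier_mat n n. A * B = 1\<^sub>m n \<and> B * A = 1\<^sub>m n"
proof -
  define B where "B = (1 / det A) \<cdot>\<^sub>m adj_mat A"
  have B: "B \<in> carrier_mat n n" using adj_mat(1)[OF assms(1)] by (simp add: B_def)
  have "A * B = (1 / det A) \<cdot>\<^sub>m (A * adj_mat A)"
    unfolding B_def using assms adj_mat(1)[OF assms(1)] by (intro mult_smult_distrib) auto
  also have "\<dots> = 1\<^sub>m n" using assms adj_mat(2)[OF assms(1)] by (intro eq_matI) auto
  finally have 1: "A * B = 1\<^sub>m n" .
  then show ?thesis using mat_mult_left_right_inverse[OF assms(1) B 1] B by blast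
qed

lemma det_vandermonde:
  assumes "inj_on r {..<n}" shows "det (vandermonde n r) \<noteq> 0"
proof
  assume "det (vandermonde n r) = 0"
  then obtain v where v: "v \<in> carrier_vec n" "v \<noteq> 0\<^sub>v n" "vandermonde n r *\<^sub>v v = 0\<^sub>v n"
    using det_0_iff_vec_prod_zero_field[of "vandermonde n r" n] by auto
  have "(\<Sum>j<n. r l ^ j * v $ j) = 0" if "l < n" for l
  proof -
    have "0 = (vandermonde n r *\<^sub>v v) $ l" using v that by simp
    also have "\<dots> = (\<Sum>j<n. r l ^ j * v $ j)"
      using v(1) that by (auto simp: vandermonde_def scalar_prod_def lessThan_atLeast0)
    finally show ?thesis by simp
  qed
  then have "\<forall>j<n. v $ j = 0" using vandermonde_kernel[OF assms, of "\<lambda>j. v $ j"] by blast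
  then show False using v by auto
qed

text \<open>The coefficients stand in the last column, so that for a root r the row (1, r, ...,
  r^(n-1)) is a left eigenvector.\<close>

definition companion :: "nat \<Rightarrow> complex poly \<Rightarrow> complex mat" where
  "companion n p = mat n n (\<lambda>(i, j). if Suc j < n then (if i = Suc j then 1 else 0) else - coeff p i)"

lemma companion_carrier [simp]: "companion n p \<in> carrier_mat n n"
  by (simp add: companion_def)

lemma dim_mat_diag [simp]: "dim_row (mat_diag n r) = n" "dim_col (mat_diag n r) = n"
  by (simp_all add: mat_diag_def)

text \<open>Each row of the Vandermonde matrix is a left eigenvector: all columns but the last shift
  the powers of the root, and the last one reduces r^n by means of p(r) = 0.\<close>

lemma vandermonde_companion:
  assumes "degree p = n" "coeff p n = 1" "\<And>l. l < n \<Longrightarrow> poly p (r l) = 0"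
  shows "vandermonde n r * companion n p = mat_diag n r * vandermonde n r"
proof (intro eq_matI)
  fix l j assume "l < dim_row (mat_diag n r * vandermonde n r)" "j < dim_col (mat_diag n r * vandermonde n r)"
  then have lj: "l < n" "j < n" by (auto simp: vandermonde_def)
  have "(vandermonde n r * companion n p) $$ (l, j) = (\<Sum>i<n. r l ^ i * companion n p $$ (i, j))"
    using lj by (subst mult_mat_index[of _ n n _ n]) (auto simp: vandermonde_def)
  also have "\<dots> = r l ^ Suc j"
  proof (cases "Suc j < n")
    case True
    have "(\<Sum>i<n. r l ^ i * companion n p $$ (i, j)) = (\<Sum>i<n. if i = Suc j then r l ^ Suc j else 0)"
      using lj True by (intro sum.cong) (auto simp: companion_def)
    also have "\<dots> = r l ^ Suc j" using True by (subst sum.delta) auto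
    finally show ?thesis .
  next
    case False
    then have j: "Suc j = n" using lj by simp
    have "0 = (\<Sum>i\<le>n. coeff p i * r l ^ i)" using assms(1) assms(3)[OF lj(1)] by (simp add: poly_altdef)
    also have "\<dots> = r l ^ n + (\<Sum>i<n. coeff p i * r l ^ i)"
      using assms(2) by (simp add: lessThan_Suc_atMost[symmetric] add.commute)
    finally have "r l ^ n = - (\<Sum>i<n. coeff p i * r l ^ i)" by (simp add: eq_neg_iff_add_eq_0)
    moreover have "(\<Sum>i<n. r l ^ i * companion n p $$ (i, j)) = (\<Sum>i<n. - (coeff p i * r l ^ i))"
      using lj False by (intro sum.cong) (auto simp: companion_def)
    ultimately show ?thesis unfolding j by (simp add: sum_negf)
  qed
  also have "\<dots> = (mat_diag n r * vandermonde n r) $$ (l, j)"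
    using lj by (simp add: mat_diag_mult_left[of _ n n] vandermonde_def)
  finally show "(vandermonde n r * companion n p) $$ (l, j) = (mat_diag n r * vandermonde n r) $$ (l, j)" .
qed (auto simp: vandermonde_def companion_def)

definition mtrace :: "nat \<Rightarrow> complex mat \<Rightarrow> complex" where
  "mtrace n A = (\<Sum>i<n. A $$ (i, i))"

lemma mtrace_comm:
  assumes "A \<in> carrier_mat n n" "B \<in> carrier_mat n n"
  shows "mtrace n (A * B) = mtrace n (B * A)"
proof -
  have "mtrace n (A * B) = (\<Sum>i<n. \<Sum>l<n. A $$ (i, l) * B $$ (l, i))"
    unfolding mtrace_def using assms by (intro sum.cong) (auto simp: mult_mat_index[of _ n n _ n] simp del: index_mult_mat)
  also have "\<dots> = (\<Sum>l<n. \<Sum>i<n. B $$ (l, i) * A $$ (i, l))"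
    by (subst sum.swap) (simp add: mult.commute)
  also have "\<dots> = mtrace n (B * A)"
    unfolding mtrace_def using assms by (intro sum.cong) (auto simp: mult_mat_index[of _ n n _ n] simp del: index_mult_mat)
  finally show ?thesis .
qed

lemma mat_diag_pow: "mat_diag n r ^\<^sub>m k = mat_diag n (\<lambda>i. r i ^ k :: complex)"
proof (induction k)
  case 0
  show ?case by (auto simp: mat_diag_def intro!: eq_matI)
next
  case (Suc k)
  then show ?case by (simp add: mat_diag_diag mult.commute)
qed

text \<open>The Vandermonde matrix conjugates the companion matrix to the diagonal of roots. This
  expresses power sums through the coefficients, so they are polynomial in a parameter although the
  roots are not.\<close>

lemma trace_companion_pow:
  assumes "degree p = n" "coeff p n = 1" "\<And>l. l < n \<Longrightarrow> poly p (r l) = 0" "inj_on r {..<n}"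
  shows "mtrace n (companion n p ^\<^sub>m k) = (\<Sum>l<n. r l ^ k)"
proof -
  let ?V = "vandermonde n r" and ?C = "companion n p" and ?D = "mat_diag n r"
  obtain W where W: "W \<in> carrier_mat n n" "?V * W = 1\<^sub>m n" "W * ?V = 1\<^sub>m n"
    using mat_inverse_exists[OF vandermonde_carrier det_vandermonde[OF assms(4)]] by blast
  have Dk: "?D ^\<^sub>m j \<in> carrier_mat n n" for j by (simp add: mat_diag_pow)
  have VC: "?V * ?C = ?D * ?V" by (rule vandermonde_companion[OF assms(1-3)])
  have Vk: "?V * ?C ^\<^sub>m k = ?D ^\<^sub>m k * ?V"
  proof (induction k)
    case (Suc k)
    have "?V * (?C ^\<^sub>m k * ?C) = ?V * ?C ^\<^sub>m k * ?C"
      by (simp add: square_mult_assoc[of _ n] del: index_mult_mat)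
    also have "\<dots> = ?D ^\<^sub>m k * (?V * ?C)" unfolding Suc
      by (rule square_mult_assoc[OF Dk]) auto
    also have "\<dots> = ?D ^\<^sub>m k * ?D * ?V" unfolding VC
      by (rule square_mult_assoc[OF Dk, symmetric]) auto
    finally show ?case by simp
  qed (simp add: vandermonde_def companion_def)
  have "?C ^\<^sub>m k = W * ?V * ?C ^\<^sub>m k" unfolding W(3) by (simp add: companion_def)
  also have "\<dots> = W * (?D ^\<^sub>m k * ?V)" unfolding Vk[symmetric]
    by (rule square_mult_assoc[OF W(1)]) auto
  finally have "mtrace n (?C ^\<^sub>m k) = mtrace n (?D ^\<^sub>m k * ?V * W)"
    using mtrace_comm[OF W(1), of "?D ^\<^sub>m k * ?V"] Dk by simp
  also have "?D ^\<^sub>m k * ?V * W = ?D ^\<^sub>m k"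
    using square_mult_assoc[OF Dk vandermonde_carrier W(1)] right_mult_one_mat[OF Dk] W(2) by simp
  also have "mtrace n \<dots> = (\<Sum>l<n. r l ^ k)"
    by (simp add: mtrace_def mat_diag_pow) (simp add: mat_diag_def)
  finally show ?thesis .
qed

lemma polymat_companion:
  assumes "\<And>j. polyfun (\<lambda>s. coeff (g s) j)"
  shows "polymat n (\<lambda>s. companion n (g s))"
proof -
  have "polyfun (\<lambda>s. companion n (g s) $$ (i, j))" if "i < n" "j < n" for i j
    using that polyfun_uminus[OF assms] by (cases "Suc j < n") (auto simp: companion_def)
  then show ?thesis by (simp add: polymat_def)
qed

lemma polymat_pow: "polymat n Q \<Longrightarrow> polymat n (\<lambda>s. Q s ^\<^sub>m k)"
proof (induction k)
  case 0
  have "dim_row (Q s) = n" for s using 0 by (auto simp: polymat_def)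
  then show ?case using polymat_const[of "1\<^sub>m n" n] by simp
next
  case (Suc k)
  then show ?case using polymat_mult by simp
qed

lemma polyfun_mtrace: "polymat n Q \<Longrightarrow> polyfun (\<lambda>s. mtrace n (Q s))"
  unfolding mtrace_def polymat_def by (intro polyfun_sum) auto

text \<open>The adjugate replaces the inverse wherever entries have to remain polynomial.\<close>

lemma polymat_adj_mat:
  assumes "polymat n Q" shows "polymat n (\<lambda>s. adj_mat (Q s))"
proof -
  have c: "Q s \<in> carrier_mat n n" for s using assms by (simp add: polymat_def)
  have "polyfun (\<lambda>s. adj_mat (Q s) $$ (i, j))" if ij: "i < n" "j < n" for i j
  proof -
    have "polymat (n - 1) (\<lambda>s. mat_delete (Q s) j i)"
      using assms ij c mat_delete_carrier[OF c] by (auto simp: polymat_def mat_delete_def carrier_matD[OF c])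
    then have "polyfun (\<lambda>s. (-1) ^ (j + i) * det (mat_delete (Q s) j i))"
      using polyfun_det by (intro polyfun_mult) auto
    then show ?thesis using ij carrier_matD[OF c] by (simp add: adj_mat_def cofactor_def)
  qed
  then show ?thesis using adj_mat(1)[OF c] by (simp add: polymat_def)
qed


section \<open>Growth, divisibility and unitary diagonal form\<close>

lemma linear_growth_poly:
  fixes p :: "complex poly"
  assumes "\<And>x::real. norm (poly p (of_real x)) \<le> K * (1 + \<bar>x\<bar>)"
  shows "\<exists>a b. p = [:a, b:]"
proof -
  obtain a p1 where p1: "p = pCons a p1" by (cases p) auto
  obtain b q where q: "p1 = pCons b q" by (cases p1) auto
  have "q = 0"
  proof (rule ccontr)
    assume "q \<noteq> 0"
    \<comment> \<open>The threshold beats linear growth: for x at least 1, K (1 + x) is at most 2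
      |K| x and \<open>norm a\<close> is at most x times itself, leaving a surplus of x.\<close>
    from poly_infinity[OF this, of "2 * \<bar>K\<bar> + norm a + 1" b]
    obtain r where r: "\<And>z. r \<le> norm z \<Longrightarrow> 2 * \<bar>K\<bar> + norm a + 1 \<le> norm (poly p1 z)"
      unfolding q by blast
    define x where "x = max r 1"
    have x: "x \<ge> 1" "x \<ge> r" by (auto simp: x_def)
    have "x * (2 * \<bar>K\<bar> + norm a + 1) \<le> x * norm (poly p1 (of_real x))"
      using r[of "of_real x"] x by (intro mult_left_mono) auto
    also have "\<dots> = norm (of_real x * poly p1 (of_real x))" using x by (simp add: norm_mult)
    also have "\<dots> \<le> norm (poly p (of_real x)) + norm a"
      unfolding p1 using norm_triangle_ineq4[of "a + of_real x * poly p1 (of_real x)" a] by simp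
    also have "\<dots> \<le> K * (1 + x) + norm a" using assms[of x] x by simp
    finally have "x * (2 * \<bar>K\<bar> + norm a + 1) \<le> K * (1 + x) + norm a" .
    moreover have "K * (1 + x) \<le> \<bar>K\<bar> * (2 * x)" using x by (intro mult_mono) auto
    moreover have "norm a \<le> x * norm a" using x mult_right_mono[of 1 x "norm a"] by simp
    ultimately show False using x by (simp add: algebra_simps)
  qed
  then show ?thesis using p1 q by auto
qed

text \<open>Over the complex numbers coprimality is the absence of common roots; the roots of
  \<open>d\<close> are cancelled against \<open>f\<close> one at a time.\<close>

lemma dvd_cancel_no_common_root:
  fixes d e f :: "complex poly"
  assumes "d dvd f * e" "d \<noteq> 0" "\<And>z. poly d z = 0 \<Longrightarrow> poly e z \<noteq> 0"
  shows "d dvd f"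
  using assms
proof (induction "degree d" arbitrary: d f)
  case 0
  then show ?case by (metis is_unit_iff_degree unit_imp_dvd)
next
  case (Suc m)
  then obtain l where l: "poly d l = 0" using poly_has_root[of d] by auto
  then obtain d' where d': "d = [:-l, 1:] * d'" by (auto simp: poly_eq_0_iff_dvd dvd_def)
  have "poly (f * e) l = 0" using Suc.prems(1) l by (metis dvdE mult_eq_0_iff poly_mult)
  then have "poly f l = 0" using Suc.prems(3)[OF l] by simp
  then obtain f' where f': "f = [:-l, 1:] * f'" by (auto simp: poly_eq_0_iff_dvd dvd_def)
  have "[:-l, 1:] * d' dvd [:-l, 1:] * (f' * e)"
    using Suc.prems(1) unfolding d' f' by (simp only: mult.assoc)
  then have dvd: "d' dvd f' * e" by (subst (asm) dvd_mult_cancel_left) auto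
  have "d' \<noteq> 0" using Suc.prems(2) d' by auto
  moreover have "m = degree d'" using Suc.hyps(2) \<open>d' \<noteq> 0\<close> unfolding d' by (subst (asm) degree_mult_eq) auto
  moreover have "poly e z \<noteq> 0" if "poly d' z = 0" for z using Suc.prems(3)[of z] that d' by simp
  ultimately have "d' dvd f'" using Suc.hyps(1)[of d' f'] dvd by blast
  then show ?case unfolding d' f' by (rule mult_dvd_mono[OF dvd_refl])
qed

lemma adjoint_mult_adjoint_mult:
  fixes A B :: "complex mat"
  assumes "A \<in> carrier_mat n n" "B \<in> carrier_mat n n"
  shows "mat_adjoint (A * B) * (A * B) = mat_adjoint B * (mat_adjoint A * A) * B"
  using assms mat_adjoint_carrier[OF assms(1)] mat_adjoint_carrier[OF assms(2)]
  by (simp add: mat_adjoint_mult[OF assms] square_mult_assoc[of _ n])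

definition udiag :: "nat \<Rightarrow> complex mat \<Rightarrow> (nat \<Rightarrow> complex) \<Rightarrow> complex mat" where
  "udiag n U r = U * mat_diag n r * mat_adjoint U"

lemma udiag_carrier: "unitary_mat n U \<Longrightarrow> udiag n U r \<in> carrier_mat n n"
  by (simp add: udiag_def unitary_mat_def)

lemma udiag_index:
  assumes "unitary_mat n U" "i < n" "j < n"
  shows "udiag n U r $$ (i, j) = (\<Sum>l<n. U $$ (i, l) * r l * cnj (U $$ (j, l)))"
proof -
  have U: "U \<in> carrier_mat n n" using assms(1) unitary_mat_carrier by blast
  have "udiag n U r $$ (i, j) = (\<Sum>l<n. (U * mat_diag n r) $$ (i, l) * mat_adjoint U $$ (l, j))"
    unfolding udiag_def using U assms(2,3) by (subst mult_mat_index[of _ n n _ n]) auto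
  also have "\<dots> = (\<Sum>l<n. U $$ (i, l) * r l * cnj (U $$ (j, l)))"
    using U assms(2,3) by (intro sum.cong) (auto simp: mat_diag_mult_right[of _ n n])
  finally show ?thesis .
qed

lemma unitary_entry_bound:
  assumes "unitary_mat n U" "i < n" "j < n" shows "norm (U $$ (i, j)) \<le> 1"
proof -
  have U: "U \<in> carrier_mat n n" using assms(1) unitary_mat_carrier by blast
  have "1 = (mat_adjoint U * U) $$ (j, j)" using assms by (simp add: unitary_mat_def)
  also have "\<dots> = (\<Sum>l<n. of_real ((norm (U $$ (l, j)))^2))"
    unfolding adjoint_mult_index[OF U assms(3,3)] complex_norm_square by (simp add: mult.commute)
  finally have "(\<Sum>l<n. (norm (U $$ (l, j)))^2) = 1"
    by (metis of_real_eq_1_iff of_real_sum)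
  moreover have "(norm (U $$ (i, j)))^2 \<le> (\<Sum>l<n. (norm (U $$ (l, j)))^2)"
    using assms(2) by (intro member_le_sum) auto
  ultimately have "(norm (U $$ (i, j)))^2 \<le> 1" by simp
  then show ?thesis by (simp add: power_le_one_iff abs_square_le_1)
qed

text \<open>Entries of a unitary matrix have modulus at most 1, so eigenvalues control entries. This
  converts a bound on roots into the linear growth that forces a pencil.\<close>

lemma udiag_entry_bound:
  assumes "unitary_mat n U" "i < n" "j < n" "\<And>l. l < n \<Longrightarrow> norm (r l) \<le> R"
  shows "norm (udiag n U r $$ (i, j)) \<le> real n * R"
proof -
  have "norm (U $$ (i, l) * r l * cnj (U $$ (j, l))) \<le> R" if "l < n" for l
  proof -
    have "norm (U $$ (i, l)) * norm (r l) * norm (U $$ (j, l)) \<le> 1 * R * 1"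
      using unitary_entry_bound[OF assms(1)] assms that
      by (intro mult_mono) (auto intro: order_trans[OF norm_ge_zero])
    then show ?thesis by (simp add: norm_mult)
  qed
  then have "norm (\<Sum>l<n. U $$ (i, l) * r l * cnj (U $$ (j, l))) \<le> (\<Sum>l<n. R)"
    by (intro sum_norm_le) auto
  then show ?thesis by (simp add: udiag_index[OF assms(1-3)])
qed

lemma udiag_hermitian:
  assumes "unitary_mat n U" "i < n" "j < n" "\<And>l. l < n \<Longrightarrow> r l \<in> \<real>"
  shows "cnj (udiag n U r $$ (j, i)) = udiag n U r $$ (i, j)"
  unfolding udiag_index[OF assms(1-3)] udiag_index[OF assms(1,3,2)] cnj_sum
  using assms(4) by (intro sum.cong) (auto simp: Reals_cnj_iff)

lemma det_udiag:
  assumes "unitary_mat n U"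
  shows "det (t \<cdot>\<^sub>m 1\<^sub>m n - udiag n U r) = (\<Prod>l<n. t - r l)"
proof -
  have U: "U \<in> carrier_mat n n" "U * mat_adjoint U = 1\<^sub>m n"
    using assms by (auto simp: unitary_mat_def)
  have Ua: "mat_adjoint U \<in> carrier_mat n n" using U by simp
  have "U * mat_diag n (\<lambda>l. t - r l) * mat_adjoint U = t \<cdot>\<^sub>m 1\<^sub>m n - udiag n U r"
  proof (intro eq_matI)
    fix i j assume "i < dim_row (t \<cdot>\<^sub>m 1\<^sub>m n - udiag n U r)" "j < dim_col (t \<cdot>\<^sub>m 1\<^sub>m n - udiag n U r)"
    then have ij: "i < n" "j < n" using carrier_matD[OF udiag_carrier[OF assms, of r]] by auto
    have "(\<Sum>l<n. U $$ (i, l) * cnj (U $$ (j, l))) = (U * mat_adjoint U) $$ (i, j)"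
      using ij U Ua by (subst mult_mat_index[of _ n n _ n]) auto
    also have "\<dots> = (if i = j then 1 else 0)" using U ij by simp
    finally have 1: "(\<Sum>l<n. U $$ (i, l) * cnj (U $$ (j, l))) = (if i = j then 1 else 0)" .
    have "(U * mat_diag n (\<lambda>l. t - r l) * mat_adjoint U) $$ (i, j)
      = (\<Sum>l<n. U $$ (i, l) * (t - r l) * cnj (U $$ (j, l)))"
      using udiag_index[OF assms ij] by (simp add: udiag_def)
    also have "\<dots> = (\<Sum>l<n. t * (U $$ (i, l) * cnj (U $$ (j, l))) - U $$ (i, l) * r l * cnj (U $$ (j, l)))"
      by (intro sum.cong) (auto simp: algebra_simps)
    also have "\<dots> = t * (if i = j then 1 else 0) - udiag n U r $$ (i, j)"
      unfolding sum_subtractf sum_distrib_left[symmetric] 1 udiag_index[OF assms ij] ..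
    finally show "(U * mat_diag n (\<lambda>l. t - r l) * mat_adjoint U) $$ (i, j) = (t \<cdot>\<^sub>m 1\<^sub>m n - udiag n U r) $$ (i, j)"
      using ij carrier_matD[OF udiag_carrier[OF assms, of r]] by simp
  qed (use U carrier_matD[OF udiag_carrier[OF assms, of r]] in auto)
  then have "det (t \<cdot>\<^sub>m 1\<^sub>m n - udiag n U r) = det U * det (mat_diag n (\<lambda>l. t - r l)) * det (mat_adjoint U)"
    using U Ua by (metis det_mult mat_diag_dim square_mult_carrier)
  also have "\<dots> = det (mat_diag n (\<lambda>l. t - r l))"
    using det_mult[OF U(1) Ua] U(2) by (simp add: mult.assoc mult.left_commute)
  also have "\<dots> = (\<Prod>l<n. t - r l)"
    by (subst det_upper_triangular[of _ n])
       (auto simp: prod_list_diag_prod mat_diag_def lessThan_atLeast0 intro!: upper_triangularI prod.cong)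
  finally show ?thesis .
qed

text \<open>With \<open>V\<close> the Vandermonde matrix, \<open>U = k\<inverse> Q V\<inverse>\<close> is unitary, so \<open>Q C Q\<inverse>\<close> is diagonalized by it.\<close>
lemma hermitian_companion_conjugate:
  assumes Q: "Q \<in> carrier_mat n n" and k: "k \<noteq> 0"
    and QV: "mat_adjoint Q * Q = (k * cnj k) \<cdot>\<^sub>m (mat_adjoint (vandermonde n r) * vandermonde n r)"
    and p: "degree p = n" "coeff p n = 1" "\<And>l. l < n \<Longrightarrow> poly p (r l) = 0" "inj_on r {..<n}"
  shows "\<exists>U. unitary_mat n U \<and> Q * companion n p * adj_mat Q = det Q \<cdot>\<^sub>m udiag n U r"
proof -
  let ?V = "vandermonde n r" and ?C = "companion n p" and ?D = "mat_diag n r"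
  obtain W where W: "W \<in> carrier_mat n n" "?V * W = 1\<^sub>m n" "W * ?V = 1\<^sub>m n"
    using mat_inverse_exists[OF vandermonde_carrier det_vandermonde[OF p(4)]] by blast
  have Wa: "mat_adjoint W \<in> carrier_mat n n" using W by simp
  define U where "U = (1 / k) \<cdot>\<^sub>m (Q * W)"
  have Uc: "U \<in> carrier_mat n n" using Q W by (simp add: U_def)
  have QW: "mat_adjoint (Q * W) * (Q * W) = (k * cnj k) \<cdot>\<^sub>m 1\<^sub>m n"
  proof -
    have "mat_adjoint (Q * W) * (Q * W) = mat_adjoint W * (mat_adjoint Q * Q) * W"
      by (rule adjoint_mult_adjoint_mult[OF Q W(1)])
    also have "\<dots> = (k * cnj k) \<cdot>\<^sub>m (mat_adjoint W * (mat_adjoint ?V * ?V) * W)"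
      unfolding QV using W(1) Wa mat_adjoint_carrier[OF vandermonde_carrier[of n r]]
      by (simp add: mult_smult_distrib[of _ n n _ n] mult_smult_assoc_mat[of _ n n _ n])
    also have "mat_adjoint W * (mat_adjoint ?V * ?V) * W = mat_adjoint (?V * W) * (?V * W)"
      by (rule adjoint_mult_adjoint_mult[OF _ W(1), symmetric]) simp
    finally show ?thesis unfolding W(2) by simp
  qed
  have "mat_adjoint U * U = 1\<^sub>m n"
  proof (intro eq_matI)
    fix i j assume "i < dim_row (1\<^sub>m n :: complex mat)" "j < dim_col (1\<^sub>m n :: complex mat)"
    then have ij: "i < n" "j < n" by auto
    have c: "Q * W \<in> carrier_mat n n" using Q W by simp
    have "(mat_adjoint U * U) $$ (i, j) = (\<Sum>l<n. cnj (U $$ (l, i)) * U $$ (l, j))"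
      by (rule adjoint_mult_index[OF Uc ij])
    also have "\<dots> = (\<Sum>l<n. 1 / (k * cnj k) * (cnj ((Q * W) $$ (l, i)) * (Q * W) $$ (l, j)))"
      unfolding U_def using ij carrier_matD[OF c] k by (intro sum.cong) (auto simp: field_simps simp del: index_mult_mat(1))
    also have "\<dots> = 1 / (k * cnj k) * (mat_adjoint (Q * W) * (Q * W)) $$ (i, j)"
      unfolding adjoint_mult_index[OF c ij] sum_distrib_left ..
    also have "\<dots> = 1\<^sub>m n $$ (i, j)" unfolding QW using ij k by simp
    finally show "(mat_adjoint U * U) $$ (i, j) = 1\<^sub>m n $$ (i, j)" .
  qed (use Uc in auto)
  then have U: "unitary_mat n U" using Uc by (intro unitary_matI)
  have Ua: "mat_adjoint U \<in> carrier_mat n n" "mat_adjoint U * U = 1\<^sub>m n" using U Uc by (auto simp: unitary_mat_def)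
  have QUV: "Q = k \<cdot>\<^sub>m (U * ?V)"
  proof -
    have "U * ?V = (1 / k) \<cdot>\<^sub>m (Q * W * ?V)" unfolding U_def using Q W
      by (intro mult_smult_assoc_mat[of _ n n _ n]) auto
    also have "Q * W * ?V = Q" using square_mult_assoc[OF Q W(1) vandermonde_carrier] W(3) Q by simp
    finally show ?thesis using k Q by (auto intro!: eq_matI)
  qed
  have "udiag n U r * (U * ?V) = U * ?V * ?C"
  proof -
    have "udiag n U r * (U * ?V) = U * ?D * (mat_adjoint U * U) * ?V"
      unfolding udiag_def using Uc Ua(1) by (simp add: square_mult_assoc[of _ n] del: index_mult_mat)
    also have "\<dots> = U * (?D * ?V)" unfolding Ua(2) using Uc by (simp add: square_mult_assoc[of _ n])
    also have "?D * ?V = ?V * ?C" by (rule vandermonde_companion[OF p(1-3), symmetric])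
    also have "U * (?V * ?C) = U * ?V * ?C"
      by (rule square_mult_assoc[OF Uc, symmetric]) auto
    finally show ?thesis .
  qed
  then have MQ: "udiag n U r * Q = Q * ?C"
    unfolding QUV using udiag_carrier[OF U, of r] Uc
    by (simp add: mult_smult_distrib[of _ n n _ n] mult_smult_assoc_mat[of _ n n _ n])
  \<comment> \<open>With M the unitarily diagonal matrix, M Q = Q C has been shown; multiplying by
    the adjugate instead of the inverse leaves the factor det Q.\<close>
  have "Q * ?C * adj_mat Q = udiag n U r * (Q * adj_mat Q)"
    unfolding MQ[symmetric] using Q udiag_carrier[OF U, of r] adj_mat(1)[OF Q] by (simp add: square_mult_assoc[of _ n])
  also have "\<dots> = det Q \<cdot>\<^sub>m udiag n U r"
    unfolding adj_mat(2)[OF Q] using udiag_carrier[OF U, of r]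
    by (simp add: mult_smult_distrib[of _ n n _ n])
  finally show ?thesis using U by blast
qed


section \<open>Hermitian pencils for simple real roots\<close>

text \<open>For real nodes the Hermite matrix of power sums is V^* V with V the Vandermonde matrix,
  so its form is a sum of squares, definite as soon as the nodes are distinct.\<close>

lemma hermite_form:
  fixes v r :: "nat \<Rightarrow> complex"
  assumes "\<And>l. l < n \<Longrightarrow> r l \<in> \<real>"
  shows "(\<Sum>i<n. \<Sum>j<n. cnj (v i) * (\<Sum>l<n. r l ^ (i + j)) * v j)
    = of_real (\<Sum>l<n. (norm (\<Sum>j<n. r l ^ j * v j))^2)"
proof -
  have "(\<Sum>i<n. \<Sum>j<n. cnj (v i) * (\<Sum>l<n. r l ^ (i + j)) * v j)
    = (\<Sum>i<n. \<Sum>j<n. \<Sum>l<n. (cnj (v i) * r l ^ i) * (r l ^ j * v j))"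
    by (simp add: sum_distrib_left sum_distrib_right power_add mult_ac)
  also have "\<dots> = (\<Sum>i<n. \<Sum>l<n. \<Sum>j<n. (cnj (v i) * r l ^ i) * (r l ^ j * v j))"
    by (intro sum.cong refl sum.swap)
  also have "\<dots> = (\<Sum>l<n. \<Sum>i<n. \<Sum>j<n. (cnj (v i) * r l ^ i) * (r l ^ j * v j))"
    by (rule sum.swap)
  also have "\<dots> = (\<Sum>l<n. (\<Sum>i<n. cnj (v i) * r l ^ i) * (\<Sum>j<n. r l ^ j * v j))"
    by (simp add: sum_product)
  also have "\<dots> = (\<Sum>l<n. of_real ((norm (\<Sum>j<n. r l ^ j * v j))^2))"
  proof (intro sum.cong refl)
    fix l assume "l \<in> {..<n}"
    then have "cnj (r l) = r l" using assms Reals_cnj_iff by auto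
    then have "(\<Sum>i<n. cnj (v i) * r l ^ i) = cnj (\<Sum>j<n. r l ^ j * v j)"
      by (simp add: mult.commute)
    then show "(\<Sum>i<n. cnj (v i) * r l ^ i) * (\<Sum>j<n. r l ^ j * v j) = of_real ((norm (\<Sum>j<n. r l ^ j * v j))^2)"
      unfolding complex_norm_square by (simp add: mult.commute)
  qed
  finally show ?thesis by simp
qed

text \<open>The Hermite matrix of power sums is factored as \<open>Q\<^sup>* Q\<close> with \<open>det Q\<close> zero-free in the closed
  upper half plane; \<open>Q C Q\<inverse>\<close> (\<open>C\<close> the companion matrix) is Hermitian on the real line and has no
  poles above it, hence none below, so it is a polynomial, of degree one by its linear growth.\<close>
lemma pencil_of_strictly_hyperbolic:
  fixes g :: "complex \<Rightarrow> complex poly" and r :: "real \<Rightarrow> nat \<Rightarrow> complex"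
  assumes pf: "\<And>j. polyfun (\<lambda>s. coeff (g s) j)"
    and deg: "\<And>s. degree (g s) = n" "\<And>s. coeff (g s) n = 1"
    and r_inj: "\<And>x. inj_on (r x) {..<n}"
    and r_real: "\<And>x l. l < n \<Longrightarrow> r x l \<in> \<real>"
    and g_r: "\<And>x. g (of_real x) = (\<Prod>l<n. [:- r x l, 1:])"
    and bound: "\<And>x l. l < n \<Longrightarrow> norm (r x l) \<le> R * (1 + \<bar>x\<bar>)"
  shows "\<exists>A B. A \<in> carrier_mat n n \<and> B \<in> carrier_mat n n \<and> mat_adjoint A = A \<and> mat_adjoint B = B \<and>
    (\<forall>(x::real) t. poly (g (of_real x)) t = det (t \<cdot>\<^sub>m 1\<^sub>m n - (of_real x \<cdot>\<^sub>m A + B))) \<and>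
    (\<forall>x::real. \<forall>i<n. \<forall>j<n. norm ((of_real x \<cdot>\<^sub>m A + B) $$ (i, j)) \<le> real n * (R * (1 + \<bar>x\<bar>)))"
proof -
  have root: "poly (g (of_real x)) (r x l) = 0" if "l < n" for x l
    unfolding g_r using that by (auto simp: poly_prod)
  \<comment> \<open>Traces of companion powers instead of power sums of \<open>r\<close>: they are
    polynomial in \<open>s\<close> and make sense off the real line, whereas \<open>r\<close> is an
    arbitrary choice of roots at each real point.\<close>
  define H where "H = (\<lambda>s i j. mtrace n (companion n (g s) ^\<^sub>m (i + j)))"
  have Hx: "H (of_real x) i j = (\<Sum>l<n. r x l ^ (i + j))" for x i j
    unfolding H_def by (rule trace_companion_pow[OF deg root r_inj])
  have Hpf: "polyfun (\<lambda>s. H s i j)" for i j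
    unfolding H_def by (intro polyfun_mtrace polymat_pow polymat_companion pf)
  have rc: "cnj (r x l) = r x l" if "l < n" for x l using r_real[OF that] Reals_cnj_iff by blast
  have Hh: "cnj (H (of_real x) j i) = H (of_real x) i j" for x i j
    unfolding Hx using rc by (simp add: add.commute)
  have Hpos: "Re (\<Sum>i<n. \<Sum>j<n. cnj (v i) * H (of_real x) i j * v j) > 0"
    if v: "\<exists>i<n. v i \<noteq> 0" for x v
  proof -
    have "\<exists>l<n. (\<Sum>j<n. r x l ^ j * v j) \<noteq> 0"
      using vandermonde_kernel[OF r_inj, of x v] v by blast
    then have "(\<Sum>l<n. (norm (\<Sum>j<n. r x l ^ j * v j))^2) > 0"
      by (auto intro!: sum_pos2)
    then show ?thesis unfolding Hx using hermite_form[of n "r x" v] r_real by simp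
  qed
  obtain Q0 k where Q0: "\<forall>i j. polyfun (\<lambda>s. Q0 s i j)" and k: "polyfun k" "\<forall>x::real. k (of_real x) \<noteq> 0"
    and QH: "\<forall>(x::real). \<forall>i<n. \<forall>j<n. (\<Sum>l<n. cnj (Q0 (of_real x) l i) * Q0 (of_real x) l j)
        = k (of_real x) * cnj (k (of_real x)) * H (of_real x) i j"
    using matrix_fejer_riesz_real_line[of H n, OF Hpf Hh Hpos] by blast
  define Q1 where "Q1 = (\<lambda>s. mat n n (\<lambda>(i, j). Q0 s i j))"
  have Q1c: "Q1 s \<in> carrier_mat n n" for s by (simp add: Q1_def)
  have Q1: "polymat n Q1" using Q0 by (auto simp: polymat_def Q1_def)
  have Q1V: "mat_adjoint (Q1 (of_real x)) * Q1 (of_real x) = (k (of_real x) * cnj (k (of_real x))) \<cdot>\<^sub>m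
      (mat_adjoint (vandermonde n (r x)) * vandermonde n (r x))" for x :: real
  proof (intro eq_matI)
    let ?c = "k (of_real x) * cnj (k (of_real x))" and ?V = "vandermonde n (r x)"
    fix i j assume "i < dim_row (?c \<cdot>\<^sub>m (mat_adjoint ?V * ?V))" "j < dim_col (?c \<cdot>\<^sub>m (mat_adjoint ?V * ?V))"
    then have ij: "i < n" "j < n" by (auto simp: vandermonde_def)
    have "(mat_adjoint (Q1 (of_real x)) * Q1 (of_real x)) $$ (i, j) = ?c * H (of_real x) i j"
      unfolding adjoint_mult_index[OF Q1c ij] using QH ij by (simp add: Q1_def)
    also have "H (of_real x) i j = (mat_adjoint ?V * ?V) $$ (i, j)"
      unfolding adjoint_mult_index[OF vandermonde_carrier ij] Hx
      using ij rc by (simp add: vandermonde_def power_add)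
    finally show "(mat_adjoint (Q1 (of_real x)) * Q1 (of_real x)) $$ (i, j) = (?c \<cdot>\<^sub>m (mat_adjoint ?V * ?V)) $$ (i, j)"
      using ij by (simp add: vandermonde_def del: index_mult_mat(1))
  qed (use Q1c in \<open>auto simp: vandermonde_def\<close>)
  have Q1det: "det (Q1 (of_real x)) \<noteq> 0" for x :: real
  proof
    assume 0: "det (Q1 (of_real x)) = 0"
    have "det (mat_adjoint (Q1 (of_real x)) * Q1 (of_real x)) = 0"
      using 0 Q1c by (subst det_mult[of _ n]) auto
    then have "(k (of_real x) * cnj (k (of_real x))) ^ n *
      det (mat_adjoint (vandermonde n (r x)) * vandermonde n (r x)) = 0"
      unfolding Q1V by (simp add: vandermonde_def)
    then have "det (mat_adjoint (vandermonde n (r x)) * vandermonde n (r x)) = 0" using k(2) by auto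
    then have "cnj (det (vandermonde n (r x))) * det (vandermonde n (r x)) = 0"
      by (subst (asm) det_mult[of _ n]) (auto simp: det_mat_adjoint[of _ n])
    then show False using det_vandermonde[OF r_inj] by auto
  qed
  obtain d1 where d1: "\<And>s. det (Q1 s) = poly d1 s" using polyfun_det[OF Q1] unfolding polyfun_def by metis
  have "\<exists>Q. polymat n Q \<and>
    (\<forall>x::real. mat_adjoint (Q (of_real x)) * Q (of_real x) = mat_adjoint (Q1 (of_real x)) * Q1 (of_real x)) \<and>
    (\<forall>z. Im z \<ge> 0 \<longrightarrow> det (Q z) \<noteq> 0)"
  \<comment> \<open>At the start every zero is uninspected: \<open>d1\<close> is the whole
    determinant and \<open>d2\<close> is 1.\<close>
  proof (rule reflect_upper_zeros[OF Q1])
    show "det (Q1 s) = poly d1 s * poly 1 s" for s using d1 by simp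
    show "poly d1 (of_real x) \<noteq> 0" for x :: real using Q1det d1 by metis
  qed auto
  then obtain Q where Q: "polymat n Q"
    and QQ: "\<And>x::real. mat_adjoint (Q (of_real x)) * Q (of_real x) = mat_adjoint (Q1 (of_real x)) * Q1 (of_real x)"
    and Qd: "\<And>z. Im z \<ge> 0 \<Longrightarrow> det (Q z) \<noteq> 0" by blast
  have Qc: "Q s \<in> carrier_mat n n" for s using Q by (simp add: polymat_def)
  obtain d where d: "\<And>s. det (Q s) = poly d s" using polyfun_det[OF Q] unfolding polyfun_def by metis
  have dz: "poly d z \<noteq> 0" if "Im z \<ge> 0" for z using Qd[OF that] d by simp
  \<comment> \<open>This is det Q times Q C Q^{-1}, hence a polynomial matrix; the rest of the
    argument shows that \<open>d\<close>, the determinant, divides each entry.\<close>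
  define F where "F = (\<lambda>s. Q s * companion n (g s) * adj_mat (Q s))"
  have F: "polymat n F" unfolding F_def
    by (intro polymat_mult polymat_companion polymat_adj_mat Q pf)
  have "\<forall>x. \<exists>U. unitary_mat n U \<and> F (of_real x) = det (Q (of_real x)) \<cdot>\<^sub>m udiag n U (r x)"
  proof
    fix x
    show "\<exists>U. unitary_mat n U \<and> F (of_real x) = det (Q (of_real x)) \<cdot>\<^sub>m udiag n U (r x)"
      unfolding F_def
      by (rule hermitian_companion_conjugate[OF Qc k(2)[rule_format] _ deg root r_inj])
        (simp_all add: QQ Q1V)
  qed
  then obtain U where U: "\<And>x. unitary_mat n (U x)"
    "\<And>x. F (of_real x) = det (Q (of_real x)) \<cdot>\<^sub>m udiag n (U x) (r x)" by metis
  have FM: "F (of_real x) $$ (i, j) = poly d (of_real x) * udiag n (U x) (r x) $$ (i, j)"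
    if "i < n" "j < n" for x i j
    unfolding U(2) d using that carrier_matD[OF udiag_carrier[OF U(1), of x "r x"]] by simp
  have "\<exists>a b. \<forall>x. udiag n (U x) (r x) $$ (i, j) = of_real x * a + b" if ij: "i < n" "j < n" for i j
  proof -
    define M where "M = (\<lambda>x. udiag n (U x) (r x))"
    obtain f where f: "\<And>s. F s $$ (i, j) = poly f s" using F ij unfolding polymat_def polyfun_def by metis
    obtain h where h: "\<And>s. F s $$ (j, i) = poly h s" using F ij unfolding polymat_def polyfun_def by metis
    have herm: "cnj (M x $$ (j, i)) = M x $$ (i, j)" for x
      unfolding M_def by (rule udiag_hermitian[OF U(1) ij r_real])
    \<comment> \<open>Hermitian symmetry with denominators cleared. The zeros of \<open>d\<close>
      lie strictly below the real line and those of its conjugate strictly above, so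
      \<open>d\<close> has to divide \<open>f\<close>.\<close>
    have "poly (f * map_poly cnj d) = poly (d * map_poly cnj h)"
    proof (rule polyfun_eqI_real)
      fix x :: real
      show "poly (f * map_poly cnj d) (of_real x) = poly (d * map_poly cnj h) (of_real x)"
        using FM[OF ij, of x] FM[OF ij(2,1), of x] herm[of x] f[of "of_real x"] h[of "of_real x"]
        by (simp add: poly_cnj_conv M_def)
    qed auto
    then have "f * map_poly cnj d = d * map_poly cnj h" using poly_eq_poly_eq_iff by blast
    then have "d dvd f * map_poly cnj d" by simp
    then have "d dvd f"
    proof (rule dvd_cancel_no_common_root)
      show "d \<noteq> 0" using dz[of 0] by auto
      show "poly (map_poly cnj d) z \<noteq> 0" if "poly d z = 0" for z
        using dz[of z] dz[of "cnj z"] that by (cases "Im z \<ge> 0") (auto simp: poly_cnj_conv)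
    qed
    then obtain m where m: "f = d * m" by (elim dvdE)
    have Mm: "M x $$ (i, j) = poly m (of_real x)" for x
      using FM[OF ij, of x] f[of "of_real x"] dz[of "of_real x"] by (simp add: m M_def)
    have "norm (poly m (of_real x)) \<le> real n * R * (1 + \<bar>x\<bar>)" for x
      unfolding Mm[symmetric] M_def
      using udiag_entry_bound[OF U(1) ij, of "r x" "R * (1 + \<bar>x\<bar>)" x] bound by (simp add: mult.assoc)
    from linear_growth_poly[OF this] obtain b a where "m = [:b, a:]" by blast
    then have "\<forall>x. M x $$ (i, j) = of_real x * a + b" using Mm by simp
    then show ?thesis unfolding M_def by blast
  qed
  then obtain a b where ab: "\<And>i j x. i < n \<Longrightarrow> j < n \<Longrightarrow> udiag n (U x) (r x) $$ (i, j) = of_real x * a i j + b i j"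
    by metis
  define A where "A = mat n n (\<lambda>(i, j). a i j)"
  define B where "B = mat n n (\<lambda>(i, j). b i j)"
  have AB: "A \<in> carrier_mat n n" "B \<in> carrier_mat n n" by (auto simp: A_def B_def)
  have M: "of_real x \<cdot>\<^sub>m A + B = udiag n (U x) (r x)" for x
    using ab carrier_matD[OF udiag_carrier[OF U(1), of x "r x"]]
    by (intro eq_matI) (auto simp: A_def B_def)
  have hm: "cnj (udiag n (U x) (r x) $$ (j, i)) = udiag n (U x) (r x) $$ (i, j)" if "i < n" "j < n" for x i j
    by (rule udiag_hermitian[OF U(1) that r_real])
  \<comment> \<open>Hermitian values at x = 0 give the constant term, and then x = 1 gives the
    linear one.\<close>
  have bh: "cnj (b j i) = b i j" if "i < n" "j < n" for i j
    using hm[OF that, of 0] ab[OF that, of 0] ab[OF that(2,1), of 0] by simp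
  have ah: "cnj (a j i) = a i j" if "i < n" "j < n" for i j
    using hm[OF that, of 1] ab[OF that, of 1] ab[OF that(2,1), of 1] bh[OF that] by simp
  have "mat_adjoint A = A" "mat_adjoint B = B"
    unfolding mat_adjoint_eq[OF AB(1)] mat_adjoint_eq[OF AB(2)] using ah bh
    by (auto simp: A_def B_def intro!: eq_matI)
  moreover have "poly (g (of_real x)) t = det (t \<cdot>\<^sub>m 1\<^sub>m n - (of_real x \<cdot>\<^sub>m A + B))" for x t
    unfolding M det_udiag[OF U(1)] g_r by (simp add: poly_prod)
  moreover have "norm ((of_real x \<cdot>\<^sub>m A + B) $$ (i, j)) \<le> real n * (R * (1 + \<bar>x\<bar>))" if "i < n" "j < n" for x i j
    unfolding M using udiag_entry_bound[OF U(1) that] bound by blast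
  ultimately show ?thesis using AB by blast
qed


section \<open>Making real roots simple\<close>

text \<open>The operator 1 + e d/dt. For positive real \<open>e\<close> it keeps all roots real,
  keeps the polynomial monic, and lowers each multiple root by one order without creating new
  multiple roots.\<close>

definition dshift :: "complex \<Rightarrow> complex poly \<Rightarrow> complex poly" where
  "dshift e f = f + smult e (pderiv f)"

lemma coeff_dshift: "coeff (dshift e f) j = coeff f j + e * of_nat (Suc j) * coeff f (Suc j)"
  by (simp add: dshift_def coeff_pderiv)

lemma monic_dshift:
  assumes "degree f = n" "coeff f n = 1"
  shows "degree (dshift e f) = n" "coeff (dshift e f) n = 1"
proof -
  show 1: "coeff (dshift e f) n = 1" using assms by (simp add: coeff_dshift coeff_eq_0)
  have "degree (dshift e f) \<le> n" using assms by (intro degree_le) (auto simp: coeff_dshift coeff_eq_0)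
  then show "degree (dshift e f) = n" using 1 le_degree[of "dshift e f" n] by simp
qed

lemma monic_dshift_funpow:
  assumes "degree f = n" "coeff f n = 1"
  shows "degree ((dshift e ^^ k) f) = n \<and> coeff ((dshift e ^^ k) f) n = 1"
  using assms monic_dshift by (induction k) auto

definition real_rooted :: "complex poly \<Rightarrow> bool" where
  "real_rooted f \<longleftrightarrow> (\<forall>z. poly f z = 0 \<longrightarrow> z \<in> \<real>)"

lemma monic_real_rooted_decompose:
  assumes "degree f = n" "coeff f n = 1" "real_rooted f"
  shows "\<exists>a :: nat \<Rightarrow> real. f = (\<Prod>i<n. [:- of_real (a i), 1:])"
proof -
  obtain r where r: "smult (lead_coeff f) (\<Prod>i<degree f. [:- r i, 1:]) = f"
    using complex_poly_decompose'[of f] by blast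
  then have r: "f = (\<Prod>i<n. [:- r i, 1:])" using assms by simp
  have "r i \<in> \<real>" if "i < n" for i
  proof -
    have "poly f (r i) = 0" unfolding r using that by (auto simp: poly_prod)
    then show ?thesis using assms(3) by (auto simp: real_rooted_def)
  qed
  then have "f = (\<Prod>i<n. [:- of_real (Re (r i)), 1:])" unfolding r by (intro prod.cong) auto
  then show ?thesis by (intro exI[of _ "\<lambda>i. Re (r i)"])
qed

text \<open>Laguerre's inequality: away from the roots f'^2 - f f'' is f^2 times the sum of 1 / (x -
  a_i)^2, hence positive. Adding a linear factor l to f turns it into l^2 (f'^2 - f f'') + f^2,
  which gives the induction. The real numbers \<open>y\<close> and \<open>w\<close> are named
  because the values are complex by type.\<close>

lemma laguerre_real:
  fixes a :: "nat \<Rightarrow> real" and x :: real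
  defines "f \<equiv> \<lambda>n. \<Prod>i<n. [:- complex_of_real (a i), 1:]"
  shows "\<exists>y w. poly (f n) (of_real x) = of_real y \<and>
    poly (pderiv (f n) ^ 2 - f n * pderiv (pderiv (f n))) (of_real x) = of_real w \<and> w \<ge> 0 \<and>
    (n > 0 \<longrightarrow> y \<noteq> 0 \<longrightarrow> w > 0)"
proof (induction n)
  case 0
  show ?case by (intro exI[of _ 1] exI[of _ 0]) (auto simp: f_def)
next
  case (Suc n)
  then obtain y w where yw: "poly (f n) (of_real x) = of_real y"
    "poly (pderiv (f n) ^ 2 - f n * pderiv (pderiv (f n))) (of_real x) = of_real w" "w \<ge> 0" by blast
  define l where "l = [:- complex_of_real (a n), 1:]"
  have l: "pderiv l = 1" "pderiv 1 = (0 :: complex poly)" "poly l (of_real x) = of_real (x - a n)"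
    by (auto simp: l_def pderiv_pCons)
  have f: "f (Suc n) = f n * l" by (simp add: f_def l_def)
  have "pderiv (f (Suc n)) ^ 2 - f (Suc n) * pderiv (pderiv (f (Suc n)))
    = l ^ 2 * (pderiv (f n) ^ 2 - f n * pderiv (pderiv (f n))) + f n ^ 2"
    unfolding f by (simp add: pderiv_mult pderiv_add l power2_eq_square algebra_simps)
  then have "poly (pderiv (f (Suc n)) ^ 2 - f (Suc n) * pderiv (pderiv (f (Suc n)))) (of_real x)
    = (poly l (of_real x)) ^ 2 * poly (pderiv (f n) ^ 2 - f n * pderiv (pderiv (f n))) (of_real x)
      + (poly (f n) (of_real x)) ^ 2"
    by (simp only: poly_add poly_mult poly_power)
  also have "\<dots> = of_real ((x - a n) ^ 2 * w + y ^ 2)"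
    unfolding yw l by simp
  finally have 1: "poly (pderiv (f (Suc n)) ^ 2 - f (Suc n) * pderiv (pderiv (f (Suc n)))) (of_real x)
    = of_real ((x - a n) ^ 2 * w + y ^ 2)" .
  have 2: "poly (f (Suc n)) (of_real x) = of_real (y * (x - a n))"
    unfolding f using yw l by simp
  show ?case
    by (rule exI[of _ "y * (x - a n)"], rule exI[of _ "(x - a n) ^ 2 * w + y ^ 2"])
       (use 1 2 yw(3) in \<open>auto intro: add_nonneg_pos\<close>)
qed

lemma poly_pderiv_prod:
  fixes n :: nat
  assumes "\<And>i. i < n \<Longrightarrow> z \<noteq> r i"
  shows "poly (pderiv (\<Prod>i<n. [:- r i, 1:])) z = poly (\<Prod>i<n. [:- r i, 1:]) z * (\<Sum>i<n. 1 / (z - r i :: complex))"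
  using assms
proof (induction n)
  case (Suc n)
  have d: "pderiv [:- r n, 1:] = 1" by (simp add: pderiv_pCons)
  have nz: "z - r n \<noteq> 0" using Suc.prems[of n] by simp
  show ?case using Suc nz unfolding prod.lessThan_Suc sum.lessThan_Suc pderiv_mult d
    by (simp add: field_simps)
qed simp

text \<open>Off the roots of \<open>f\<close> the equation reads 1 + e S = 0 with S the sum of 1 /
  (z - a_i). The imaginary part of S vanishes only for real z, and if every a_i were farther from z
  than n e, then |S| would be below 1 / e.\<close>

lemma dshift_roots:
  fixes a :: "nat \<Rightarrow> real" and e :: real
  assumes f: "f = (\<Prod>i<n. [:- complex_of_real (a i), 1:])" and e: "e > 0"
    and z: "poly (dshift (of_real e) f) z = 0"
  shows "z \<in> \<real> \<and> (\<exists>w. poly f w = 0 \<and> norm (z - w) \<le> real n * e)"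
proof (cases "poly f z = 0")
  case True
  then have "z \<in> \<real>" unfolding f by (auto simp: poly_prod)
  then show ?thesis using True e by (auto intro!: exI[of _ z])
next
  case False
  have ne: "z \<noteq> of_real (a i)" if "i < n" for i using False that unfolding f by (auto simp: poly_prod)
  define S where "S = (\<Sum>i<n. 1 / (z - of_real (a i)))"
  have "poly f z * (1 + of_real e * S) = 0"
    using z poly_pderiv_prod[of n z "\<lambda>i. of_real (a i)"] ne unfolding dshift_def f S_def
    by (simp add: algebra_simps)
  then have eS: "of_real e * S = -1" using False by (simp add: eq_neg_iff_add_eq_0 add.commute)
  have n: "n > 0" using eS by (cases "n = 0") (auto simp: S_def)
  have ImS: "Im S = - Im z * (\<Sum>i<n. 1 / (norm (z - of_real (a i)))^2)"
    unfolding S_def Im_sum sum_distrib_left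
    by (intro sum.cong) (auto simp: Im_divide cmod_power2)
  have "e * Im S = Im (of_real e * S)" by simp
  then have "Im S = 0" using e unfolding eS by simp
  moreover have "(\<Sum>i<n. 1 / (norm (z - of_real (a i)))^2) > 0"
    using n ne by (intro sum_pos) auto
  ultimately have zr: "z \<in> \<real>" using ImS by (simp add: complex_is_Real_iff)
  have "\<exists>i<n. norm (z - of_real (a i)) \<le> real n * e"
  proof (rule ccontr)
    assume "\<not> (\<exists>i<n. norm (z - of_real (a i)) \<le> real n * e)"
    then have lt: "norm (1 / (z - of_real (a i))) < 1 / (real n * e)" if "i < n" for i
      using that n e ne[OF that] divide_strict_left_mono[of "real n * e" "norm (z - of_real (a i))" 1]
      by (auto simp: norm_divide not_le)
    have "norm S \<le> (\<Sum>i<n. norm (1 / (z - of_real (a i))))" unfolding S_def by (rule norm_sum)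
    also have "\<dots> < (\<Sum>i<n. 1 / (real n * e))" using lt n by (intro sum_strict_mono) auto
    also have "\<dots> = 1 / e" using n by simp
    finally have "e * norm S < 1" using e by (simp add: field_simps)
    moreover have "e * norm S = norm (of_real e * S)" using e by (simp add: norm_mult)
    ultimately show False unfolding eS by simp
  qed
  then obtain i where "i < n" "norm (z - of_real (a i)) \<le> real n * e" by blast
  then show ?thesis using zr unfolding f by (auto simp: poly_prod intro!: exI[of _ "of_real (a i)"])
qed

text \<open>At a root of \<open>f\<close> of order m the derivative has order exactly m - 1, so the
  sum has order below m. Every other root is new and simple by Laguerre's inequality, which accounts
  for the 1 in the maximum.\<close>

lemma order_dshift_le:
  fixes a :: "nat \<Rightarrow> real" and e :: real
  assumes f: "f = (\<Prod>i<n. [:- complex_of_real (a i), 1:])" and e: "e > 0" and f0: "dshift (of_real e) f \<noteq> 0"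
    and k: "\<And>z. order z f \<le> k"
  shows "order z (dshift (of_real e) f) \<le> max 1 (k - 1)"
proof (cases "poly (dshift (of_real e) f) z = 0")
  case False
  then show ?thesis by (simp add: order_0I)
next
  case True
  let ?g = "dshift (of_real e) f"
  have fnz: "f \<noteq> 0" unfolding f by auto
  show ?thesis
  proof (cases "poly f z = 0")
    case fz: True
    define m where "m = order z f"
    have m: "m > 0" "m \<le> k" using fz fnz k[of z] by (auto simp: m_def order_root)
    have "degree f \<noteq> 0" using fz fnz m order_degree[OF fnz, of z] by (auto simp: m_def)
    then have pd: "pderiv f \<noteq> 0" by (simp add: pderiv_eq_0_iff)
    have mm: "m = Suc (order z (pderiv f))"
      using order_pderiv[OF fnz fz] by (simp add: m_def)
    have "\<not> [:- z, 1:] ^ m dvd ?g"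
    proof
      assume d: "[:- z, 1:] ^ m dvd ?g"
      have "[:- z, 1:] ^ m dvd f" unfolding m_def by (rule order_1)
      with d have "[:- z, 1:] ^ m dvd ?g - f" by (rule dvd_diff)
      then have "[:- z, 1:] ^ m dvd smult (of_real e) (pderiv f)" by (simp add: dshift_def)
      then have "[:- z, 1:] ^ m dvd pderiv f" using e by (simp add: dvd_smult_iff)
      then have "m \<le> order z (pderiv f)" using pd unfolding order_divides by simp
      then show False using mm by simp
    qed
    then have "order z ?g < m" using f0 by (simp add: order_divides)
    then show ?thesis using m by simp
  next
    case fz: False
    have pz: "poly f z = - of_real e * poly (pderiv f) z"
      using True by (simp add: dshift_def eq_neg_iff_add_eq_0)
    have zr: "z \<in> \<real>" using dshift_roots[OF f e True] by blast
    then obtain x where x: "z = of_real x" by (auto elim: Reals_cases)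
    have n: "n > 0"
    proof (rule ccontr)
      assume "\<not> n > 0"
      then show False using True by (simp add: f dshift_def)
    qed
    obtain y w where yw: "poly f (of_real x) = of_real y"
      "poly (pderiv f ^ 2 - f * pderiv (pderiv f)) (of_real x) = of_real w" "n > 0 \<longrightarrow> y \<noteq> 0 \<longrightarrow> w > 0"
      using laguerre_real[where n = n and a = a and x = x, folded f] by blast
    have "y \<noteq> 0" using fz yw(1) x by auto
    then have "w \<noteq> 0" using yw(3) n by auto
    \<comment> \<open>At a new root f = - e f', so the Laguerre expression f'^2 - f f'' becomes f'
      (f' + e f'') = f' g'.\<close>
    have "of_real w = poly (pderiv f) z * poly (pderiv ?g) z"
    proof -
      have "of_real w = (poly (pderiv f) z)^2 - poly f z * poly (pderiv (pderiv f)) z"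
        using yw(2) x by simp
      then show ?thesis unfolding pz
        by (simp add: dshift_def pderiv_add pderiv_smult power2_eq_square algebra_simps)
    qed
    then have "poly (pderiv ?g) z \<noteq> 0" using \<open>w \<noteq> 0\<close> by auto
    then have g': "order z (pderiv ?g) = 0" "pderiv ?g \<noteq> 0" by (auto simp: order_0I)
    have "order z ?g = 1" using order_pderiv[OF f0 True] g'(1) by simp
    then show ?thesis by simp
  qed
qed

text \<open>No root of \<open>f\<close> has order above \<open>n\<close>, and each step takes one
  off that bound; for \<open>k = n\<close> the bound is 1. Every step moves roots by at most n e,
  and these displacements add up.\<close>

lemma dshift_funpow_simple:
  fixes e :: real
  assumes f: "degree f = n" "coeff f n = 1" "real_rooted f" and e: "e > 0"
  shows "real_rooted ((dshift (of_real e) ^^ k) f) \<and> (\<forall>z. order z ((dshift (of_real e) ^^ k) f) \<le> max 1 (n - k)) \<and>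
    (\<forall>z. poly ((dshift (of_real e) ^^ k) f) z = 0 \<longrightarrow> (\<exists>w. poly f w = 0 \<and> norm (z - w) \<le> real k * (real n * e)))"
proof (induction k)
  case 0
  have "f \<noteq> 0" using f(2) by auto
  then have "order z f \<le> max 1 n" for z using order_degree[of f z] f(1) by simp
  then show ?case using f by auto
next
  case (Suc k)
  define h where "h = (dshift (of_real e) ^^ k) f"
  have h: "degree h = n" "coeff h n = 1" using monic_dshift_funpow[OF f(1,2)] by (auto simp: h_def)
  obtain a where a: "h = (\<Prod>i<n. [:- complex_of_real (a i), 1:])"
    using monic_real_rooted_decompose[OF h] Suc by (auto simp: h_def)
  have nz: "dshift (of_real e) h \<noteq> 0" using monic_dshift(2)[OF h] by (metis coeff_0 zero_neq_one)
  have S: "(dshift (of_real e) ^^ Suc k) f = dshift (of_real e) h" by (simp add: h_def)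
  show ?case unfolding S
  proof (intro conjI allI impI)
    show "real_rooted (dshift (of_real e) h)"
      unfolding real_rooted_def using dshift_roots[OF a e] by blast
    fix z
    have "order w h \<le> max 1 (n - k)" for w using Suc by (auto simp: h_def)
    from order_dshift_le[OF a e nz this, of z]
    show "order z (dshift (of_real e) h) \<le> max 1 (n - Suc k)" by linarith
    assume "poly (dshift (of_real e) h) z = 0"
    then obtain w where w: "poly h w = 0" "norm (z - w) \<le> real n * e" using dshift_roots[OF a e] by blast
    then obtain v where v: "poly f v = 0" "norm (w - v) \<le> real k * (real n * e)" using Suc by (auto simp: h_def)
    have "norm (z - v) \<le> norm (z - w) + norm (w - v)" using norm_triangle_ineq[of "z - w" "w - v"] by simp
    also have "\<dots> \<le> real (Suc k) * (real n * e)" using w v by (simp add: algebra_simps)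
    finally show "\<exists>w. poly f w = 0 \<and> norm (z - w) \<le> real (Suc k) * (real n * e)" using v(1) by blast
  qed
qed

lemma simple_roots_decompose:
  fixes f :: "complex poly"
  assumes "degree f = n" "coeff f n = 1" "\<And>z. order z f \<le> 1"
  shows "\<exists>r. inj_on r {..<n} \<and> f = (\<Prod>l<n. [:- r l, 1:])"
proof -
  have f0: "f \<noteq> 0" using assms(2) by auto
  have "rsquarefree f" unfolding rsquarefree_def using f0 assms(3) by (metis le_Suc_eq le_zero_eq One_nat_def)
  then have d: "f = (\<Prod>z | poly f z = 0. [:- z, 1:])"
    using complex_poly_decompose_rsquarefree[of f] assms by simp
  have fin: "finite {z. poly f z = 0}" using f0 by (rule poly_roots_finite)
  have "degree f = card {z. poly f z = 0}"
    by (subst d) (simp add: degree_prod_sum_eq)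
  then obtain r where r: "bij_betw r {..<n} {z. poly f z = 0}"
    using ex_bij_betw_nat_finite[OF fin] assms(1) by (auto simp: lessThan_atLeast0)
  have "f = (\<Prod>l<n. [:- r l, 1:])"
    by (subst d) (rule prod.reindex_bij_betw[OF r, symmetric])
  then show ?thesis using r by (auto simp: bij_betw_def)
qed

lemma polyfun_coeff_dshift_funpow:
  assumes "\<And>j. polyfun (\<lambda>s. coeff (g s) j)"
  shows "polyfun (\<lambda>s. coeff ((dshift e ^^ k) (g s)) j)"
proof (induction k arbitrary: j)
  case 0 then show ?case using assms by simp
next
  case (Suc k) then show ?case by (auto simp: coeff_dshift intro!: polyfun_add polyfun_mult)
qed

lemma tendsto_coeff_dshift_funpow:
  assumes "e \<longlonglongrightarrow> 0"
  shows "(\<lambda>m. coeff ((dshift (e m) ^^ k) f) j) \<longlonglongrightarrow> coeff f j"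
proof (induction k arbitrary: j)
  case (Suc k)
  have "(\<lambda>m. coeff ((dshift (e m) ^^ k) f) j + e m * of_nat (Suc j) * coeff ((dshift (e m) ^^ k) f) (Suc j))
      \<longlonglongrightarrow> coeff f j + 0 * of_nat (Suc j) * coeff f (Suc j)"
    by (intro tendsto_intros Suc assms)
  then show ?case by (simp add: coeff_dshift)
qed simp

lemma tendsto_poly_dshift_funpow:
  assumes "e \<longlonglongrightarrow> 0" "degree f = n" "coeff f n = 1"
  shows "(\<lambda>m. poly ((dshift (e m) ^^ k) f) t) \<longlonglongrightarrow> poly f t"
proof -
  have "(\<lambda>m. \<Sum>j\<le>n. coeff ((dshift (e m) ^^ k) f) j * t ^ j) \<longlonglongrightarrow> (\<Sum>j\<le>n. coeff f j * t ^ j)"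
    by (intro tendsto_intros tendsto_coeff_dshift_funpow assms(1))
  then show ?thesis using monic_dshift_funpow[OF assms(2,3)] assms(2) by (simp add: poly_altdef)
qed


section \<open>Compactness and pencils for arbitrary real roots\<close>

lemma bounded_complex_convergent_subseq:
  fixes X :: "nat \<Rightarrow> complex"
  assumes "\<And>m. norm (X m) \<le> K"
  shows "\<exists>f. strict_mono f \<and> convergent (\<lambda>m. X (f m))"
proof -
  obtain f where f: "strict_mono f" "monoseq (\<lambda>m. Re (X (f m)))"
    using seq_monosub[of "\<lambda>m. Re (X m)"] by blast
  have "Bseq (\<lambda>m. Re (X (f m)))"
    using assms abs_Re_le_cmod by (intro BseqI'[of _ K]) (auto intro: order_trans)
  then have 1: "convergent (\<lambda>m. Re (X (f m)))" using f(2) by (rule Bseq_monoseq_convergent)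
  obtain h where h: "strict_mono h" "monoseq (\<lambda>m. Im (X (f (h m))))"
    using seq_monosub[of "\<lambda>m. Im (X (f m))"] by blast
  have "Bseq (\<lambda>m. Im (X (f (h m))))"
    using assms abs_Im_le_cmod by (intro BseqI'[of _ K]) (auto intro: order_trans)
  then have 2: "convergent (\<lambda>m. Im (X (f (h m))))" using h(2) by (rule Bseq_monoseq_convergent)
  have 3: "convergent (\<lambda>m. Re (X (f (h m))))"
    using convergent_subseq_convergent[OF 1 h(1)] by (simp add: o_def)
  obtain a b where "(\<lambda>m. Re (X (f (h m)))) \<longlonglongrightarrow> a" "(\<lambda>m. Im (X (f (h m)))) \<longlonglongrightarrow> b"
    using 2 3 by (auto simp: convergent_def)
  then have "(\<lambda>m. Complex (Re (X (f (h m)))) (Im (X (f (h m))))) \<longlonglongrightarrow> Complex a b"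
    by (rule tendsto_Complex)
  then have "convergent (\<lambda>m. X ((f \<circ> h) m))" by (auto simp: convergent_def)
  then show ?thesis using strict_mono_o[OF f(1) h(1)] by blast
qed

text \<open>Successive extraction, one coordinate at a time; convergence already achieved passes to
  later subsequences.\<close>

lemma common_convergent_subseq:
  fixes X :: "nat \<Rightarrow> 'i \<Rightarrow> complex"
  assumes "finite I" "\<And>m i. i \<in> I \<Longrightarrow> norm (X m i) \<le> K"
  shows "\<exists>f. strict_mono f \<and> (\<forall>i\<in>I. convergent (\<lambda>m. X (f m) i))"
  using assms
proof (induction I rule: finite_induct)
  case empty
  then show ?case by (intro exI[of _ id]) (auto simp: strict_mono_def)
next
  case (insert i I)
  then obtain f where f: "strict_mono f" "\<forall>j\<in>I. convergent (\<lambda>m. X (f m) j)" by auto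
  obtain h where h: "strict_mono h" "convergent (\<lambda>m. X (f (h m)) i)"
    using bounded_complex_convergent_subseq[of "\<lambda>m. X (f m) i" K] insert.prems by auto
  have "convergent (\<lambda>m. X (f (h m)) j)" if "j \<in> I" for j
    using convergent_subseq_convergent[OF f(2)[rule_format, OF that] h(1)] by (simp add: o_def)
  then have "\<forall>j\<in>insert i I. convergent (\<lambda>m. X ((f \<circ> h) m) j)" using h(2) by simp
  then show ?case using strict_mono_o[OF f(1) h(1)] by blast
qed

lemma tendsto_det:
  fixes F :: "'a \<Rightarrow> complex mat"
  assumes "\<And>m. F m \<in> carrier_mat n n" "G \<in> carrier_mat n n"
    "\<And>i j. i < n \<Longrightarrow> j < n \<Longrightarrow> ((\<lambda>m. F m $$ (i, j)) \<longlongrightarrow> G $$ (i, j)) net"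
  shows "((\<lambda>m. det (F m)) \<longlongrightarrow> det G) net"
  unfolding det_def'[OF assms(1)] det_def'[OF assms(2)]
  by (intro tendsto_sum tendsto_mult tendsto_prod tendsto_const assms(3)) auto

text \<open>Smoothing by \<open>n\<close> steps makes the roots simple at every real point, so a
  pencil exists for each perturbation. Bounds independent of the perturbation allow a limit, and
  Hermitian symmetry and the determinantal identity are closed conditions.\<close>

lemma pencil_of_hyperbolic:
  fixes g :: "complex \<Rightarrow> complex poly"
  assumes pf: "\<And>j. polyfun (\<lambda>s. coeff (g s) j)"
    and deg: "\<And>s. degree (g s) = n" "\<And>s. coeff (g s) n = 1"
    and rr: "\<And>x::real. real_rooted (g (of_real x))"
    and bound: "\<And>(x::real) t. poly (g (of_real x)) t = 0 \<Longrightarrow> norm t \<le> R * (1 + \<bar>x\<bar>)"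
  shows "\<exists>A B. A \<in> carrier_mat n n \<and> B \<in> carrier_mat n n \<and> mat_adjoint A = A \<and> mat_adjoint B = B \<and>
    (\<forall>(x::real) t. poly (g (of_real x)) t = det (t \<cdot>\<^sub>m 1\<^sub>m n - (of_real x \<cdot>\<^sub>m A + B)))"
proof -
  define e where "e = (\<lambda>m::nat. 1 / (real m + 1))"
  have e: "e m > 0" "e m \<le> 1" for m by (auto simp: e_def)
  have elim: "(\<lambda>m. complex_of_real (e m)) \<longlonglongrightarrow> 0"
  proof -
    have "e \<longlonglongrightarrow> 0" unfolding e_def using LIMSEQ_inverse_real_of_nat by (simp add: inverse_eq_divide add.commute)
    then show ?thesis using tendsto_of_real[of e 0] by simp
  qed
  define h where "h = (\<lambda>m s. (dshift (of_real (e m)) ^^ n) (g s))"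
  \<comment> \<open>\<open>n\<close> smoothing steps move a root by at most n * n * e m, and e m is
    at most 1; the absolute value makes the bound monotone in 1 + |x|.\<close>
  define R' where "R' = \<bar>R\<bar> + real n * real n"
  have R'0: "R' \<ge> 0" by (simp add: R'_def)
  have hdeg: "degree (h m s) = n" "coeff (h m s) n = 1" for m s
    using monic_dshift_funpow[OF deg] by (auto simp: h_def)
  have simple: "real_rooted (h m (of_real x))" "order z (h m (of_real x)) \<le> 1"
     "poly (h m (of_real x)) z = 0 \<Longrightarrow> norm z \<le> R' * (1 + \<bar>x\<bar>)" for m z and x :: real
  proof -
    note * = dshift_funpow_simple[OF deg(1)[of "of_real x"] deg(2)[of "of_real x"] rr[of x] e(1)[of m], where k = n]
    show "real_rooted (h m (of_real x))" "order z (h m (of_real x)) \<le> 1"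
      using * by (auto simp: h_def)
    assume "poly (h m (of_real x)) z = 0"
    then obtain w where w: "poly (g (of_real x)) w = 0" "norm (z - w) \<le> real n * (real n * e m)"
      using * by (auto simp: h_def)
    have "norm z \<le> norm w + norm (z - w)" using norm_triangle_ineq[of w "z - w"] by simp
    also have "norm w \<le> R * (1 + \<bar>x\<bar>)" by (rule bound[OF w(1)])
    also have "R * (1 + \<bar>x\<bar>) \<le> \<bar>R\<bar> * (1 + \<bar>x\<bar>)" by (intro mult_right_mono) auto
    also have "norm (z - w) \<le> real n * real n * (1 + \<bar>x\<bar>)"
    proof -
      have "real n * (real n * e m) \<le> real n * (real n * 1)"
        using e by (intro mult_left_mono) auto
      also have "\<dots> \<le> real n * real n * (1 + \<bar>x\<bar>)" by (simp add: distrib_left)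
      finally show ?thesis using w(2) by simp
    qed
    finally show "norm z \<le> R' * (1 + \<bar>x\<bar>)" by (simp add: R'_def distrib_right)
  qed
  have "\<exists>A B. A \<in> carrier_mat n n \<and> B \<in> carrier_mat n n \<and> mat_adjoint A = A \<and> mat_adjoint B = B \<and>
    (\<forall>(x::real) t. poly (h m (of_real x)) t = det (t \<cdot>\<^sub>m 1\<^sub>m n - (of_real x \<cdot>\<^sub>m A + B))) \<and>
    (\<forall>x::real. \<forall>i<n. \<forall>j<n. norm ((of_real x \<cdot>\<^sub>m A + B) $$ (i, j)) \<le> real n * (R' * (1 + \<bar>x\<bar>)))" for m
  proof -
    have "\<forall>x::real. \<exists>r. inj_on r {..<n} \<and> h m (of_real x) = (\<Prod>l<n. [:- r l, 1:])"
      using simple_roots_decompose[OF hdeg simple(2)] by blast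
    then obtain r where r: "\<And>x::real. inj_on (r x) {..<n}" "\<And>x. h m (of_real x) = (\<Prod>l<n. [:- r x l, 1:])"
      by metis
    have root: "poly (h m (of_real x)) (r x l) = 0" if "l < n" for x l
      unfolding r(2) using that by (auto simp: poly_prod)
    show ?thesis
    proof (rule pencil_of_strictly_hyperbolic[where r = r])
      show "polyfun (\<lambda>s. coeff (h m s) j)" for j
        unfolding h_def by (rule polyfun_coeff_dshift_funpow[OF pf])
      show "r x l \<in> \<real>" if "l < n" for x l
        using root[OF that] simple(1) unfolding real_rooted_def by blast
      show "norm (r x l) \<le> R' * (1 + \<bar>x\<bar>)" if "l < n" for x l
        using simple(3)[OF root[OF that]] .
    qed (use hdeg r in auto)
  qed
  then obtain A B where AB: "\<And>m. A m \<in> carrier_mat n n" "\<And>m. B m \<in> carrier_mat n n"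
    "\<And>m. mat_adjoint (A m) = A m" "\<And>m. mat_adjoint (B m) = B m"
    and hAB: "\<And>m (x::real) t. poly (h m (of_real x)) t = det (t \<cdot>\<^sub>m 1\<^sub>m n - (of_real x \<cdot>\<^sub>m A m + B m))"
    and ABb: "\<And>m (x::real) i j. i < n \<Longrightarrow> j < n \<Longrightarrow>
      norm ((of_real x \<cdot>\<^sub>m A m + B m) $$ (i, j)) \<le> real n * (R' * (1 + \<bar>x\<bar>))"
    by metis
  \<comment> \<open>A is the pencil at x = 1 minus the pencil at x = 0; the bounds at these points
    carry the factors 2 and 1.\<close>
  define K where "K = real n * (R' * 3)"
  have Bb: "norm (B m $$ (i, j)) \<le> real n * R'" if "i < n" "j < n" for m i j
    using ABb[OF that, of 0 m] AB(1,2)[of m] that by simp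
  have Ab: "norm (A m $$ (i, j)) \<le> K" if "i < n" "j < n" for m i j
  proof -
    have "A m $$ (i, j) = (of_real 1 \<cdot>\<^sub>m A m + B m) $$ (i, j) - B m $$ (i, j)"
      using AB(1,2)[of m] that by simp
    then have "norm (A m $$ (i, j)) \<le> norm ((of_real 1 \<cdot>\<^sub>m A m + B m) $$ (i, j)) + norm (B m $$ (i, j))"
      by (metis norm_triangle_ineq4)
    also have "\<dots> \<le> real n * (R' * (1 + \<bar>1\<bar>)) + real n * R'"
      using ABb[OF that, of 1 m] Bb[OF that] by (intro add_mono) auto
    finally show ?thesis by (simp add: K_def mult_ac)
  qed
  have Bb': "norm (B m $$ (i, j)) \<le> K" if "i < n" "j < n" for m i j
  proof -
    have "real n * R' \<le> K" unfolding K_def using R'0 by (intro mult_left_mono) auto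
    then show ?thesis using Bb[OF that, of m] by linarith
  qed
  \<comment> \<open>All entries of both matrix sequences in one finite family, so that a single
    subsequence serves them all.\<close>
  define X where "X = (\<lambda>m (b, i, j). (if b then A m else B m) $$ (i, j))"
  define I where "I = (UNIV :: bool set) \<times> {..<n} \<times> {..<n}"
  obtain f where f: "strict_mono f" "\<forall>i\<in>I. convergent (\<lambda>m. X (f m) i)"
  proof -
    have "norm (X m i) \<le> K" if "i \<in> I" for m i
      using that Ab Bb' by (cases i) (auto simp: I_def X_def)
    moreover have "finite I" by (simp add: I_def)
    ultimately show ?thesis using that common_convergent_subseq[of I X K] by blast
  qed
  have "\<exists>L. (\<lambda>m. A (f m) $$ (i, j)) \<longlonglongrightarrow> L" if "i < n" "j < n" for i j
    using f(2)[rule_format, of "(True, i, j)"] that by (simp add: I_def X_def convergent_def)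
  then obtain a where a: "\<And>i j. i < n \<Longrightarrow> j < n \<Longrightarrow> (\<lambda>m. A (f m) $$ (i, j)) \<longlonglongrightarrow> a i j" by metis
  have "\<exists>L. (\<lambda>m. B (f m) $$ (i, j)) \<longlonglongrightarrow> L" if "i < n" "j < n" for i j
    using f(2)[rule_format, of "(False, i, j)"] that by (simp add: I_def X_def convergent_def)
  then obtain b where b: "\<And>i j. i < n \<Longrightarrow> j < n \<Longrightarrow> (\<lambda>m. B (f m) $$ (i, j)) \<longlonglongrightarrow> b i j" by metis
  define A0 where "A0 = mat n n (\<lambda>(i, j). a i j)"
  define B0 where "B0 = mat n n (\<lambda>(i, j). b i j)"
  have c: "A0 \<in> carrier_mat n n" "B0 \<in> carrier_mat n n" by (auto simp: A0_def B0_def)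
  have "cnj (a j i) = a i j" if ij: "i < n" "j < n" for i j
  proof -
    have "cnj (A m $$ (j, i)) = A m $$ (i, j)" for m
      using mat_adjoint_index[OF AB(1) ij, of m] AB(3) by simp
    then have "(\<lambda>m. A (f m) $$ (i, j)) \<longlonglongrightarrow> cnj (a j i)"
      using tendsto_cnj[OF a[OF ij(2,1)]] by simp
    then show ?thesis using LIMSEQ_unique a[OF ij] by blast
  qed
  then have "mat_adjoint A0 = A0" unfolding mat_adjoint_eq[OF c(1)] by (auto simp: A0_def intro!: eq_matI)
  moreover have "cnj (b j i) = b i j" if ij: "i < n" "j < n" for i j
  proof -
    have "cnj (B m $$ (j, i)) = B m $$ (i, j)" for m
      using mat_adjoint_index[OF AB(2) ij, of m] AB(4) by simp
    then have "(\<lambda>m. B (f m) $$ (i, j)) \<longlonglongrightarrow> cnj (b j i)"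
      using tendsto_cnj[OF b[OF ij(2,1)]] by simp
    then show ?thesis using LIMSEQ_unique b[OF ij] by blast
  qed
  then have "mat_adjoint B0 = B0" unfolding mat_adjoint_eq[OF c(2)] by (auto simp: B0_def intro!: eq_matI)
  moreover have "poly (g (of_real x)) t = det (t \<cdot>\<^sub>m 1\<^sub>m n - (of_real x \<cdot>\<^sub>m A0 + B0))" for x :: real and t
  proof -
    have "(\<lambda>m. det (t \<cdot>\<^sub>m 1\<^sub>m n - (of_real x \<cdot>\<^sub>m A (f m) + B (f m)))) \<longlonglongrightarrow>
       det (t \<cdot>\<^sub>m 1\<^sub>m n - (of_real x \<cdot>\<^sub>m A0 + B0))"
    proof (rule tendsto_det)
      fix i j assume ij: "i < n" "j < n"
      have "(\<lambda>m. t * 1\<^sub>m n $$ (i, j) - (of_real x * A (f m) $$ (i, j) + B (f m) $$ (i, j))) \<longlonglongrightarrow>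
         t * 1\<^sub>m n $$ (i, j) - (of_real x * a i j + b i j)"
        by (intro tendsto_intros a b ij)
      then show "(\<lambda>m. (t \<cdot>\<^sub>m 1\<^sub>m n - (of_real x \<cdot>\<^sub>m A (f m) + B (f m))) $$ (i, j)) \<longlonglongrightarrow>
         (t \<cdot>\<^sub>m 1\<^sub>m n - (of_real x \<cdot>\<^sub>m A0 + B0)) $$ (i, j)"
        using ij carrier_matD[OF AB(1)] carrier_matD[OF AB(2)] by (simp add: A0_def B0_def)
    next
      fix m show "t \<cdot>\<^sub>m 1\<^sub>m n - (of_real x \<cdot>\<^sub>m A (f m) + B (f m)) \<in> carrier_mat n n"
        by (intro minus_carrier_mat add_carrier_mat AB(2))
    qed (use c in auto)
    moreover have "(\<lambda>m. poly (h (f m) (of_real x)) t) \<longlonglongrightarrow> poly (g (of_real x)) t"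
      unfolding h_def
      using tendsto_poly_dshift_funpow[OF elim deg, of n "of_real x" t] LIMSEQ_subseq_LIMSEQ[OF _ f(1)]
      by (fastforce simp: o_def)
    ultimately show ?thesis unfolding hAB using LIMSEQ_unique by blast
  qed
  ultimately show ?thesis using c by blast
qed


section \<open>Hermitian diagonalization and the block form of the pencil\<close>

lemma mult_mat_vec_index:
  "A \<in> carrier_mat n m \<Longrightarrow> v \<in> carrier_vec m \<Longrightarrow> i < n \<Longrightarrow> (A *\<^sub>v v) $ i = (\<Sum>j<m. A $$ (i, j) * v $ j)"
  by (auto simp: scalar_prod_def lessThan_atLeast0)

lemma unitary_block:
  assumes "unitary_mat n U"
  shows "unitary_mat (Suc n) (mat (Suc n) (Suc n) (\<lambda>(i, j). case i of 0 \<Rightarrow> (case j of 0 \<Rightarrow> 1 | Suc _ \<Rightarrow> 0)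
    | Suc i' \<Rightarrow> (case j of 0 \<Rightarrow> 0 | Suc j' \<Rightarrow> U $$ (i', j'))))" (is "unitary_mat _ ?V")
proof (rule unitary_matI)
  have U: "U \<in> carrier_mat n n" "mat_adjoint U * U = 1\<^sub>m n" using assms by (auto simp: unitary_mat_def)
  show c: "?V \<in> carrier_mat (Suc n) (Suc n)" by simp
  show "mat_adjoint ?V * ?V = 1\<^sub>m (Suc n)"
  proof (intro eq_matI)
    fix i j assume "i < dim_row (1\<^sub>m (Suc n) :: complex mat)" "j < dim_col (1\<^sub>m (Suc n) :: complex mat)"
    then have ij: "i < Suc n" "j < Suc n" by auto
    have "(\<Sum>l<n. cnj (U $$ (l, i')) * U $$ (l, j')) = (if i' = j' then 1 else 0)" if "i' < n" "j' < n" for i' j'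
      using adjoint_mult_index[OF U(1) that] U(2) that by simp
    then show "(mat_adjoint ?V * ?V) $$ (i, j) = 1\<^sub>m (Suc n) $$ (i, j)"
      unfolding adjoint_mult_index[OF c ij] sum.lessThan_Suc_shift
      using ij by (cases i; cases j) (auto simp del: sum.lessThan_Suc)
  qed auto
qed

lemma udiag_mult_left:
  assumes "unitary_mat n W" "unitary_mat n U"
  shows "udiag n (W * U) r = W * udiag n U r * mat_adjoint W"
proof -
  have c: "W \<in> carrier_mat n n" "U \<in> carrier_mat n n" using assms by (auto simp: unitary_mat_def)
  then show ?thesis unfolding udiag_def
    using mat_adjoint_carrier[OF c(1)] mat_adjoint_carrier[OF c(2)]
    by (simp add: mat_adjoint_mult[OF c] square_mult_assoc[of _ n] del: index_mult_mat)
qed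

lemma det_char_conjugate:
  assumes "unitary_mat n W" "A \<in> carrier_mat n n"
  shows "det (t \<cdot>\<^sub>m 1\<^sub>m n - mat_adjoint W * A * W) = det (t \<cdot>\<^sub>m 1\<^sub>m n - A)"
proof -
  have W: "W \<in> carrier_mat n n" "mat_adjoint W \<in> carrier_mat n n" "mat_adjoint W * W = 1\<^sub>m n"
    using assms by (auto simp: unitary_mat_def)
  have "mat_adjoint W * (t \<cdot>\<^sub>m 1\<^sub>m n - A) * W = mat_adjoint W * (t \<cdot>\<^sub>m 1\<^sub>m n) * W - mat_adjoint W * A * W"
    using W assms(2) by (simp add: mult_minus_distrib_mat[of _ n n _ n] minus_mult_distrib_mat[of _ n n _ _ n])
  also have "mat_adjoint W * (t \<cdot>\<^sub>m 1\<^sub>m n) * W = t \<cdot>\<^sub>m (mat_adjoint W * W)"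
    using W by (simp add: mult_smult_distrib[of _ n n _ n] mult_smult_assoc_mat[of _ n n _ n])
  finally have "t \<cdot>\<^sub>m 1\<^sub>m n - mat_adjoint W * A * W = mat_adjoint W * (t \<cdot>\<^sub>m 1\<^sub>m n - A) * W" unfolding W(3) by simp
  also have "det \<dots> = det (mat_adjoint W) * det W * det (t \<cdot>\<^sub>m 1\<^sub>m n - A)"
    using W minus_carrier_mat[OF assms(2), of "t \<cdot>\<^sub>m 1\<^sub>m n"] by (simp add: det_mult[of _ n])
  also have "det (mat_adjoint W) * det W = 1"
    using det_mult[OF W(2,1)] W(3) by simp
  finally show ?thesis by simp
qed

lemma det_block_diag:
  fixes M :: "complex mat"
  assumes "M \<in> carrier_mat (Suc n) (Suc n)" "\<And>j. j < n \<Longrightarrow> M $$ (0, Suc j) = 0"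
  shows "det M = M $$ (0, 0) * det (mat n n (\<lambda>(i, j). M $$ (Suc i, Suc j)))"
proof -
  have "M = four_block_mat (mat 1 1 (\<lambda>_. M $$ (0, 0))) (0\<^sub>m 1 n) (mat n 1 (\<lambda>(i, _). M $$ (Suc i, 0)))
      (mat n n (\<lambda>(i, j). M $$ (Suc i, Suc j)))"
    using assms by (intro eq_matI) (auto simp: less_Suc_eq_0_disj)
  then have "det M = det (mat 1 1 (\<lambda>_. M $$ (0, 0))) * det (mat n n (\<lambda>(i, j). M $$ (Suc i, Suc j)))"
    using det_four_block_mat_upper_right_zero[of "mat 1 1 (\<lambda>_. M $$ (0, 0))" 1 "0\<^sub>m 1 n" n
      "mat n 1 (\<lambda>(i, _). M $$ (Suc i, 0))" "mat n n (\<lambda>(i, j). M $$ (Suc i, Suc j))"] by simp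
  moreover have "det (mat 1 1 (\<lambda>_. M $$ (0, 0))) = M $$ (0, 0)" by (subst det_single) auto
  ultimately show ?thesis by (simp only:)
qed

lemma polyfun_det_char:
  assumes "A \<in> carrier_mat n n" shows "polyfun (\<lambda>t. det (t \<cdot>\<^sub>m 1\<^sub>m n - A))"
  using assms by (intro polyfun_det) (auto simp: polymat_def intro!: polyfun_diff polyfun_mult)

text \<open>Deflation: a unitary matrix whose first column is an eigenvector for \<open>r 0\<close>
  splits off that eigenvalue, the first row vanishing by Hermitian symmetry. The eigenvalues come
  out in the prescribed order, which the block form relies on.\<close>

lemma hermitian_diagonalization:
  fixes A :: "complex mat"
  assumes "A \<in> carrier_mat n n" "mat_adjoint A = A" "\<And>t. det (t \<cdot>\<^sub>m 1\<^sub>m n - A) = (\<Prod>l<n. t - r l)"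
  shows "\<exists>U. unitary_mat n U \<and> A = udiag n U r"
  using assms
proof (induction n arbitrary: A r)
  case 0
  have "unitary_mat 0 (1\<^sub>m 0)" by (rule unitary_matI) auto
  moreover have "A = udiag 0 (1\<^sub>m 0) r" using 0 carrier_matD[OF udiag_carrier[OF calculation]] by (intro eq_matI) auto
  ultimately show ?case by blast
next
  case (Suc n)
  let ?N = "Suc n"
  note A = Suc.prems(1)
  have "det (r 0 \<cdot>\<^sub>m 1\<^sub>m ?N - A) = 0" unfolding Suc.prems(3) by (intro prod_zero) auto
  then obtain v where v: "v \<in> carrier_vec ?N" "v \<noteq> 0\<^sub>v ?N" "(r 0 \<cdot>\<^sub>m 1\<^sub>m ?N - A) *\<^sub>v v = 0\<^sub>v ?N"
    using det_0_iff_vec_prod_zero_field[of "r 0 \<cdot>\<^sub>m 1\<^sub>m ?N - A" ?N] minus_carrier_mat[OF A] by blast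
  have Av: "(\<Sum>j<?N. A $$ (i, j) * v $ j) = r 0 * v $ i" if i: "i < ?N" for i
  proof -
    have "0 = ((r 0 \<cdot>\<^sub>m 1\<^sub>m ?N - A) *\<^sub>v v) $ i" using v(3) i by simp
    also have "\<dots> = (\<Sum>j<?N. (r 0 \<cdot>\<^sub>m 1\<^sub>m ?N - A) $$ (i, j) * v $ j)"
      using A v(1) i by (intro mult_mat_vec_index) auto
    also have "\<dots> = (\<Sum>j<?N. (if j = i then r 0 * v $ j else 0) - A $$ (i, j) * v $ j)"
      using A i by (intro sum.cong) (auto simp: algebra_simps)
    also have "\<dots> = r 0 * v $ i - (\<Sum>j<?N. A $$ (i, j) * v $ j)"
      using i by (simp add: sum_subtractf del: sum.lessThan_Suc)
    finally show ?thesis by simp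
  qed
  have "\<exists>i<?N. v $ i \<noteq> 0" using v(1,2) by (metis carrier_vecD eq_vecI index_zero_vec(1) index_zero_vec(2))
  then obtain W c where W: "unitary_mat ?N W" "\<forall>i<?N. W $$ (i, 0) = c * v $ i"
    using unitary_first_column[of ?N "\<lambda>i. v $ i"] by auto
  have Wc: "W \<in> carrier_mat ?N ?N" "mat_adjoint W \<in> carrier_mat ?N ?N"
    and WW: "mat_adjoint W * W = 1\<^sub>m ?N" "W * mat_adjoint W = 1\<^sub>m ?N"
    using W(1) by (auto simp: unitary_mat_def)
  define A1 where "A1 = mat_adjoint W * A * W"
  have A1c: "A1 \<in> carrier_mat ?N ?N" using A Wc by (simp add: A1_def)
  have A1h: "mat_adjoint A1 = A1"
    unfolding A1_def using Wc A Suc.prems(2) by (simp add: mat_adjoint_mult[of _ ?N] square_mult_assoc[of _ ?N])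
  have A1h': "cnj (A1 $$ (j, i)) = A1 $$ (i, j)" if "i < ?N" "j < ?N" for i j
    using mat_adjoint_index[OF A1c that] A1h by simp
  have AW: "(A * W) $$ (i, 0) = r 0 * W $$ (i, 0)" if i: "i < ?N" for i
  proof -
    have "(A * W) $$ (i, 0) = (\<Sum>j<?N. A $$ (i, j) * (c * v $ j))"
      using i W(2) by (subst mult_mat_index[OF A Wc(1)]) auto
    also have "\<dots> = c * (\<Sum>j<?N. A $$ (i, j) * v $ j)" unfolding sum_distrib_left by (intro sum.cong) auto
    finally show ?thesis unfolding Av[OF i] using W(2) i by simp
  qed
  have col: "A1 $$ (i, 0) = (if i = 0 then r 0 else 0)" if i: "i < ?N" for i
  proof -
    have "A1 $$ (i, 0) = (mat_adjoint W * (A * W)) $$ (i, 0)"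
      unfolding A1_def using square_mult_assoc[OF Wc(2) A Wc(1)] by simp
    also have "\<dots> = (\<Sum>l<?N. mat_adjoint W $$ (i, l) * (r 0 * W $$ (l, 0)))"
      using i A Wc AW by (subst mult_mat_index[of _ ?N ?N _ ?N]) auto
    also have "\<dots> = r 0 * (\<Sum>l<?N. mat_adjoint W $$ (i, l) * W $$ (l, 0))"
      unfolding sum_distrib_left by (intro sum.cong) auto
    also have "(\<Sum>l<?N. mat_adjoint W $$ (i, l) * W $$ (l, 0)) = (mat_adjoint W * W) $$ (i, 0)"
      using i by (subst mult_mat_index[OF Wc(2,1)]) auto
    finally show ?thesis unfolding WW using i by simp
  qed
  have row: "A1 $$ (0, Suc j) = 0" if "j < n" for j
    using A1h'[of 0 "Suc j"] col[of "Suc j"] that by simp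
  have r0: "cnj (r 0) = r 0" using A1h'[of 0 0] col[of 0] by simp
  define A' where "A' = mat n n (\<lambda>(i, j). A1 $$ (Suc i, Suc j))"
  have A'c: "A' \<in> carrier_mat n n" by (simp add: A'_def)
  have "mat_adjoint A' = A'"
    unfolding mat_adjoint_eq[OF A'c] using A1h' by (auto simp: A'_def intro!: eq_matI)
  \<comment> \<open>Dividing the characteristic polynomial by t - r 0 is legitimate away from
    \<open>r 0\<close>; polynomial identity covers that point.\<close>
  moreover have "(\<lambda>t. det (t \<cdot>\<^sub>m 1\<^sub>m n - A')) = (\<lambda>t. \<Prod>l<n. t - r (Suc l))"
  proof (rule polyfun_eqI)
    show "infinite (- {r 0})" by (rule infinite_Compl_finite) auto
    fix t assume t: "t \<in> - {r 0}"
    let ?M = "t \<cdot>\<^sub>m 1\<^sub>m ?N - A1"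
    have M: "?M \<in> carrier_mat ?N ?N" by (rule minus_carrier_mat[OF A1c])
    have "(t - r 0) * (\<Prod>l<n. t - r (Suc l)) = det (t \<cdot>\<^sub>m 1\<^sub>m ?N - A)"
      unfolding Suc.prems(3) by (simp add: prod.lessThan_Suc_shift del: prod.lessThan_Suc)
    also have "\<dots> = det ?M" unfolding A1_def by (rule det_char_conjugate[OF W(1) A, symmetric])
    also have "\<dots> = ?M $$ (0, 0) * det (mat n n (\<lambda>(i, j). ?M $$ (Suc i, Suc j)))"
      using A1c row by (intro det_block_diag[OF M]) auto
    also have "?M $$ (0, 0) = t - r 0" using A1c col[of 0] by simp
    also have "mat n n (\<lambda>(i, j). ?M $$ (Suc i, Suc j)) = t \<cdot>\<^sub>m 1\<^sub>m n - A'"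
      using A1c by (intro eq_matI) (auto simp: A'_def)
    finally show "det (t \<cdot>\<^sub>m 1\<^sub>m n - A') = (\<Prod>l<n. t - r (Suc l))" using t by auto
  qed (use polyfun_det_char[OF A'c] in \<open>auto intro!: polyfun_prod polyfun_diff\<close>)
  then have "det (t \<cdot>\<^sub>m 1\<^sub>m n - A') = (\<Prod>l<n. t - r (Suc l))" for t by metis
  ultimately obtain U' where U': "unitary_mat n U'" "A' = udiag n U' (\<lambda>l. r (Suc l))"
    using Suc.IH[OF A'c, of "\<lambda>l. r (Suc l)"] by blast
  define V where "V = mat ?N ?N (\<lambda>(i, j). case i of 0 \<Rightarrow> (case j of 0 \<Rightarrow> 1 | Suc _ \<Rightarrow> 0)
    | Suc i' \<Rightarrow> (case j of 0 \<Rightarrow> 0 | Suc j' \<Rightarrow> U' $$ (i', j')))"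
  have V: "unitary_mat ?N V" unfolding V_def by (rule unitary_block[OF U'(1)])
  have "A1 = udiag ?N V r"
  proof (intro eq_matI)
    fix i j assume "i < dim_row (udiag ?N V r)" "j < dim_col (udiag ?N V r)"
    then have ij: "i < ?N" "j < ?N" using carrier_matD[OF udiag_carrier[OF V, of r]] by auto
    have "A1 $$ (Suc i', Suc j') = (\<Sum>l<n. U' $$ (i', l) * r (Suc l) * cnj (U' $$ (j', l)))"
      if "i' < n" "j' < n" for i' j'
      using udiag_index[OF U'(1) that, of "\<lambda>l. r (Suc l)"] that unfolding U'(2)[symmetric] by (simp add: A'_def)
    then show "A1 $$ (i, j) = udiag ?N V r $$ (i, j)"
      unfolding udiag_index[OF V ij] sum.lessThan_Suc_shift
      using ij row col by (cases i; cases j) (auto simp: V_def simp del: sum.lessThan_Suc)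
  qed (use A1c carrier_matD[OF udiag_carrier[OF V, of r]] in auto)
  moreover have "A = W * A1 * mat_adjoint W"
  proof -
    have "W * A1 * mat_adjoint W = (W * mat_adjoint W) * A * (W * mat_adjoint W)"
      unfolding A1_def using Wc A by (simp add: square_mult_assoc[of _ ?N] del: index_mult_mat)
    then show ?thesis unfolding WW using A by simp
  qed
  ultimately have "A = udiag ?N (W * V) r" using udiag_mult_left[OF W(1) V] by simp
  then show ?case using unitary_mat_mult[OF W(1) V] by blast
qed

text \<open>\<open>block_diag n\<^sub>1 n\<^sub>2 x y\<close> is \<open>x I \<oplus> y I\<close>, in a form with accessible entries.\<close>
definition block_diag :: "nat \<Rightarrow> nat \<Rightarrow> complex \<Rightarrow> complex \<Rightarrow> complex mat" where
  "block_diag n1 n2 x y = mat_diag (n1 + n2) (\<lambda>l. if l < n1 then x else y)"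

lemma block_diag_carrier [simp]: "block_diag n1 n2 x y \<in> carrier_mat (n1 + n2) (n1 + n2)"
  by (simp add: block_diag_def)

lemma block_diag_index [simp]:
  "i < n1 + n2 \<Longrightarrow> j < n1 + n2 \<Longrightarrow>
    block_diag n1 n2 x y $$ (i, j) = (if i = j then (if i < n1 then x else y) else 0)"
  by (simp add: block_diag_def mat_diag_def)

lemma prod_block: "(\<Prod>l<n1 + n2. if l < n1 then x else y) = x ^ n1 * (y :: complex) ^ n2"
  by (induction n2) (simp_all add: mult_ac)

text \<open>The hypothesis \<open>top\<close> is the characteristic polynomial of -A, so an
  eigenbasis turns -A into I (+) 0. In it, t I - x A becomes (t + x) I (+) t I, and -B becomes the
  Hermitian \<open>C\<close>.\<close>

lemma pencil_block_form:
  assumes "A \<in> carrier_mat (n1 + n2) (n1 + n2)" "B \<in> carrier_mat (n1 + n2) (n1 + n2)"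
    and "mat_adjoint A = A" "mat_adjoint B = B"
    and top: "\<And>t. det (t \<cdot>\<^sub>m 1\<^sub>m (n1 + n2) + A) = (t - 1) ^ n1 * t ^ n2"
  shows "\<exists>C. C \<in> carrier_mat (n1 + n2) (n1 + n2) \<and> mat_adjoint C = C \<and>
    (\<forall>t x. det (t \<cdot>\<^sub>m 1\<^sub>m (n1 + n2) - (x \<cdot>\<^sub>m A + B)) = det (block_diag n1 n2 (t + x) t + C))"
proof -
  define n where "n = n1 + n2"
  have A: "A \<in> carrier_mat n n" "-A \<in> carrier_mat n n" and B: "B \<in> carrier_mat n n" using assms by (auto simp: n_def)
  \<comment> \<open>Eigenvalues of -A, listed in the order of the two blocks.\<close>
  define r where "r = (\<lambda>l::nat. if l < n1 then 1 else 0 :: complex)"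
  have Ah: "cnj (A $$ (j, i)) = A $$ (i, j)" if "i < n" "j < n" for i j
    using mat_adjoint_index[OF A(1) that] assms(3) by simp
  have "mat_adjoint (-A) = -A"
    unfolding mat_adjoint_eq[OF A(2)] using A Ah by (auto intro!: eq_matI)
  moreover have "det (t \<cdot>\<^sub>m 1\<^sub>m n - (- A)) = (\<Prod>l<n. t - r l)" for t
  proof -
    have "t \<cdot>\<^sub>m 1\<^sub>m n - (- A) = t \<cdot>\<^sub>m 1\<^sub>m n + A" using A by (intro eq_matI) auto
    moreover have "(\<Prod>l<n. t - r l) = (\<Prod>l<n1 + n2. if l < n1 then t - 1 else t)"
      unfolding n_def r_def by (intro prod.cong) auto
    ultimately show ?thesis using top[of t] unfolding prod_block n_def by simp
  qed
  ultimately obtain U where U: "unitary_mat n U" "-A = udiag n U r"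
    using hermitian_diagonalization[OF A(2)] by blast
  have Uc: "U \<in> carrier_mat n n" "mat_adjoint U \<in> carrier_mat n n"
    and UU: "mat_adjoint U * U = 1\<^sub>m n" "U * mat_adjoint U = 1\<^sub>m n"
    using U(1) by (auto simp: unitary_mat_def)
  define C0 where "C0 = mat_adjoint U * B * U"
  have C0: "C0 \<in> carrier_mat n n" "mat_adjoint C0 = C0"
    unfolding C0_def using Uc B assms(4) by (auto simp: mat_adjoint_mult[of _ n] square_mult_assoc[of _ n])
  have C0h: "cnj (C0 $$ (j, i)) = C0 $$ (i, j)" if "i < n" "j < n" for i j
    using mat_adjoint_index[OF C0(1) that] C0(2) by simp
  define C where "C = - C0"
  have C: "C \<in> carrier_mat n n" "mat_adjoint C = C"
  proof -
    show c: "C \<in> carrier_mat n n" using C0 by (simp add: C_def)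
    show "mat_adjoint C = C" unfolding mat_adjoint_eq[OF c] using C0 C0h by (auto simp: C_def intro!: eq_matI)
  qed
  have UAU: "mat_adjoint U * A * U = - mat_diag n r"
  proof -
    have "A = - udiag n U r" using U(2) A by (metis uminus_uminus_mat)
    then have "mat_adjoint U * A * U = - (mat_adjoint U * udiag n U r * U)"
      using Uc udiag_carrier[OF U(1), of r] by simp
    also have "mat_adjoint U * udiag n U r * U = (mat_adjoint U * U) * mat_diag n r * (mat_adjoint U * U)"
      unfolding udiag_def using Uc by (simp add: square_mult_assoc[of _ n] del: index_mult_mat)
    finally show ?thesis unfolding UU by simp
  qed
  have "det (t \<cdot>\<^sub>m 1\<^sub>m n - (x \<cdot>\<^sub>m A + B)) = det (block_diag n1 n2 (t + x) t + C)" for t x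
  proof -
    have "mat_adjoint U * (x \<cdot>\<^sub>m A + B) * U = mat_adjoint U * (x \<cdot>\<^sub>m A) * U + C0"
      unfolding C0_def using Uc A B
      by (simp add: mult_add_distrib_mat[of _ n n _ n] add_mult_distrib_mat[of _ n n _ _ n])
    also have "mat_adjoint U * (x \<cdot>\<^sub>m A) * U = x \<cdot>\<^sub>m (- mat_diag n r)"
      unfolding UAU[symmetric] using Uc A
      by (simp add: mult_smult_distrib[of _ n n _ n] mult_smult_assoc_mat[of _ n n _ n])
    finally have "t \<cdot>\<^sub>m 1\<^sub>m n - mat_adjoint U * (x \<cdot>\<^sub>m A + B) * U = block_diag n1 n2 (t + x) t + C"
      using C0 by (intro eq_matI) (auto simp: C_def block_diag_def mat_diag_def r_def n_def)
    then show ?thesis using det_char_conjugate[OF U(1), of "x \<cdot>\<^sub>m A + B" t] A B by simp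
  qed
  then show ?thesis using C unfolding n_def by blast
qed


section \<open>The Cayley transform of the bivariate polynomial\<close>

definition polyfam :: "(complex \<Rightarrow> complex poly) \<Rightarrow> bool" where
  "polyfam g \<longleftrightarrow> (\<forall>j. polyfun (\<lambda>s. coeff (g s) j))"

lemma polyfam_const: "polyfam (\<lambda>_. p)" by (simp add: polyfam_def)

lemma polyfam_mult: "polyfam f \<Longrightarrow> polyfam g \<Longrightarrow> polyfam (\<lambda>s. f s * g s)"
  unfolding polyfam_def coeff_mult by (intro allI polyfun_sum polyfun_mult) auto

lemma polyfam_power: "polyfam f \<Longrightarrow> polyfam (\<lambda>s. f s ^ k)"
  by (induction k) (auto intro: polyfam_mult polyfam_const)

lemma polyfam_sum: "(\<And>i. i \<in> I \<Longrightarrow> polyfam (f i)) \<Longrightarrow> polyfam (\<lambda>s. \<Sum>i\<in>I. f i s)"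
  unfolding polyfam_def coeff_sum by (intro allI polyfun_sum) auto

lemma polyfam_smult: "polyfam f \<Longrightarrow> polyfam (\<lambda>s. smult c (f s))"
  unfolding polyfam_def coeff_smult by auto

lemma polyfam_linear:
  assumes "polyfun f" shows "polyfam (\<lambda>s. [:f s, 1:])"
  unfolding polyfam_def
proof
  fix j show "polyfun (\<lambda>s. coeff [:f s, 1:] j)"
    using assms by (cases j; cases "j - 1") auto
qed

text \<open>Evaluation from a coefficient array in a fixed degree box: rotating the variables then
  only changes the array, and no degrees have to be recomputed.\<close>

definition coeff_sum2 :: "nat \<Rightarrow> nat \<Rightarrow> (nat \<Rightarrow> nat \<Rightarrow> complex) \<Rightarrow> complex \<Rightarrow> complex \<Rightarrow> complex" where
  "coeff_sum2 n1 n2 a x y = (\<Sum>j\<le>n2. \<Sum>i\<le>n1. a i j * x ^ i * y ^ j)"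

lemma tendsto_coeff_sum2:
  assumes "(f \<longlongrightarrow> x) F" "(g \<longlongrightarrow> y) F"
  shows "((\<lambda>m. coeff_sum2 n1 n2 a (f m) (g m)) \<longlongrightarrow> coeff_sum2 n1 n2 a x y) F"
  unfolding coeff_sum2_def by (intro tendsto_intros assms)

lemma coeff_sum2_nonzero_nearby:
  assumes "coeff_sum2 n1 n2 a x y \<noteq> 0"
  shows "\<exists>d>0. \<forall>u v. norm (u - x) < d \<longrightarrow> norm (v - y) < d \<longrightarrow> coeff_sum2 n1 n2 a u v \<noteq> 0"
proof (rule ccontr)
  assume c: "\<not> ?thesis"
  have "\<exists>u v. norm (u - x) < inverse (real (Suc m)) \<and> norm (v - y) < inverse (real (Suc m)) \<and> coeff_sum2 n1 n2 a u v = 0" for m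
    using c by (metis inverse_positive_iff_positive of_nat_0_less_iff zero_less_Suc)
  then obtain u v where uv: "\<And>m. norm (u m - x) < inverse (real (Suc m))"
    "\<And>m. norm (v m - y) < inverse (real (Suc m))" "\<And>m. coeff_sum2 n1 n2 a (u m) (v m) = 0" by metis
  have "u \<longlonglongrightarrow> x" "v \<longlonglongrightarrow> y"
    by (rule metric_tendsto_imp_tendsto[OF LIMSEQ_inverse_real_of_nat],
        use uv in \<open>auto intro!: always_eventually less_imp_le simp: dist_norm\<close>)+
  then have "(\<lambda>m. coeff_sum2 n1 n2 a (u m) (v m)) \<longlonglongrightarrow> coeff_sum2 n1 n2 a x y"
    by (rule tendsto_coeff_sum2)
  then have "(\<lambda>m. 0) \<longlonglongrightarrow> coeff_sum2 n1 n2 a x y" using uv(3) by simp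
  then show False using assms LIMSEQ_const_iff by metis
qed

text \<open>The polynomial \<open>t \<mapsto> f (t + s) t\<close>, where \<open>f\<close> is the Cayley transform
  \<open>(x + \<i>\<tau>)^n\<^sub>1 (y + \<i>\<tau>)^n\<^sub>2 p ((x - \<i>\<tau>) / (x + \<i>\<tau>)) ((y - \<i>\<tau>) / (y + \<i>\<tau>))\<close> of \<open>p = \<Sum> a\<^sub>i\<^sub>j z\<^sub>1^i z\<^sub>2^j\<close>;
  the parameter \<open>\<tau>\<close> homogenizes it.\<close>
definition cayley_poly :: "nat \<Rightarrow> nat \<Rightarrow> (nat \<Rightarrow> nat \<Rightarrow> complex) \<Rightarrow> complex \<Rightarrow> complex \<Rightarrow> complex poly" where
  "cayley_poly n1 n2 a \<tau> s = (\<Sum>j\<le>n2. \<Sum>i\<le>n1. smult (a i j)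
     (([:s - \<i> * \<tau>, 1:] ^ i * [:s + \<i> * \<tau>, 1:] ^ (n1 - i)) * ([:- \<i> * \<tau>, 1:] ^ j * [:\<i> * \<tau>, 1:] ^ (n2 - j))))"

lemma poly_cayley_poly:
  "poly (cayley_poly n1 n2 a \<tau> s) t = (\<Sum>j\<le>n2. \<Sum>i\<le>n1. a i j *
     (((t + s - \<i> * \<tau>) ^ i * (t + s + \<i> * \<tau>) ^ (n1 - i)) * ((t - \<i> * \<tau>) ^ j * (t + \<i> * \<tau>) ^ (n2 - j))))"
  unfolding cayley_poly_def by (simp add: poly_sum algebra_simps)

lemma poly_cayley_poly_eq:
  assumes "t + s + \<i> \<noteq> 0" "t + \<i> \<noteq> 0"
  shows "poly (cayley_poly n1 n2 a 1 s) t = (t + s + \<i>) ^ n1 * (t + \<i>) ^ n2 *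
    coeff_sum2 n1 n2 a ((t + s - \<i>) / (t + s + \<i>)) ((t - \<i>) / (t + \<i>))"
proof -
  have 1: "x ^ i * y ^ (n - i) = y ^ n * (x / y) ^ i" if "y \<noteq> 0" "i \<le> n" for x y :: complex and i n
    using that by (simp add: power_diff power_divide)
  show ?thesis
    unfolding poly_cayley_poly coeff_sum2_def sum_distrib_left
    using assms by (intro sum.cong refl) (simp add: 1 mult_ac)
qed

text \<open>Joint homogeneity of degree n1 + n2 in (t, s, \<tau>); taking \<tau> = 1 / M exposes the
  leading form as M grows.\<close>

lemma poly_cayley_poly_scale:
  "poly (cayley_poly n1 n2 a \<tau> s) t * M ^ (n1 + n2) = poly (cayley_poly n1 n2 a (\<tau> * M) (s * M)) (t * M)"
proof -
  have 1: "x ^ i * y ^ (n - i) * M ^ n = (x * M) ^ i * (y * M) ^ (n - i)" if "i \<le> n" for x y :: complex and i n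
    using that by (simp add: power_mult_distrib power_add[symmetric] mult_ac)
  show ?thesis
    unfolding poly_cayley_poly sum_distrib_right
  proof (intro sum.cong refl)
    fix j i assume ij: "j \<in> {..n2}" "i \<in> {..n1}"
    let ?x = "t + s - \<i> * \<tau>" and ?x' = "t + s + \<i> * \<tau>" and ?y = "t - \<i> * \<tau>" and ?y' = "t + \<i> * \<tau>"
    have "a i j * (?x ^ i * ?x' ^ (n1 - i) * (?y ^ j * ?y' ^ (n2 - j))) * M ^ (n1 + n2)
      = a i j * ((?x ^ i * ?x' ^ (n1 - i) * M ^ n1) * (?y ^ j * ?y' ^ (n2 - j) * M ^ n2))"
      by (simp add: power_add mult_ac)
    also have "\<dots> = a i j * (((?x * M) ^ i * (?x' * M) ^ (n1 - i)) * ((?y * M) ^ j * (?y' * M) ^ (n2 - j)))"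
      using ij by (simp add: 1)
    also have "\<dots> = a i j * (((t * M + s * M - \<i> * (\<tau> * M)) ^ i * (t * M + s * M + \<i> * (\<tau> * M)) ^ (n1 - i)) *
        ((t * M - \<i> * (\<tau> * M)) ^ j * (t * M + \<i> * (\<tau> * M)) ^ (n2 - j)))"
    proof -
      have "?x * M = t * M + s * M - \<i> * (\<tau> * M)" "?x' * M = t * M + s * M + \<i> * (\<tau> * M)"
        "?y * M = t * M - \<i> * (\<tau> * M)" "?y' * M = t * M + \<i> * (\<tau> * M)"
        by (simp_all add: algebra_simps)
      then show ?thesis by simp
    qed
    finally show "a i j * (?x ^ i * ?x' ^ (n1 - i) * (?y ^ j * ?y' ^ (n2 - j))) * M ^ (n1 + n2) =
       a i j * (((t * M + s * M - \<i> * (\<tau> * M)) ^ i * (t * M + s * M + \<i> * (\<tau> * M)) ^ (n1 - i)) *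
        ((t * M - \<i> * (\<tau> * M)) ^ j * (t * M + \<i> * (\<tau> * M)) ^ (n2 - j)))" .
  qed
qed

text \<open>At \<tau> = 0 numerators and denominators of the Cayley maps coincide, so every summand
  carries the same monomial: this is the leading form.\<close>

lemma poly_cayley_poly_0:
  "poly (cayley_poly n1 n2 a 0 s) t = coeff_sum2 n1 n2 a 1 1 * ((t + s) ^ n1 * t ^ n2)"
proof -
  have 1: "x ^ i * x ^ (n - i) = x ^ n" if "i \<le> n" for x :: complex and i n
    using that by (simp add: power_add[symmetric])
  have "poly (cayley_poly n1 n2 a 0 s) t = (\<Sum>j\<le>n2. \<Sum>i\<le>n1. a i j * ((t + s) ^ n1 * t ^ n2))"
    unfolding poly_cayley_poly by (intro sum.cong refl) (simp add: 1)
  then show ?thesis by (simp add: coeff_sum2_def sum_distrib_right)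
qed

lemma tendsto_cayley_poly:
  assumes "\<tau> \<longlonglongrightarrow> 0"
  shows "(\<lambda>m. poly (cayley_poly n1 n2 a (\<tau> m) s) t) \<longlonglongrightarrow> poly (cayley_poly n1 n2 a 0 s) t"
  unfolding poly_cayley_poly by (intro tendsto_intros assms)

lemma polyfam_cayley_poly: "polyfam (\<lambda>s. cayley_poly n1 n2 a \<tau> s)"
  unfolding cayley_poly_def
  by (intro polyfam_sum polyfam_smult polyfam_mult polyfam_power polyfam_linear polyfam_const
      polyfun_add polyfun_diff polyfun_id polyfun_const)

lemma monic_linear_power: "degree ([:c, 1:] ^ k :: complex poly) = k \<and> coeff ([:c, 1:] ^ k) k = 1"
proof -
  have d: "degree ([:c, 1:] ^ k :: complex poly) = k" by (simp add: degree_power_eq)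
  then show ?thesis using lead_coeff_power[of "[:c, 1:]" k] by simp
qed

lemma monic_mult:
  fixes p q :: "complex poly"
  assumes "degree p = m \<and> coeff p m = 1" "degree q = k \<and> coeff q k = 1"
  shows "degree (p * q) = m + k \<and> coeff (p * q) (m + k) = 1"
proof -
  have "p \<noteq> 0" "q \<noteq> 0" using assms by auto
  then show ?thesis using assms coeff_mult_degree_sum[of p q] by (simp add: degree_mult_eq)
qed

text \<open>Each product in the sum is monic in t of degree n1 + n2, so the top coefficient is the
  sum of all \<open>a i j\<close>, independent of \<open>s\<close>; it must not vanish, whence the
  rotation making p(1, 1) nonzero.\<close>

lemma cayley_poly_degree:
  "degree (cayley_poly n1 n2 a \<tau> s) \<le> n1 + n2"
  "coeff (cayley_poly n1 n2 a \<tau> s) (n1 + n2) = coeff_sum2 n1 n2 a 1 1"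
proof -
  let ?q = "\<lambda>i j. ([:s - \<i> * \<tau>, 1:] ^ i * [:s + \<i> * \<tau>, 1:] ^ (n1 - i)) * ([:- \<i> * \<tau>, 1:] ^ j * [:\<i> * \<tau>, 1:] ^ (n2 - j))"
  have q: "degree (?q i j) = n1 + n2 \<and> coeff (?q i j) (n1 + n2) = 1" if "i \<le> n1" "j \<le> n2" for i j
  proof -
    have "n1 + n2 = (i + (n1 - i)) + (j + (n2 - j))" using that by simp
    then show ?thesis using monic_mult[OF monic_mult[OF monic_linear_power monic_linear_power]
        monic_mult[OF monic_linear_power monic_linear_power]] by metis
  qed
  show "degree (cayley_poly n1 n2 a \<tau> s) \<le> n1 + n2" unfolding cayley_poly_def
    using q by (intro degree_sum_le) (auto intro!: degree_sum_le order_trans[OF degree_smult_le])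
  show "coeff (cayley_poly n1 n2 a \<tau> s) (n1 + n2) = coeff_sum2 n1 n2 a 1 1"
    unfolding cayley_poly_def coeff_sum coeff_smult coeff_sum2_def using q by (intro sum.cong) auto
qed

lemma cayley_upper_half_plane:
  assumes "Im x > 0" shows "x + \<i> \<noteq> 0" "norm ((x - \<i>) / (x + \<i>)) < 1"
proof -
  show nz: "x + \<i> \<noteq> 0" using assms by (auto simp: complex_eq_iff)
  have "(norm (x - \<i>))^2 < (norm (x + \<i>))^2" using assms
    unfolding cmod_power2 by (simp add: power2_eq_square algebra_simps)
  then have "norm (x - \<i>) < norm (x + \<i>)" by (rule power_less_imp_less_base) simp
  then show "norm ((x - \<i>) / (x + \<i>)) < 1" using nz by (simp add: norm_divide)
qed

text \<open>The situation after the rotation of the variables: \<open>at_one\<close> is what the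
  rotation achieves, and \<alpha> has absorbed the powers of the rotation factors.\<close>

locale stable_self_reversive =
  fixes n1 n2 :: nat and a :: "nat \<Rightarrow> nat \<Rightarrow> complex" and \<alpha> :: complex
  assumes stable: "\<And>x y. norm x < 1 \<Longrightarrow> norm y < 1 \<Longrightarrow> coeff_sum2 n1 n2 a x y \<noteq> 0"
    and reversive: "\<And>x y. x \<noteq> 0 \<Longrightarrow> y \<noteq> 0 \<Longrightarrow>
      \<alpha> * coeff_sum2 n1 n2 a x y = x ^ n1 * y ^ n2 * cnj (coeff_sum2 n1 n2 a (1 / cnj x) (1 / cnj y))"
    and alpha: "\<alpha> \<noteq> 0"
    and at_one: "coeff_sum2 n1 n2 a 1 1 \<noteq> 0"
    and at_zero: "coeff_sum2 n1 n2 a 0 0 = 1"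
begin

abbreviation "c \<equiv> coeff_sum2 n1 n2 a 1 1"
abbreviation "G \<equiv> cayley_poly n1 n2 a 1"

text \<open>A real shift keeps t + x in the upper half plane, so both Cayley images lie in the open
  disk, where stability applies.\<close>

lemma upper_zero_free: "Im t > 0 \<Longrightarrow> poly (G (of_real x)) t \<noteq> 0"
proof -
  assume t: "Im t > 0"
  then have "Im (t + of_real x) > 0" by simp
  note 1 = cayley_upper_half_plane[OF t] cayley_upper_half_plane[OF this]
  show ?thesis using 1 stable[OF 1(4,2)] by (subst poly_cayley_poly_eq) auto
qed

text \<open>Under the Cayley map, reflection in the circle, z to 1 / cnj z, becomes complex
  conjugation; self-reversiveness therefore becomes symmetry of the coefficients.\<close>

lemma cayley_symmetry: "smult \<alpha> (G (of_real x)) = map_poly cnj (G (of_real x))"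
proof -
  define X where "X = complex_of_real x"
  have "poly (smult \<alpha> (G X)) = poly (map_poly cnj (G X))"
  proof (rule polyfun_eqI)
    \<comment> \<open>The excluded points are those where a Cayley image is 0 or infinite.\<close>
    show "infinite (- {\<i>, - \<i>, \<i> - X, - \<i> - X})" by (rule infinite_Compl_finite) auto
    fix t assume "t \<in> - {\<i>, - \<i>, \<i> - X, - \<i> - X}"
    then have nz: "t + X + \<i> \<noteq> 0" "t + X - \<i> \<noteq> 0" "t + \<i> \<noteq> 0" "t - \<i> \<noteq> 0"
      by (auto simp: algebra_simps eq_neg_iff_add_eq_0)
    have cX: "cnj X = X" by (simp add: X_def)
    have cnz: "cnj t + X + \<i> \<noteq> 0" "cnj t + \<i> \<noteq> 0"
      using nz(2,4) by (metis cX complex_cnj_add complex_cnj_cnj complex_cnj_diff complex_cnj_i complex_cnj_zero diff_minus_eq_add minus_diff_eq uminus_add_conv_diff add.commute)+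
    define u where "u = (t + X - \<i>) / (t + X + \<i>)"
    define v where "v = (t - \<i>) / (t + \<i>)"
    have uv: "u \<noteq> 0" "v \<noteq> 0" using nz by (auto simp: u_def v_def)
    have cuv: "1 / cnj u = (cnj t + X - \<i>) / (cnj t + X + \<i>)" "1 / cnj v = (cnj t - \<i>) / (cnj t + \<i>)"
      by (simp_all add: u_def v_def cX)
    have un: "(t + X + \<i>) ^ n1 * u ^ n1 = (t + X - \<i>) ^ n1" "(t + \<i>) ^ n2 * v ^ n2 = (t - \<i>) ^ n2"
      using nz by (simp_all add: u_def v_def power_divide)
    have "poly (smult \<alpha> (G X)) t = (t + X + \<i>) ^ n1 * (t + \<i>) ^ n2 * (\<alpha> * coeff_sum2 n1 n2 a u v)"
      using nz by (simp add: poly_cayley_poly_eq u_def v_def)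
    also have "\<dots> = ((t + X + \<i>) ^ n1 * u ^ n1) * ((t + \<i>) ^ n2 * v ^ n2) *
        cnj (coeff_sum2 n1 n2 a (1 / cnj u) (1 / cnj v))"
      unfolding reversive[OF uv] by (simp add: mult_ac)
    also have "\<dots> = cnj (poly (G X) (cnj t))"
      unfolding un cuv using cnz by (simp add: poly_cayley_poly_eq cX)
    finally show "poly (smult \<alpha> (G X)) t = poly (map_poly cnj (G X)) t"
      by (simp add: poly_cnj_conv)
  qed auto
  then show ?thesis unfolding X_def using poly_eq_poly_eq_iff by blast
qed

lemma cayley_real_rooted: "real_rooted (G (of_real x))"
  unfolding real_rooted_def
proof (intro allI impI)
  fix t assume t: "poly (G (of_real x)) t = 0"
  have "poly (smult \<alpha> (G (of_real x))) t = cnj (poly (G (of_real x)) (cnj t))"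
    unfolding cayley_symmetry by (rule poly_cnj_conv)
  then have "poly (G (of_real x)) (cnj t) = 0" using t by simp
  then have "\<not> Im t > 0" "\<not> Im (cnj t) > 0" using upper_zero_free t by blast+
  then show "t \<in> \<real>" by (simp add: complex_is_Real_iff)
qed

text \<open>For large real arguments both Cayley images are close to 1, and near (1, 1) the
  polynomial does not vanish by continuity.\<close>

lemma cayley_root_bound: "\<exists>R. \<forall>(x::real) t. poly (G (of_real x)) t = 0 \<longrightarrow> norm t \<le> R * (1 + \<bar>x\<bar>)"
proof -
  obtain d where d: "d > 0" "\<And>u v. norm (u - 1) < d \<Longrightarrow> norm (v - 1) < d \<Longrightarrow> coeff_sum2 n1 n2 a u v \<noteq> 0"
    using coeff_sum2_nonzero_nearby[OF at_one] by blast
  \<comment> \<open>For real z the distance of the Cayley image from 1 is 2 / |z + i|, at most 2 /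
    |z|. The summand 1 gives R at least 1, so that |t| > R (1 + |x|) forces |t + x| > R too.\<close>
  define R where "R = 2 / d + 1"
  have R: "R > 0" using d by (simp add: R_def add_pos_pos)
  have near: "z + \<i> \<noteq> 0 \<and> norm ((z - \<i>) / (z + \<i>) - 1) < d" if "z \<in> \<real>" "norm z > R" for z
  proof -
    have "norm z \<le> norm (z + \<i>)"
      using that(1) abs_Re_le_cmod[of "z + \<i>"] by (simp add: complex_is_Real_iff cmod_eq_Re)
    then have big: "norm (z + \<i>) > 2 / d" using that by (simp add: R_def)
    then have nz: "z + \<i> \<noteq> 0" using d by auto
    have "(z - \<i>) / (z + \<i>) - 1 = - (2 * \<i>) / (z + \<i>)" using nz by (simp add: field_simps)
    then have "norm ((z - \<i>) / (z + \<i>) - 1) = 2 / norm (z + \<i>)" by (simp add: norm_divide norm_mult)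
    also have "\<dots> < d" using big nz d by (simp add: field_simps)
    finally show ?thesis using nz by blast
  qed
  have "norm t \<le> R * (1 + \<bar>x\<bar>)" if t: "poly (G (of_real x)) t = 0" for x t
  proof (rule ccontr)
    assume "\<not> norm t \<le> R * (1 + \<bar>x\<bar>)"
    then have big: "norm t > R + R * \<bar>x\<bar>" by (simp add: distrib_left)
    have R1: "R \<ge> 1" using d by (simp add: R_def)
    have "\<bar>x\<bar> \<le> R * \<bar>x\<bar>" using R1 mult_right_mono[of 1 R "\<bar>x\<bar>"] by simp
    have tr: "t \<in> \<real>" using cayley_real_rooted t unfolding real_rooted_def by blast
    have "norm t \<le> norm (t + of_real x) + \<bar>x\<bar>" using norm_triangle_ineq4[of "t + of_real x" "of_real x"] by simp
    then have 1: "norm (t + of_real x) > R" using big \<open>\<bar>x\<bar> \<le> R * \<bar>x\<bar>\<close> by linarith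
    have "R * \<bar>x\<bar> \<ge> 0" using R1 by simp
    then have 2: "norm t > R" using big by linarith
    have "t + of_real x \<in> \<real>" using tr by simp
    note n1 = near[OF this 1] and n2 = near[OF tr 2]
    show False using t d(2) n1 n2 poly_cayley_poly_eq[of t "of_real x"] by auto
  qed
  then show ?thesis by blast
qed

lemma cayley_pencil:
  "\<exists>A B. A \<in> carrier_mat (n1 + n2) (n1 + n2) \<and> B \<in> carrier_mat (n1 + n2) (n1 + n2) \<and>
    mat_adjoint A = A \<and> mat_adjoint B = B \<and>
    (\<forall>(x::real) t. poly (G (of_real x)) t = c * det (t \<cdot>\<^sub>m 1\<^sub>m (n1 + n2) - (of_real x \<cdot>\<^sub>m A + B)))"
proof -
  define g where "g = (\<lambda>s. smult (1 / c) (G s))"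
  have pg: "poly (G s) t = c * poly (g s) t" for s t using at_one by (simp add: g_def)
  have 2: "coeff (g s) (n1 + n2) = 1" for s using at_one by (simp add: g_def cayley_poly_degree(2))
  have 1: "degree (g s) = n1 + n2" for s
  proof (rule antisym)
    show "degree (g s) \<le> n1 + n2" unfolding g_def
      using cayley_poly_degree(1) degree_smult_le order_trans by blast
    show "n1 + n2 \<le> degree (g s)" using 2[of s] by (intro le_degree) simp
  qed
  obtain R where R: "\<And>(x::real) t. poly (G (of_real x)) t = 0 \<Longrightarrow> norm t \<le> R * (1 + \<bar>x\<bar>)"
    using cayley_root_bound by blast
  have "polyfam g" unfolding g_def by (intro polyfam_smult polyfam_cayley_poly)
  then have 3: "polyfun (\<lambda>s. coeff (g s) j)" for j by (simp add: polyfam_def)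
  have 4: "real_rooted (g (of_real x))" for x
    using cayley_real_rooted[of x] pg at_one by (simp add: real_rooted_def)
  have 5: "norm t \<le> R * (1 + \<bar>x\<bar>)" if "poly (g (of_real x)) t = 0" for x t
    using R[of x t] pg that by simp
  obtain A B where AB: "A \<in> carrier_mat (n1 + n2) (n1 + n2)" "B \<in> carrier_mat (n1 + n2) (n1 + n2)"
    "mat_adjoint A = A" "mat_adjoint B = B"
    and gAB: "\<forall>(x::real) t. poly (g (of_real x)) t = det (t \<cdot>\<^sub>m 1\<^sub>m (n1 + n2) - (of_real x \<cdot>\<^sub>m A + B))"
  proof -
    have "\<exists>A B. A \<in> carrier_mat (n1 + n2) (n1 + n2) \<and> B \<in> carrier_mat (n1 + n2) (n1 + n2) \<and>
      mat_adjoint A = A \<and> mat_adjoint B = B \<and>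
      (\<forall>(x::real) t. poly (g (of_real x)) t = det (t \<cdot>\<^sub>m 1\<^sub>m (n1 + n2) - (of_real x \<cdot>\<^sub>m A + B)))"
      by (rule pencil_of_hyperbolic[OF 3 1 2 4 5])
    then show thesis using that by (elim exE conjE)
  qed
  show ?thesis
    by (intro exI[of _ A] exI[of _ B] conjI allI AB) (simp only: pg gAB)
qed

text \<open>Comparison of leading forms: both sides are taken at s = -M and t M, divided by M^(n1 +
  n2), and M tends to infinity. B drops out, and s negative gives the sign in front of A.\<close>

lemma cayley_pencil_top:
  assumes "A \<in> carrier_mat (n1 + n2) (n1 + n2)" "B \<in> carrier_mat (n1 + n2) (n1 + n2)"
    and pencil: "\<And>(x::real) t. poly (G (of_real x)) t = c * det (t \<cdot>\<^sub>m 1\<^sub>m (n1 + n2) - (of_real x \<cdot>\<^sub>m A + B))"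
  shows "det (t \<cdot>\<^sub>m 1\<^sub>m (n1 + n2) + A) = (t - 1) ^ n1 * t ^ n2"
proof -
  define n where "n = n1 + n2"
  \<comment> \<open>The reciprocal of M = m + 1; M is real because the pencil is known at real
    parameters only.\<close>
  define \<tau> where "\<tau> = (\<lambda>m. complex_of_real (inverse (real (Suc m))))"
  have tau: "\<tau> \<longlonglongrightarrow> 0" unfolding \<tau>_def using tendsto_of_real[OF LIMSEQ_inverse_real_of_nat, where 'a = complex]
    by (simp only: of_real_0)
  have eq: "poly (cayley_poly n1 n2 a (\<tau> m) (-1)) t = c * det (t \<cdot>\<^sub>m 1\<^sub>m n - (- 1 \<cdot>\<^sub>m A + \<tau> m \<cdot>\<^sub>m B))" for m
  proof -
    define M where "M = complex_of_real (real (Suc m))"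
    have M: "M \<noteq> 0" "\<tau> m * M = 1"
    proof -
      show "M \<noteq> 0" unfolding M_def of_real_of_nat_eq by (rule of_nat_neq_0)
      have "inverse (real (Suc m)) * real (Suc m) = 1" by simp
      then show "\<tau> m * M = 1" unfolding M_def \<tau>_def by (metis of_real_mult of_real_1)
    qed
    have "poly (cayley_poly n1 n2 a (\<tau> m) (-1)) t * M ^ n = poly (G (of_real (- real (Suc m)))) (t * M)"
      using poly_cayley_poly_scale[of n1 n2 a "\<tau> m" "-1" t M] M(2) unfolding n_def by (simp add: M_def)
    also have "\<dots> = c * det ((t * M) \<cdot>\<^sub>m 1\<^sub>m n - (of_real (- real (Suc m)) \<cdot>\<^sub>m A + B))"
      unfolding pencil n_def ..
    also have "(t * M) \<cdot>\<^sub>m 1\<^sub>m n - (of_real (- real (Suc m)) \<cdot>\<^sub>m A + B) = M \<cdot>\<^sub>m (t \<cdot>\<^sub>m 1\<^sub>m n - (- 1 \<cdot>\<^sub>m A + \<tau> m \<cdot>\<^sub>m B))"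
    proof (intro eq_matI)
      have e: "t * M * d - (- M * x + b) = M * (t * d - (- 1 * x + \<tau> m * b))" for d x b
      proof -
        have "M * (t * d - (- 1 * x + \<tau> m * b)) = M * t * d + M * x - (\<tau> m * M) * b" by (simp add: algebra_simps)
        then show ?thesis unfolding M(2) by (simp add: algebra_simps)
      qed
      have eM: "of_real (- real (Suc m)) = - M" by (simp add: M_def)
      fix i j assume "i < dim_row (M \<cdot>\<^sub>m (t \<cdot>\<^sub>m 1\<^sub>m n - (- 1 \<cdot>\<^sub>m A + \<tau> m \<cdot>\<^sub>m B)))"
        "j < dim_col (M \<cdot>\<^sub>m (t \<cdot>\<^sub>m 1\<^sub>m n - (- 1 \<cdot>\<^sub>m A + \<tau> m \<cdot>\<^sub>m B)))"
      then show "((t * M) \<cdot>\<^sub>m 1\<^sub>m n - (of_real (- real (Suc m)) \<cdot>\<^sub>m A + B)) $$ (i, j) =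
          (M \<cdot>\<^sub>m (t \<cdot>\<^sub>m 1\<^sub>m n - (- 1 \<cdot>\<^sub>m A + \<tau> m \<cdot>\<^sub>m B))) $$ (i, j)"
        using assms(1,2) e[of "1\<^sub>m n $$ (i, j)" "A $$ (i, j)" "B $$ (i, j)"] unfolding eM by (simp add: n_def)
    qed (use assms(1,2) in \<open>auto simp: n_def\<close>)
    also have "det \<dots> = M ^ n * det (t \<cdot>\<^sub>m 1\<^sub>m n - (- 1 \<cdot>\<^sub>m A + \<tau> m \<cdot>\<^sub>m B))"
      using assms(1,2) by (simp add: n_def)
    finally show ?thesis using M(1) by simp
  qed
  have "(\<lambda>m. det (t \<cdot>\<^sub>m 1\<^sub>m n - (- 1 \<cdot>\<^sub>m A + \<tau> m \<cdot>\<^sub>m B))) \<longlonglongrightarrow> det (t \<cdot>\<^sub>m 1\<^sub>m n + A)"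
  proof (rule tendsto_det)
    fix i j assume ij: "i < n" "j < n"
    have "(\<lambda>m. t * 1\<^sub>m n $$ (i, j) - (- 1 * A $$ (i, j) + \<tau> m * B $$ (i, j))) \<longlonglongrightarrow>
       t * 1\<^sub>m n $$ (i, j) - (- 1 * A $$ (i, j) + 0 * B $$ (i, j))"
      by (intro tendsto_intros tau)
    then show "(\<lambda>m. (t \<cdot>\<^sub>m 1\<^sub>m n - (- 1 \<cdot>\<^sub>m A + \<tau> m \<cdot>\<^sub>m B)) $$ (i, j)) \<longlonglongrightarrow> (t \<cdot>\<^sub>m 1\<^sub>m n + A) $$ (i, j)"
      using ij assms(1,2) by (simp add: n_def)
  next
    fix m show "t \<cdot>\<^sub>m 1\<^sub>m n - (- 1 \<cdot>\<^sub>m A + \<tau> m \<cdot>\<^sub>m B) \<in> carrier_mat n n"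
      using assms(2) by (intro minus_carrier_mat add_carrier_mat) (simp add: n_def)
  qed (use assms in \<open>auto simp: n_def\<close>)
  then have "(\<lambda>m. poly (cayley_poly n1 n2 a (\<tau> m) (-1)) t) \<longlonglongrightarrow> c * det (t \<cdot>\<^sub>m 1\<^sub>m n + A)"
    unfolding eq by (intro tendsto_intros)
  moreover have "(\<lambda>m. poly (cayley_poly n1 n2 a (\<tau> m) (-1)) t) \<longlonglongrightarrow> c * ((t + -1) ^ n1 * t ^ n2)"
    using tendsto_cayley_poly[OF tau] unfolding poly_cayley_poly_0 .
  ultimately have "c * det (t \<cdot>\<^sub>m 1\<^sub>m n + A) = c * ((t + -1) ^ n1 * t ^ n2)"
    using LIMSEQ_unique by blast
  then show ?thesis using at_one by (simp add: n_def)
qed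

end


section \<open>From the Hermitian matrix to the unitary one\<close>

lemma dim_block_diag [simp]:
  "dim_row (block_diag n1 n2 x y) = n1 + n2" "dim_col (block_diag n1 n2 x y) = n1 + n2"
  by (simp_all add: block_diag_def)

lemma det_block_diag_mat: "det (block_diag n1 n2 x y) = x ^ n1 * y ^ n2"
proof -
  have "det (block_diag n1 n2 x y) = (\<Prod>l<n1 + n2. if l < n1 then x else y)"
    by (subst det_upper_triangular[of _ "n1 + n2"])
       (auto simp: prod_list_diag_prod lessThan_atLeast0 intro!: upper_triangularI prod.cong)
  then show ?thesis by (simp add: prod_block)
qed

lemma block_diag_mult:
  "block_diag n1 n2 x y * block_diag n1 n2 u v = block_diag n1 n2 (x * u) (y * v)"
  unfolding block_diag_def mat_diag_diag by (auto simp: mat_diag_def intro!: eq_matI)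

lemma mat_adjoint_block_diag: "mat_adjoint (block_diag n1 n2 x y) = block_diag n1 n2 (cnj x) (cnj y)"
  by (intro eq_matI) (auto simp: mat_adjoint_index[OF block_diag_carrier])

lemma block_diag_one: "block_diag n1 n2 1 1 = 1\<^sub>m (n1 + n2)"
  by (intro eq_matI) auto

lemma Z_mat_eq_block_diag: "Z_mat n1 n2 x y = block_diag n1 n2 x y"
  unfolding Z_mat_def by (intro eq_matI) (auto simp: Let_def)

lemma mult_block_diag_index:
  assumes "A \<in> carrier_mat (n1 + n2) (n1 + n2)" "i < n1 + n2" "j < n1 + n2"
  shows "(A * block_diag n1 n2 x y) $$ (i, j) = A $$ (i, j) * (if j < n1 then x else y)"
  unfolding block_diag_def using assms by (subst mat_diag_mult_right[OF assms(1)]) auto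

lemma polyfun_det_block:
  assumes "K \<in> carrier_mat (n1 + n2) (n1 + n2)" "polyfun f" "polyfun g"
  shows "polyfun (\<lambda>z. det (1\<^sub>m (n1 + n2) - K * block_diag n1 n2 (f z) (g z)))"
proof (rule polyfun_det)
  have "polyfun (\<lambda>s. (1\<^sub>m (n1 + n2) - K * block_diag n1 n2 (f s) (g s)) $$ (i, j))"
    if ij: "i < n1 + n2" "j < n1 + n2" for i j
  proof -
    have "(\<lambda>s. (1\<^sub>m (n1 + n2) - K * block_diag n1 n2 (f s) (g s)) $$ (i, j)) =
      (\<lambda>s. 1\<^sub>m (n1 + n2) $$ (i, j) - K $$ (i, j) * (if j < n1 then f s else g s))"
      using ij assms(1) mult_block_diag_index[OF assms(1) ij] by (auto simp del: index_mult_mat(1))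
    moreover have "polyfun (\<lambda>s. 1\<^sub>m (n1 + n2) $$ (i, j) - K $$ (i, j) * (if j < n1 then f s else g s))"
      using assms by (cases "j < n1") (auto intro!: polyfun_diff polyfun_mult)
    ultimately show ?thesis by simp
  qed
  moreover have "1\<^sub>m (n1 + n2) - K * block_diag n1 n2 (f s) (g s) \<in> carrier_mat (n1 + n2) (n1 + n2)" for s
    using assms(1) by (intro minus_carrier_mat square_mult_carrier) auto
  ultimately show "polymat (n1 + n2) (\<lambda>z. 1\<^sub>m (n1 + n2) - K * block_diag n1 n2 (f z) (g z))"
    by (simp add: polymat_def)
qed

lemma polyfun_coeff_sum2:
  "polyfun f \<Longrightarrow> polyfun g \<Longrightarrow> polyfun (\<lambda>z. coeff_sum2 n1 n2 a (f z) (g z))"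
  unfolding coeff_sum2_def by (intro polyfun_sum polyfun_mult polyfun_const polyfun_power) auto

text \<open>For Hermitian C the matrices S = C + i and T = C - i are adjoint to each other and
  commute. With X = S^{-1}, (X T)^* (X T) = X^* S X T = X^* S^* = (S X)^* = 1.\<close>

lemma cayley_transform_unitary:
  assumes C: "C \<in> carrier_mat n n" "mat_adjoint C = C"
    and X: "X \<in> carrier_mat n n" "(C + \<i> \<cdot>\<^sub>m 1\<^sub>m n) * X = 1\<^sub>m n" "X * (C + \<i> \<cdot>\<^sub>m 1\<^sub>m n) = 1\<^sub>m n"
  shows "unitary_mat n (X * (C - \<i> \<cdot>\<^sub>m 1\<^sub>m n))"
proof (rule unitary_matI)
  define S where "S = C + \<i> \<cdot>\<^sub>m 1\<^sub>m n"
  define T where "T = C - \<i> \<cdot>\<^sub>m 1\<^sub>m n"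
  have c: "S \<in> carrier_mat n n" "T \<in> carrier_mat n n" using C by (auto simp: S_def T_def)
  have X: "X \<in> carrier_mat n n" "S * X = 1\<^sub>m n" "X * S = 1\<^sub>m n" using X by (auto simp: S_def)
  have Xa: "mat_adjoint X \<in> carrier_mat n n" using X by simp
  have Ch: "cnj (C $$ (j, i)) = C $$ (i, j)" if "i < n" "j < n" for i j
    using mat_adjoint_index[OF C(1) that] C(2) by simp
  have TS: "mat_adjoint T = S"
    unfolding mat_adjoint_eq[OF c(2)] using C Ch by (auto simp: S_def T_def intro!: eq_matI)
  then have ST: "mat_adjoint S = T" using c by (metis mat_adjoint_adjoint)
  have comm: "S * T = T * S"
  proof -
    have "S = T + (2 * \<i>) \<cdot>\<^sub>m 1\<^sub>m n" using C by (intro eq_matI) (auto simp: S_def T_def)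
    then show ?thesis using c(2)
      by (simp add: add_mult_distrib_mat[of _ n n _ _ n] mult_add_distrib_mat[of _ n n _ n]
          mult_smult_distrib[of _ n n _ n] mult_smult_assoc_mat[of _ n n _ n])
  qed
  have XT: "X * T = T * X"
  proof -
    have "X * T = X * (T * (S * X))" using X(2) c by simp
    also have "\<dots> = X * (T * S) * X" using X(1) c by (simp add: square_mult_assoc[of _ n] del: index_mult_mat)
    also have "\<dots> = (X * S) * (T * X)" unfolding comm[symmetric]
      using X(1) c by (simp add: square_mult_assoc[of _ n] del: index_mult_mat)
    finally show ?thesis using X c by simp
  qed
  show "X * (C - \<i> \<cdot>\<^sub>m 1\<^sub>m n) \<in> carrier_mat n n" unfolding T_def[symmetric] using X c by simp
  have "mat_adjoint (X * T) * (X * T) = (mat_adjoint X * S) * (X * T)"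
    unfolding XT using mat_adjoint_mult[OF c(2) X(1)] TS by simp
  also have "\<dots> = mat_adjoint X * (S * X) * T"
    using X(1) Xa c by (simp add: square_mult_assoc[of _ n] del: index_mult_mat)
  also have "\<dots> = mat_adjoint X * mat_adjoint S" unfolding X(2) ST using right_mult_one_mat[OF Xa] by simp
  also have "\<dots> = mat_adjoint (S * X)" by (rule mat_adjoint_mult[OF c(1) X(1), symmetric])
  finally show "mat_adjoint (X * (C - \<i> \<cdot>\<^sub>m 1\<^sub>m n)) * (X * (C - \<i> \<cdot>\<^sub>m 1\<^sub>m n)) = 1\<^sub>m n"
    unfolding X(2) T_def[symmetric] by simp
qed

context stable_self_reversive
begin

text \<open>The pencil is known for real \<open>s\<close> only, but both sides are polynomial in
  \<open>s\<close>. Complex \<open>s\<close> makes t + s and t independent complex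
  variables.\<close>

lemma cayley_determinantal_form:
  "\<exists>C. C \<in> carrier_mat (n1 + n2) (n1 + n2) \<and> mat_adjoint C = C \<and>
    (\<forall>s t. poly (G s) t = c * det (block_diag n1 n2 (t + s) t + C))"
proof -
  obtain A B where AB: "A \<in> carrier_mat (n1 + n2) (n1 + n2)" "B \<in> carrier_mat (n1 + n2) (n1 + n2)"
    "mat_adjoint A = A" "mat_adjoint B = B"
    and pencil: "\<forall>(x::real) t. poly (G (of_real x)) t = c * det (t \<cdot>\<^sub>m 1\<^sub>m (n1 + n2) - (of_real x \<cdot>\<^sub>m A + B))"
    using cayley_pencil by (elim exE conjE)
  obtain C where C: "C \<in> carrier_mat (n1 + n2) (n1 + n2)" "mat_adjoint C = C"
    and AC: "\<forall>t x. det (t \<cdot>\<^sub>m 1\<^sub>m (n1 + n2) - (x \<cdot>\<^sub>m A + B)) = det (block_diag n1 n2 (t + x) t + C)"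
    using pencil_block_form[OF AB cayley_pencil_top[OF AB(1,2) pencil[rule_format]]] by (elim exE conjE)
  have "(\<lambda>s. poly (G s) t) = (\<lambda>s. c * det (block_diag n1 n2 (t + s) t + C))" for t
  proof (rule polyfun_eqI_real)
    show "polyfun (\<lambda>s. poly (G s) t)" unfolding poly_cayley_poly
      by (intro polyfun_sum polyfun_mult polyfun_const polyfun_power polyfun_add polyfun_diff polyfun_id)
    have "polyfun (\<lambda>s. (block_diag n1 n2 (t + s) t + C) $$ (i, j))" if "i < n1 + n2" "j < n1 + n2" for i j
      using that C(1) by (cases "i = j"; cases "i < n1") (auto intro!: polyfun_add)
    then have "polymat (n1 + n2) (\<lambda>s. block_diag n1 n2 (t + s) t + C)"
      using C(1) by (auto simp: polymat_def)
    then show "polyfun (\<lambda>s. c * det (block_diag n1 n2 (t + s) t + C))"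
      by (intro polyfun_mult polyfun_const polyfun_det)
    show "poly (G (of_real x)) t = c * det (block_diag n1 n2 (t + of_real x) t + C)" for x
      unfolding pencil[rule_format] AC[rule_format] ..
  qed
  then show ?thesis using C by (intro exI[of _ C]) (auto dest: fun_cong)
qed

text \<open>Undoing the Cayley map: clearing its denominators turns the determinant of x I (+) y I +
  C into that of S - T Z, and S is then factored out to leave K = S^{-1} T.\<close>

lemma unitary_representation:
  "\<exists>K. unitary_mat (n1 + n2) K \<and>
    (\<forall>x y. coeff_sum2 n1 n2 a x y = det (1\<^sub>m (n1 + n2) - K * block_diag n1 n2 x y))"
proof -
  define n where "n = n1 + n2"
  obtain C where C: "C \<in> carrier_mat n n" "mat_adjoint C = C"
    and GC: "\<And>s t. poly (G s) t = c * det (block_diag n1 n2 (t + s) t + C)"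
    using cayley_determinantal_form unfolding n_def by blast
  define S where "S = C + \<i> \<cdot>\<^sub>m 1\<^sub>m n"
  define T where "T = C - \<i> \<cdot>\<^sub>m 1\<^sub>m n"
  have ST: "S \<in> carrier_mat n n" "T \<in> carrier_mat n n" using C by (auto simp: S_def T_def)
  have key: "(2 * \<i>) ^ n * coeff_sum2 n1 n2 a x y = c * det (S - T * block_diag n1 n2 x y)"
    if xy: "x \<noteq> 1" "y \<noteq> 1" for x y
  proof -
    \<comment> \<open>The inverse Cayley map, with pole at 1; both coordinates therefore avoid 1 at
      first.\<close>
    define w where "w = (\<lambda>z::complex. \<i> * (1 + z) / (1 - z))"
    have w: "(w z + \<i>) * (1 - z) = 2 * \<i>" "w z * (1 - z) = \<i> * (1 + z)" "w z + \<i> \<noteq> 0" "(w z - \<i>) / (w z + \<i>) = z"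
      if "z \<noteq> 1" for z
    proof -
      have nz: "1 - z \<noteq> 0" using that by simp
      show 2: "w z * (1 - z) = \<i> * (1 + z)" using nz by (simp add: w_def)
      then show 1: "(w z + \<i>) * (1 - z) = 2 * \<i>" by (simp add: algebra_simps)
      then show 3: "w z + \<i> \<noteq> 0" by auto
      have "(w z - \<i>) * (1 - z) = \<i> * (1 + z) - \<i> * (1 - z)"
        by (simp only: left_diff_distrib 2)
      also have "\<dots> = z * (2 * \<i>)" by (simp add: algebra_simps)
      finally have "(w z - \<i>) * (1 - z) = z * (w z + \<i>) * (1 - z)"
        by (simp only: 1[symmetric] mult.assoc)
      then show "(w z - \<i>) / (w z + \<i>) = z" using nz 3 by (metis mult_right_cancel nonzero_eq_divide_eq)
    qed
    \<comment> \<open>Taken at t = w y and s = w x - w y, so that (t + s, t) = (w x, w y).\<close>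
    have "(w x + \<i>) ^ n1 * (w y + \<i>) ^ n2 * coeff_sum2 n1 n2 a x y = c * det (block_diag n1 n2 (w x) (w y) + C)"
      using poly_cayley_poly_eq[of "w y" "w x - w y" n1 n2 a] GC[of "w x - w y" "w y"] w xy by simp
    then have "((w x + \<i>) * (1 - x)) ^ n1 * ((w y + \<i>) * (1 - y)) ^ n2 * coeff_sum2 n1 n2 a x y
      = c * (det (block_diag n1 n2 (w x) (w y) + C) * ((1 - x) ^ n1 * (1 - y) ^ n2))"
      by (simp add: power_mult_distrib mult_ac)
    also have "det (block_diag n1 n2 (w x) (w y) + C) * ((1 - x) ^ n1 * (1 - y) ^ n2)
      = det ((block_diag n1 n2 (w x) (w y) + C) * block_diag n1 n2 (1 - x) (1 - y))"
      using C(1) unfolding det_block_diag_mat[symmetric]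
      by (intro det_mult[symmetric, of _ n]) (auto simp: n_def)
    also have "(block_diag n1 n2 (w x) (w y) + C) * block_diag n1 n2 (1 - x) (1 - y) = S - T * block_diag n1 n2 x y"
    proof (intro eq_matI)
      fix i j assume "i < dim_row (S - T * block_diag n1 n2 x y)" "j < dim_col (S - T * block_diag n1 n2 x y)"
      then have ij: "i < n1 + n2" "j < n1 + n2" using ST by (auto simp: n_def)
      have 1: "block_diag n1 n2 (w x) (w y) + C \<in> carrier_mat (n1 + n2) (n1 + n2)" "T \<in> carrier_mat (n1 + n2) (n1 + n2)"
        using C ST by (auto simp: n_def)
      show "((block_diag n1 n2 (w x) (w y) + C) * block_diag n1 n2 (1 - x) (1 - y)) $$ (i, j) =
         (S - T * block_diag n1 n2 x y) $$ (i, j)"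
      proof -
        define z where "z = (if j < n1 then x else y)"
        have z: "w z * (1 - z) = \<i> * (1 + z)" using w(2) xy by (simp add: z_def)
        \<comment> \<open>With d an entry of \<open>C\<close> on the diagonal this is the entry of S
          - T Z: the factor 1 - z clears the pole of w.\<close>
        have e: "(w z + d) * (1 - z) = (d + \<i>) - (d - \<i>) * z" for d
          unfolding distrib_right z by (simp add: algebra_simps)
        have "((block_diag n1 n2 (w x) (w y) + C) * block_diag n1 n2 (1 - x) (1 - y)) $$ (i, j)
          = ((if i = j then w z else 0) + C $$ (i, j)) * (1 - z)"
          unfolding mult_block_diag_index[OF 1(1) ij] using ij C(1) by (auto simp: z_def n_def)
        also have "\<dots> = (C $$ (i, j) + \<i> * (if i = j then 1 else 0)) - (C $$ (i, j) - \<i> * (if i = j then 1 else 0)) * z"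
          using e[of "C $$ (i, j)"] by (simp add: algebra_simps)
        also have "\<dots> = S $$ (i, j) - T $$ (i, j) * z"
          using ij C(1) by (simp add: S_def T_def n_def)
        also have "\<dots> = (S - T * block_diag n1 n2 x y) $$ (i, j)"
          using ij ST mult_block_diag_index[OF 1(2) ij, of x y] by (simp add: z_def n_def del: index_mult_mat(1))
        finally show ?thesis .
      qed
    qed (use C ST in \<open>auto simp: n_def\<close>)
    finally show ?thesis using w(1)[OF xy(1)] w(1)[OF xy(2)] by (simp add: n_def power_add mult_ac)
  qed
  have "T * block_diag n1 n2 0 0 = 0\<^sub>m n n"
    using ST by (intro eq_matI) (auto simp: n_def mult_block_diag_index simp del: index_mult_mat(1))
  moreover have "S - 0\<^sub>m n n = S" using ST by (intro eq_matI) auto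
  \<comment> \<open>The value 1 at the origin both shows that S is invertible and fixes the constant
    \<open>c\<close> in front of the determinant.\<close>
  ultimately have cS: "(2 * \<i>) ^ n = c * det S" using key[of 0 0] at_zero by simp
  then have "det S \<noteq> 0" by (metis mult_zero_right power_not_zero complex_i_not_zero no_zero_divisors zero_neq_numeral)
  then obtain X where X: "X \<in> carrier_mat n n" "S * X = 1\<^sub>m n" "X * S = 1\<^sub>m n"
    using mat_inverse_exists[OF ST(1)] by blast
  define K where "K = X * T"
  have K: "unitary_mat n K" unfolding K_def T_def
    using cayley_transform_unitary[OF C] X unfolding S_def by blast
  have Kc: "K \<in> carrier_mat (n1 + n2) (n1 + n2)" using K by (simp add: unitary_mat_def n_def)
  have rep: "coeff_sum2 n1 n2 a x y = det (1\<^sub>m n - K * block_diag n1 n2 x y)" if "x \<noteq> 1" "y \<noteq> 1" for x y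
  proof -
    let ?Z = "block_diag n1 n2 x y"
    have Z: "?Z \<in> carrier_mat n n" by (simp add: n_def)
    have KZ: "K * ?Z \<in> carrier_mat n n" using Kc Z by (simp add: n_def)
    have "S * (1\<^sub>m n - K * ?Z) = S * 1\<^sub>m n - S * (K * ?Z)"
      by (rule mult_minus_distrib_mat[OF ST(1) _ KZ]) simp
    also have "S * (K * ?Z) = (S * X) * T * ?Z"
      unfolding K_def using ST X(1) Z by (simp add: square_mult_assoc[of _ n] del: index_mult_mat)
    also have "\<dots> = T * ?Z" unfolding X(2) using ST by simp
    finally have "S - T * ?Z = S * (1\<^sub>m n - K * ?Z)" using ST by simp
    then have "det (S - T * ?Z) = det S * det (1\<^sub>m n - K * ?Z)"
      using det_mult[OF ST(1) minus_carrier_mat[OF KZ]] by simp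
    then have "(2 * \<i>) ^ n * coeff_sum2 n1 n2 a x y = (2 * \<i>) ^ n * det (1\<^sub>m n - K * ?Z)"
      using key[OF that] cS by simp
    then show ?thesis by simp
  qed
  have inf: "infinite (- {1 :: complex})" by (rule infinite_Compl_finite) auto
  \<comment> \<open>The excluded value 1 is filled in for one variable at a time.\<close>
  have 1: "(\<lambda>x. coeff_sum2 n1 n2 a x y) = (\<lambda>x. det (1\<^sub>m n - K * block_diag n1 n2 x y))" if "y \<noteq> 1" for y
    unfolding n_def
    by (rule polyfun_eqI[OF polyfun_coeff_sum2 polyfun_det_block[OF Kc] inf]) (use rep that in \<open>auto simp: n_def\<close>)
  have 2: "(\<lambda>y. coeff_sum2 n1 n2 a x y) = (\<lambda>y. det (1\<^sub>m n - K * block_diag n1 n2 x y))" for x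
    unfolding n_def
    by (rule polyfun_eqI[OF polyfun_coeff_sum2 polyfun_det_block[OF Kc] inf])
       (use 1 in \<open>auto simp: n_def dest: fun_cong\<close>)
  have "coeff_sum2 n1 n2 a x y = det (1\<^sub>m n - K * block_diag n1 n2 x y)" for x y
    using fun_cong[OF 2, of x y] .
  then show ?thesis using K unfolding n_def by blast
qed

end

section \<open>The two implications for bivariate polynomials\<close>

lemma eval2_coeff_sum2: "eval2 p x y = coeff_sum2 (deg1 p) (deg2 p) (\<lambda>i j. coeff (coeff p j) i) x y"
  by (simp add: eval2_as_sum coeff_sum2_def)

lemma infinite_unit_circle: "infinite {z :: complex. norm z = 1}"
proof
  assume "finite {z :: complex. norm z = 1}"
  then have "finite (Re ` {z. norm z = 1})" by simp
  moreover have "{0..1} \<subseteq> Re ` {z. norm z = 1}"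
  proof
    fix x :: real assume x: "x \<in> {0..1}"
    then have "norm (Complex x (sqrt (1 - x\<^sup>2))) = 1"
      by (simp add: cmod_def power_le_one)
    then show "x \<in> Re ` {z. norm z = 1}" by (intro image_eqI[of _ _ "Complex x (sqrt (1 - x\<^sup>2))"]) auto
  qed
  ultimately have "finite {0..1::real}" using finite_subset by blast
  then show False using infinite_Icc[of 0 "1::real"] by simp
qed

text \<open>The unit circle is infinite, so vanishing on the torus propagates to the whole plane,
  first in one variable and then in the other.\<close>

lemma nonzero_on_torus:
  assumes "coeff_sum2 n1 n2 a 0 0 \<noteq> 0"
  shows "\<exists>u v. norm u = 1 \<and> norm v = 1 \<and> coeff_sum2 n1 n2 a u v \<noteq> 0"
proof (rule ccontr)
  assume "\<not> ?thesis"
  then have 0: "\<And>u v. norm u = 1 \<Longrightarrow> norm v = 1 \<Longrightarrow> coeff_sum2 n1 n2 a u v = 0" by blast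
  have 1: "(\<lambda>v. coeff_sum2 n1 n2 a u v) = (\<lambda>_. 0)" if "norm u = 1" for u
    by (rule polyfun_eqI[OF polyfun_coeff_sum2 polyfun_const infinite_unit_circle]) (use 0 that in auto)
  have "(\<lambda>u. coeff_sum2 n1 n2 a u v) = (\<lambda>_. 0)" for v
    by (rule polyfun_eqI[OF polyfun_coeff_sum2 polyfun_const infinite_unit_circle]) (use 1 in \<open>auto dest: fun_cong\<close>)
  then show False using assms by (auto dest: fun_cong)
qed

lemma unitary_block_diag:
  assumes "norm x = 1" "norm y = 1" shows "unitary_mat (n1 + n2) (block_diag n1 n2 x y)"
proof (rule unitary_matI)
  have "cnj x * x = 1" "cnj y * y = 1"
    using assms by (simp_all add: mult.commute[of "cnj _"] complex_norm_square[symmetric])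
  then show "mat_adjoint (block_diag n1 n2 x y) * block_diag n1 n2 x y = 1\<^sub>m (n1 + n2)"
    by (simp add: mat_adjoint_block_diag block_diag_mult block_diag_one)
qed simp

text \<open>A rotation by a point (u, v) of the torus with p(u, v) nonzero brings \<open>p\<close>
  into the scope of the locale; a unitary diagonal factor on K undoes it.\<close>

lemma determinantal_of_self_reversive:
  assumes "semi_stable p" "eval2 p 0 0 = 1" "self_reversive p"
  shows "\<exists>K. unitary_mat (deg1 p + deg2 p) K \<and>
    (\<forall>x y. eval2 p x y = det (1\<^sub>m (deg1 p + deg2 p) - K * block_diag (deg1 p) (deg2 p) x y))"
proof -
  define n1 n2 where "n1 = deg1 p" and "n2 = deg2 p"
  define a where "a = (\<lambda>i j. coeff (coeff p j) i)"
  have ev: "eval2 p x y = coeff_sum2 n1 n2 a x y" for x y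
    by (simp add: eval2_coeff_sum2 n1_def n2_def a_def)
  obtain \<alpha> where \<alpha>: "norm \<alpha> = 1" "reverse p = smult [:\<alpha>:] p" using assms(3) by (auto simp: self_reversive_def)
  have rev: "\<alpha> * eval2 p x y = x ^ n1 * y ^ n2 * cnj (eval2 p (1 / cnj x) (1 / cnj y))"
    if "x \<noteq> 0" "y \<noteq> 0" for x y
    using is_reverse_reverse[of p] that unfolding is_reverse_def \<alpha>(2) eval2_smult n1_def n2_def by blast
  obtain u v where uv: "norm u = 1" "norm v = 1" "coeff_sum2 n1 n2 a u v \<noteq> 0"
    using nonzero_on_torus[of n1 n2 a] assms(2) ev by auto
  have uv0: "u \<noteq> 0" "v \<noteq> 0" using uv by auto
  have uu: "1 / cnj u = u" "1 / cnj v = v"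
    using uv by (auto simp: divide_conv_cnj)
  define a' where "a' = (\<lambda>i j. a i j * u ^ i * v ^ j)"
  have a': "coeff_sum2 n1 n2 a' x y = eval2 p (u * x) (v * y)" for x y
    unfolding ev coeff_sum2_def a'_def by (simp add: power_mult_distrib mult_ac)
  \<comment> \<open>Substituting (u x, v y) into the reversal identity produces the factor u^n1
    v^n2, which is moved into the constant.\<close>
  interpret stable_self_reversive n1 n2 a' "\<alpha> / (u ^ n1 * v ^ n2)"
  proof unfold_locales
    fix x y :: complex assume "norm x < 1" "norm y < 1"
    then have "norm (u * x) < 1" "norm (v * y) < 1" using uv by (auto simp: norm_mult)
    then show "coeff_sum2 n1 n2 a' x y \<noteq> 0" unfolding a' using assms(1) by (auto simp: semi_stable_def)
  next
    fix x y :: complex assume xy: "x \<noteq> 0" "y \<noteq> 0"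
    \<comment> \<open>Reflection in the circle commutes with rotations, because u and v are their
      own reflections.\<close>
    have c: "1 / cnj (u * x) = u * (1 / cnj x)" "1 / cnj (v * y) = v * (1 / cnj y)"
      using uu by (metis complex_cnj_mult times_divide_times_eq mult.right_neutral)+
    have "\<alpha> * eval2 p (u * x) (v * y) = (u * x) ^ n1 * (v * y) ^ n2 * cnj (eval2 p (1 / cnj (u * x)) (1 / cnj (v * y)))"
      using rev[of "u * x" "v * y"] uv0 xy by simp
    then show "\<alpha> / (u ^ n1 * v ^ n2) * coeff_sum2 n1 n2 a' x y =
        x ^ n1 * y ^ n2 * cnj (coeff_sum2 n1 n2 a' (1 / cnj x) (1 / cnj y))"
      unfolding a' c using uv0 by (simp add: power_mult_distrib field_simps)
  next
    show "\<alpha> / (u ^ n1 * v ^ n2) \<noteq> 0" using \<alpha>(1) uv0 by auto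
    show "coeff_sum2 n1 n2 a' 1 1 \<noteq> 0" using uv(3) by (simp add: a' ev)
    show "coeff_sum2 n1 n2 a' 0 0 = 1" using assms(2) by (simp add: a')
  qed
  obtain K where K: "unitary_mat (n1 + n2) K"
    "\<And>x y. coeff_sum2 n1 n2 a' x y = det (1\<^sub>m (n1 + n2) - K * block_diag n1 n2 x y)"
    using unitary_representation by blast
  have Kc: "K \<in> carrier_mat (n1 + n2) (n1 + n2)" using K(1) by (simp add: unitary_mat_def)
  define K' where "K' = K * block_diag n1 n2 (1 / u) (1 / v)"
  have "unitary_mat (n1 + n2) K'" unfolding K'_def
    using uv by (intro unitary_mat_mult K(1) unitary_block_diag) (auto simp: norm_divide)
  moreover have "eval2 p x y = det (1\<^sub>m (n1 + n2) - K' * block_diag n1 n2 x y)" for x y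
  proof -
    have "eval2 p x y = coeff_sum2 n1 n2 a' (1 / u * x) (1 / v * y)" unfolding a' using uv0 by simp
    also have "\<dots> = det (1\<^sub>m (n1 + n2) - K * (block_diag n1 n2 (1 / u) (1 / v) * block_diag n1 n2 x y))"
      unfolding K(2) block_diag_mult ..
    also have "K * (block_diag n1 n2 (1 / u) (1 / v) * block_diag n1 n2 x y) = K' * block_diag n1 n2 x y"
      unfolding K'_def by (rule square_mult_assoc[OF Kc, symmetric]) auto
    finally show ?thesis .
  qed
  ultimately show ?thesis unfolding n1_def n2_def by blast
qed

text \<open>With Z' the block matrix at the reflected point, Z Z'^* = I gives Z (I - K Z')^* = Z -
  K^* = - K^* (I - K Z); taking determinants yields the reverse.\<close>

lemma self_reversive_of_determinantal:
  assumes K: "unitary_mat (deg1 p + deg2 p) K"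
    and rep: "\<And>x y. eval2 p x y = det (1\<^sub>m (deg1 p + deg2 p) - K * block_diag (deg1 p) (deg2 p) x y)"
  shows "self_reversive p"
proof -
  define n1 n2 n where "n1 = deg1 p" and "n2 = deg2 p" and "n = n1 + n2"
  have Kc: "K \<in> carrier_mat n n" "mat_adjoint K \<in> carrier_mat n n" and KK: "mat_adjoint K * K = 1\<^sub>m n"
    using K by (auto simp: unitary_mat_def n_def n1_def n2_def)
  \<comment> \<open>The determinant of - K^*, the factor pulled out on the left.\<close>
  define \<alpha> where "\<alpha> = (-1) ^ n * cnj (det K)"
  have "cnj (det K) * det K = 1"
    using det_mult[OF Kc(2,1)] KK Kc(1) by (simp add: det_mat_adjoint)
  then have "norm (det K) = 1"
    by (metis complex_mod_cnj norm_mult norm_one abs_norm_cancel abs_square_eq_1 power2_eq_square)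
  then have norm: "norm \<alpha> = 1" by (simp add: \<alpha>_def norm_mult norm_power)
  have "is_reverse p (smult [:\<alpha>:] p)"
    unfolding is_reverse_def eval2_smult
  proof (intro allI impI)
    fix x y :: complex assume xy: "x \<noteq> 0" "y \<noteq> 0"
    let ?Z = "block_diag n1 n2 x y" and ?Z' = "block_diag n1 n2 (1 / cnj x) (1 / cnj y)"
    have Z: "?Z \<in> carrier_mat n n" "?Z' \<in> carrier_mat n n" by (auto simp: n_def)
    have ZZ: "?Z * mat_adjoint ?Z' = 1\<^sub>m n"
      using xy by (simp add: mat_adjoint_block_diag block_diag_mult block_diag_one n_def)
    let ?E = "1\<^sub>m n - K * ?Z'"
    have KZ': "K * ?Z' \<in> carrier_mat n n" using Kc Z by simp
    have Ec: "?E \<in> carrier_mat n n" by (rule minus_carrier_mat[OF KZ'])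
    have Eadj: "mat_adjoint ?E = 1\<^sub>m n - mat_adjoint ?Z' * mat_adjoint K"
      unfolding mat_adjoint_mult[OF Kc(1) Z(2), symmetric] mat_adjoint_eq[OF Ec] mat_adjoint_eq[OF KZ']
      using carrier_matD[OF KZ'] by (intro eq_matI) auto
    have Za: "mat_adjoint ?Z' \<in> carrier_mat n n" using Z by simp
    have ZK: "mat_adjoint ?Z' * mat_adjoint K \<in> carrier_mat n n" using Za Kc by simp
    have "?Z * mat_adjoint ?E = ?Z - mat_adjoint K"
    proof -
      have "?Z * mat_adjoint ?E = ?Z * 1\<^sub>m n - ?Z * (mat_adjoint ?Z' * mat_adjoint K)"
        unfolding Eadj by (rule mult_minus_distrib_mat[OF Z(1) _ ZK]) simp
      also have "?Z * (mat_adjoint ?Z' * mat_adjoint K) = ?Z * mat_adjoint ?Z' * mat_adjoint K"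
        by (rule square_mult_assoc[OF Z(1) Za Kc(2), symmetric])
      finally show ?thesis unfolding ZZ using right_mult_one_mat[OF Z(1)] left_mult_one_mat[OF Kc(2)] by simp
    qed
    also have "\<dots> = mat_adjoint K * (- 1 \<cdot>\<^sub>m (1\<^sub>m n - K * ?Z))"
    proof -
      have KZ: "K * ?Z \<in> carrier_mat n n" using Kc Z by simp
      have "- 1 \<cdot>\<^sub>m (1\<^sub>m n - K * ?Z) = K * ?Z - 1\<^sub>m n" using carrier_matD[OF KZ] by (intro eq_matI) auto
      then have "mat_adjoint K * (- 1 \<cdot>\<^sub>m (1\<^sub>m n - K * ?Z)) = mat_adjoint K * (K * ?Z) - mat_adjoint K * 1\<^sub>m n"
        using mult_minus_distrib_mat[OF Kc(2) KZ, of "1\<^sub>m n"] by simp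
      also have "mat_adjoint K * (K * ?Z) = mat_adjoint K * K * ?Z"
        by (rule square_mult_assoc[OF Kc(2,1) Z(1), symmetric])
      finally show ?thesis unfolding KK using left_mult_one_mat[OF Z(1)] right_mult_one_mat[OF Kc(2)] by simp
    qed
    finally have eq: "?Z * mat_adjoint ?E = mat_adjoint K * (- 1 \<cdot>\<^sub>m (1\<^sub>m n - K * ?Z))" .
    have M: "1\<^sub>m n - K * ?Z \<in> carrier_mat n n" using Kc Z by (intro minus_carrier_mat square_mult_carrier)
    have "x ^ n1 * y ^ n2 * cnj (det ?E) = det (?Z * mat_adjoint ?E)"
      using det_mult[OF Z(1) mat_adjoint_carrier[OF Ec]] by (simp add: det_block_diag_mat det_mat_adjoint[OF Ec])
    also have "\<dots> = cnj (det K) * ((- 1) ^ n * det (1\<^sub>m n - K * ?Z))"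
      unfolding eq using det_mult[OF Kc(2), of "- 1 \<cdot>\<^sub>m (1\<^sub>m n - K * ?Z)"] M carrier_matD[OF M]
      by (simp add: det_mat_adjoint[OF Kc(1)])
    finally have "x ^ n1 * y ^ n2 * cnj (det ?E) = \<alpha> * det (1\<^sub>m n - K * ?Z)" by (simp add: \<alpha>_def)
    then show "\<alpha> * eval2 p x y = x ^ deg1 p * y ^ deg2 p * cnj (eval2 p (1 / cnj x) (1 / cnj y))"
      unfolding rep n_def n1_def n2_def by simp
  qed
  then have "reverse p = smult [:\<alpha>:] p"
    using ex1_is_reverse is_reverse_reverse by blast
  then show ?thesis using norm by (auto simp: self_reversive_def)
qed

theorem theorem3p2:
  fixes p :: bipoly and n1 n2 :: nat
  assumes "semi_stable p"
    and "(deg1 p, deg2 p) = (n1, n2)"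
    and "(n1, n2) \<noteq> (0, 0)"
    and "eval2 p 0 0 = 1"
  shows "self_reversive p \<longleftrightarrow>
    (\<exists>K :: complex mat. unitary_mat (n1 + n2) K \<and>
      (\<forall>z1 z2. eval2 p z1 z2 = det (1\<^sub>m (n1 + n2) - K * Z_mat n1 n2 z1 z2)))"
proof -
  have n: "n1 = deg1 p" "n2 = deg2 p" using assms(2) by auto
  show ?thesis unfolding n Z_mat_eq_block_diag
    using determinantal_of_self_reversive[OF assms(1,4)] self_reversive_of_determinantal by blast
qed

end
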